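(* Let $(\Sigma_1,g_1)$ and $(\Sigma_2,g_2)$ be connected, complete, oriented Riemannian 2-manifolds with Gauss curvatures $\kappa(g_1)$ and $\kappa(g_2)$, let $\epsilon\in\{1,-1\}$, and let $(G^{\epsilon},J,\Omega^{\epsilon})$ be the canonical Kähler product structure on $\Sigma_1\times\Sigma_2$. Assume that one of the following holds: (i) the metrics $g_1$ and $g_2$ are both generically non-flat and $\epsilon\,\kappa(g_1)\kappa(g_2)<0$ away from flat points (i.e. $\epsilon\,\kappa(g_1)(x)\,\kappa(g_2)(y)<0$ whenever $\kappa(g_1)(x)\neq0$ and $\kappa(g_2)(y)\neq 0$); (ii) only one of the metrics $g_1$ and $g_2$ is flat, while the other is generically non-flat. Then every $G^{\epsilon}$-minimal Lagrangian surface in $\Sigma_1\times\Sigma_2$ is of projected rank one.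
   Context: For $k=1,2$, $j_k$ is the rotation by $+\pi/2$ in $T\Sigma_k$ and $\omega_k(\cdot,\cdot)=g_k(j_k\cdot,\cdot)$. Let $\pi_i:\Sigma_1\times\Sigma_2\to\Sigma_i$ be the projections. The canonical Kähler product structure is $G^{\epsilon}=\pi_1^{*}g_1+\epsilon\,\pi_2^{*}g_2$, $\Omega^{\epsilon}=\pi_1^{*}\omega_1+\epsilon\,\pi_2^{*}\omega_2$, $J=j_1\oplus j_2$. A generic property is one that holds almost everywhere; a flat point is a point where the Gauss curvature vanishes; generically non-flat means the Gauss curvature is nonzero almost everywhere. An immersion $\Phi:S\to\Sigma_1\times\Sigma_2$ of a surface is Lagrangian if $\Phi^{*}\Omega^{\epsilon}=0$, and it is $G^{\epsilon}$-minimal if the induced metric $\Phi^{*}G^{\epsilon}$ is nondegenerate and its mean curvature vector (trace of the second fundamental form with respect to $G^{\epsilon}$) vanishes. Write $\Phi=(\phi,\psi)$ with $\phi=\pi_1\circ\Phi$, $\psi=\pi_2\circ\Phi$; the rank of a map at a point is the rank of its derivative there. $\Phi$ is of projected rank one at $p$ if $\mathrm{rank}(\phi)=1$ or $\mathrm{rank}(\psi)=1$ at $p$, and of projected rank one if this holds at every $p\in S$. *)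

theory Defs
  imports "HOL-Analysis.Analysis"
begin

section \<open>Smooth functions on open subsets of Euclidean spaces\<close>

text \<open>These notions are meant for open sets only.\<close>

primrec Ck_on :: "nat \<Rightarrow> 'e::euclidean_space set \<Rightarrow> ('e \<Rightarrow> 'f::real_normed_vector) \<Rightarrow> bool" where
  "Ck_on 0 U f \<longleftrightarrow> continuous_on U f"
| "Ck_on (Suc k) U f \<longleftrightarrow>
     (\<forall>y\<in>U. f differentiable (at y)) \<and> (\<forall>u. Ck_on k U (\<lambda>y. frechet_derivative f (at y) u))"

definition smooth_on :: "'e::euclidean_space set \<Rightarrow> ('e \<Rightarrow> 'f::real_normed_vector) \<Rightarrow> bool" where
  "smooth_on U f \<longleftrightarrow> (\<forall>k. Ck_on k U f)"


section \<open>Pseudo-Riemannian metrics in coordinates\<close>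

text \<open>A coordinate metric \<open>h\<close> assigns to every point of an open subset of a Euclidean space a
  symmetric nondegenerate bilinear form.\<close>

type_synonym 'e coord_metric = "'e \<Rightarrow> 'e \<Rightarrow> 'e \<Rightarrow> real"

text \<open>The Levi-Civita connection is \<open>\<nabla>\<^sub>u v = D\<^sub>u v + \<Gamma>(u, v)\<close>, where \<open>\<Gamma>\<close> is determined by the
  Koszul formula for the constant (hence commuting) vector fields \<open>u\<close>, \<open>v\<close>, \<open>z\<close>.\<close>

definition christoffel :: "'e::euclidean_space coord_metric \<Rightarrow> 'e \<Rightarrow> 'e \<Rightarrow> 'e \<Rightarrow> 'e" where
  "christoffel h y u v = (THE w. \<forall>z. 2 * h y w z =
      frechet_derivative (\<lambda>y. h y v z) (at y) u
    + frechet_derivative (\<lambda>y. h y u z) (at y) v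
    - frechet_derivative (\<lambda>y. h y u v) (at y) z)"

text \<open>\<open>R(u, v) w = \<nabla>\<^sub>u \<nabla>\<^sub>v w - \<nabla>\<^sub>v \<nabla>\<^sub>u w\<close> for constant fields \<open>u\<close>, \<open>v\<close>, \<open>w\<close>.\<close>

definition riemann_curvature ::
  "'e::euclidean_space coord_metric \<Rightarrow> 'e \<Rightarrow> 'e \<Rightarrow> 'e \<Rightarrow> 'e \<Rightarrow> 'e" where
  "riemann_curvature h y u v w =
      frechet_derivative (\<lambda>y. christoffel h y v w) (at y) u
    + christoffel h y u (christoffel h y v w)
    - frechet_derivative (\<lambda>y. christoffel h y u w) (at y) v
    - christoffel h y v (christoffel h y u w)"

definition coord_gauss_curvature :: "(real^2) coord_metric \<Rightarrow> real^2 \<Rightarrow> real" where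
  "coord_gauss_curvature h y = (let e1 = axis 1 1; e2 = axis 2 1 in
     h y (riemann_curvature h y e1 e2 e2) e1 / (h y e1 e1 * h y e2 e2 - (h y e1 e2)\<^sup>2))"

text \<open>The component of \<open>w\<close> in the orthogonal complement of the subspace \<open>T\<close>; it is well defined
  whenever \<open>b\<close> is nondegenerate on \<open>T\<close>.\<close>

definition normal_part :: "('f::euclidean_space \<Rightarrow> 'f \<Rightarrow> real) \<Rightarrow> 'f set \<Rightarrow> 'f \<Rightarrow> 'f" where
  "normal_part b T w = (THE n. w - n \<in> T \<and> (\<forall>t\<in>T. b n t = 0))"

definition second_fundamental_form ::
  "'f::euclidean_space coord_metric \<Rightarrow> ('e::euclidean_space \<Rightarrow> 'f) \<Rightarrow> 'e \<Rightarrow> 'e \<Rightarrow> 'e \<Rightarrow> 'f" where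
  "second_fundamental_form h F y u v = (let D = frechet_derivative F (at y) in
     normal_part (h (F y)) (range D)
       (frechet_derivative (\<lambda>y. frechet_derivative F (at y) v) (at y) u
          + christoffel h (F y) (D u) (D v)))"

definition mean_curvature_vector ::
  "'f::euclidean_space coord_metric \<Rightarrow> (real^'n \<Rightarrow> 'f) \<Rightarrow> real^'n \<Rightarrow> 'f" where
  "mean_curvature_vector h F y = (let D = frechet_derivative F (at y);
     gram = (\<chi> i j. h (F y) (D (axis i 1)) (D (axis j 1))) :: real^'n^'n in
     \<Sum>i\<in>UNIV. \<Sum>j\<in>UNIV.
       (matrix_inv gram $ i $ j) *\<^sub>R second_fundamental_form h F y (axis i 1) (axis j 1))"


section \<open>Smooth manifolds\<close>

text \<open>A chart is a domain together with a coordinate map, which matters on the domain only.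
  A smooth structure is given by any compatible atlas, not necessarily a maximal one; all notions
  below depend only on the smooth structure which the atlas generates (for oriented surfaces: on
  the oriented smooth structure).\<close>

type_synonym ('a, 'e) chart = "'a set \<times> ('a \<Rightarrow> 'e)"

abbreviation chart_dom :: "('a, 'e) chart \<Rightarrow> 'a set" where
  "chart_dom c \<equiv> fst c"

abbreviation chart_map :: "('a, 'e) chart \<Rightarrow> 'a \<Rightarrow> 'e" where
  "chart_map c \<equiv> snd c"

definition chart_inv :: "('a, 'e) chart \<Rightarrow> 'e \<Rightarrow> 'a" where
  "chart_inv c = inv_into (chart_dom c) (chart_map c)"

definition coord_expr :: "('a, 'e) chart \<Rightarrow> ('b, 'f) chart \<Rightarrow> ('a \<Rightarrow> 'b) \<Rightarrow> 'e \<Rightarrow> 'f" where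
  "coord_expr c d f = chart_map d \<circ> f \<circ> chart_inv c"

definition chart_at :: "('a, 'e) chart set \<Rightarrow> 'a \<Rightarrow> ('a, 'e) chart" where
  "chart_at A p = (SOME c. c \<in> A \<and> p \<in> chart_dom c)"

locale smooth_manifold =
  fixes X :: "'a topology" and A :: "('a, 'e::euclidean_space) chart set"
  assumes Hausdorff: "Hausdorff_space X"
    and second_countable: "second_countable X"
    and openin_chart_dom: "\<And>c. c \<in> A \<Longrightarrow> openin X (chart_dom c)"
    and open_chart_image: "\<And>c. c \<in> A \<Longrightarrow> open (chart_map c ` chart_dom c)"
    and chart_homeomorphic: "\<And>c. c \<in> A \<Longrightarrow>
      homeomorphic_map (subtopology X (chart_dom c))
        (top_of_set (chart_map c ` chart_dom c)) (chart_map c)"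
    and charts_cover: "(\<Union>c\<in>A. chart_dom c) = topspace X"
    and smooth_transition: "\<And>c d. c \<in> A \<Longrightarrow> d \<in> A \<Longrightarrow>
      smooth_on (chart_map c ` (chart_dom c \<inter> chart_dom d)) (coord_expr c d id)"

definition smooth_map ::
  "'a topology \<Rightarrow> ('a, 'e::euclidean_space) chart set \<Rightarrow>
   'b topology \<Rightarrow> ('b, 'f::euclidean_space) chart set \<Rightarrow> ('a \<Rightarrow> 'b) \<Rightarrow> bool" where
  "smooth_map X A Y B f \<longleftrightarrow> continuous_map X Y f \<and>
     (\<forall>c\<in>A. \<forall>d\<in>B. smooth_on (chart_map c ` (chart_dom c \<inter> f -` chart_dom d)) (coord_expr c d f))"

definition prod_atlas ::
  "('a, 'e) chart set \<Rightarrow> ('b, 'f) chart set \<Rightarrow> ('a \<times> 'b, 'e \<times> 'f) chart set" where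
  "prod_atlas A B =
     (\<lambda>(c, d). (chart_dom c \<times> chart_dom d, map_prod (chart_map c) (chart_map d))) ` (A \<times> B)"

definition rank_at ::
  "('a, 'e::euclidean_space) chart set \<Rightarrow> ('b, 'f::euclidean_space) chart set \<Rightarrow>
   ('a \<Rightarrow> 'b) \<Rightarrow> 'a \<Rightarrow> nat" where
  "rank_at A B f p = (let c = chart_at A p; d = chart_at B (f p) in
     dim (range (frechet_derivative (coord_expr c d f) (at (chart_map c p)))))"

text \<open>Null sets of a manifold are the sets with Lebesgue null image in every chart; these are the
  null sets of the volume measure of any Riemannian metric.\<close>

definition holds_almost_everywhere ::
  "('a, 'e::euclidean_space) chart set \<Rightarrow> ('a \<Rightarrow> bool) \<Rightarrow> bool" where
  "holds_almost_everywhere A P \<longleftrightarrow>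
     (\<forall>c\<in>A. negligible (chart_map c ` {p \<in> chart_dom c. \<not> P p}))"


section \<open>Tangent vectors and tensors\<close>

text \<open>A tangent vector at \<open>p\<close> is a directional derivative at \<open>p\<close>, acting on functions that are
  differentiable at \<open>p\<close>. It is set to \<open>0\<close> on all other functions, so that equality of tangent
  vectors is equality of operators and does not depend on charts.\<close>

type_synonym 'a tangent = "('a \<Rightarrow> real) \<Rightarrow> real"

text \<open>A covariant tensor of rank two; only its values on tangent vectors are relevant.\<close>

type_synonym 'a tensor2 = "'a \<Rightarrow> 'a tangent \<Rightarrow> 'a tangent \<Rightarrow> real"

text \<open>\<open>coord_vector c p u\<close> is the tangent vector at \<open>p\<close> with components \<open>u\<close> in the chart \<open>c\<close>.\<close>

definition coord_vector ::
  "('a, 'e::euclidean_space) chart \<Rightarrow> 'a \<Rightarrow> 'e \<Rightarrow> 'a tangent" where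
  "coord_vector c p u = (\<lambda>f. if (f \<circ> chart_inv c) differentiable (at (chart_map c p))
     then frechet_derivative (f \<circ> chart_inv c) (at (chart_map c p)) u else 0)"

definition tangent_space ::
  "('a, 'e::euclidean_space) chart set \<Rightarrow> 'a \<Rightarrow> 'a tangent set" where
  "tangent_space A p = {coord_vector c p u | c u. c \<in> A \<and> p \<in> chart_dom c}"

definition differentiable_at_point ::
  "('a, 'e::euclidean_space) chart set \<Rightarrow> 'a \<Rightarrow> ('a \<Rightarrow> real) \<Rightarrow> bool" where
  "differentiable_at_point A p f \<longleftrightarrow>
     (\<forall>c\<in>A. p \<in> chart_dom c \<longrightarrow> (f \<circ> chart_inv c) differentiable (at (chart_map c p)))"

text \<open>The derivative at \<open>p\<close> of a map \<open>F\<close> into a manifold with atlas \<open>B\<close>.\<close>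

definition pushforward ::
  "('b, 'f::euclidean_space) chart set \<Rightarrow> ('a \<Rightarrow> 'b) \<Rightarrow> 'a \<Rightarrow> 'a tangent \<Rightarrow> 'b tangent" where
  "pushforward B F p v = (\<lambda>f. if differentiable_at_point B (F p) f then v (f \<circ> F) else 0)"

definition pullback ::
  "('b, 'f::euclidean_space) chart set \<Rightarrow> ('a \<Rightarrow> 'b) \<Rightarrow> 'b tensor2 \<Rightarrow> 'a tensor2" where
  "pullback B F t p v w = t (F p) (pushforward B F p v) (pushforward B F p w)"

definition tensor_in_chart ::
  "('a, 'e::euclidean_space) chart \<Rightarrow> 'a tensor2 \<Rightarrow> 'e coord_metric" where
  "tensor_in_chart c t y u v =
     t (chart_inv c y) (coord_vector c (chart_inv c y) u) (coord_vector c (chart_inv c y) v)"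

definition immersion ::
  "'a topology \<Rightarrow> ('a, 'e::euclidean_space) chart set \<Rightarrow>
   'b topology \<Rightarrow> ('b, 'f::euclidean_space) chart set \<Rightarrow> ('a \<Rightarrow> 'b) \<Rightarrow> bool" where
  "immersion X A Y B F \<longleftrightarrow> smooth_map X A Y B F \<and>
     (\<forall>p\<in>topspace X. inj_on (pushforward B F p) (tangent_space A p))"


section \<open>Oriented Riemannian surfaces\<close>

text \<open>The orientation is the one for which all charts of the atlas are positively oriented.\<close>

locale oriented_riemannian_surface = smooth_manifold X A
  for X :: "'a topology" and A :: "('a, real^2) chart set" +
  fixes g :: "'a tensor2"
  assumes oriented: "\<And>c d p. c \<in> A \<Longrightarrow> d \<in> A \<Longrightarrow> p \<in> chart_dom c \<Longrightarrow> p \<in> chart_dom d \<Longrightarrow>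
      det (matrix (frechet_derivative (coord_expr c d id) (at (chart_map c p)))) > 0"
    and metric_smooth: "\<And>c u v. c \<in> A \<Longrightarrow>
      smooth_on (chart_map c ` chart_dom c) (\<lambda>y. tensor_in_chart c g y u v)"
    and metric_bilinear: "\<And>c y. c \<in> A \<Longrightarrow> y \<in> chart_map c ` chart_dom c \<Longrightarrow>
      bilinear (tensor_in_chart c g y)"
    and metric_sym: "\<And>c y u v. c \<in> A \<Longrightarrow> y \<in> chart_map c ` chart_dom c \<Longrightarrow>
      tensor_in_chart c g y u v = tensor_in_chart c g y v u"
    and metric_pos: "\<And>c y u. c \<in> A \<Longrightarrow> y \<in> chart_map c ` chart_dom c \<Longrightarrow> u \<noteq> 0 \<Longrightarrow>
      tensor_in_chart c g y u u > 0"

definition positively_oriented ::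
  "('a, real^2) chart set \<Rightarrow> 'a \<Rightarrow> 'a tangent \<Rightarrow> 'a tangent \<Rightarrow> bool" where
  "positively_oriented A p v w \<longleftrightarrow> (\<exists>c\<in>A. \<exists>a b. p \<in> chart_dom c \<and>
     v = coord_vector c p a \<and> w = coord_vector c p b \<and> det (vector [a, b] :: real^2^2) > 0)"

text \<open>The rotation by \<open>+\<pi>/2\<close>.\<close>

definition rotation ::
  "('a, real^2) chart set \<Rightarrow> 'a tensor2 \<Rightarrow> 'a \<Rightarrow> 'a tangent \<Rightarrow> 'a tangent" where
  "rotation A g p v = (THE w. w \<in> tangent_space A p \<and> g p w w = g p v v \<and> g p v w = 0 \<and>
     (v \<noteq> (\<lambda>f. 0) \<longrightarrow> positively_oriented A p v w))"

definition kahler_form :: "('a, real^2) chart set \<Rightarrow> 'a tensor2 \<Rightarrow> 'a tensor2" where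
  "kahler_form A g p v w = g p (rotation A g p v) w"

text \<open>The Gauss curvature does not depend on the chart, so the choice in \<open>chart_at\<close> is immaterial.\<close>

definition gauss_curvature :: "('a, real^2) chart set \<Rightarrow> 'a tensor2 \<Rightarrow> 'a \<Rightarrow> real" where
  "gauss_curvature A g p = (let c = chart_at A p in
     coord_gauss_curvature (tensor_in_chart c g) (chart_map c p))"

definition flat_metric :: "'a topology \<Rightarrow> ('a, real^2) chart set \<Rightarrow> 'a tensor2 \<Rightarrow> bool" where
  "flat_metric X A g \<longleftrightarrow> (\<forall>p\<in>topspace X. gauss_curvature A g p = 0)"

definition generically_non_flat :: "('a, real^2) chart set \<Rightarrow> 'a tensor2 \<Rightarrow> bool" where
  "generically_non_flat A g \<longleftrightarrow> holds_almost_everywhere A (\<lambda>p. gauss_curvature A g p \<noteq> 0)"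

text \<open>Completeness is geodesic completeness: every tangent vector is the initial velocity of a
  geodesic which is defined on the whole real line.\<close>

definition geodesic ::
  "'a topology \<Rightarrow> ('a, 'e::euclidean_space) chart set \<Rightarrow> 'a tensor2 \<Rightarrow> (real \<Rightarrow> 'a) \<Rightarrow> bool" where
  "geodesic X A g \<gamma> \<longleftrightarrow> continuous_map euclideanreal X \<gamma> \<and>
     (\<forall>c\<in>A. \<forall>t. \<gamma> t \<in> chart_dom c \<longrightarrow>
        (let x = chart_map c \<circ> \<gamma>; x' = (\<lambda>s. vector_derivative x (at s)) in
           x differentiable (at t) \<and>
           (x' has_vector_derivative
              - christoffel (tensor_in_chart c g) (x t) (x' t) (x' t)) (at t)))"

definition geodesically_complete ::
  "'a topology \<Rightarrow> ('a, 'e::euclidean_space) chart set \<Rightarrow> 'a tensor2 \<Rightarrow> bool" where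
  "geodesically_complete X A g \<longleftrightarrow>
     (\<forall>p\<in>topspace X. \<forall>c\<in>A. p \<in> chart_dom c \<longrightarrow> (\<forall>u. \<exists>\<gamma>. geodesic X A g \<gamma> \<and> \<gamma> 0 = p \<and>
        ((chart_map c \<circ> \<gamma>) has_vector_derivative u) (at 0)))"


section \<open>Minimal Lagrangian surfaces in products\<close>

text \<open>\<open>\<pi>\<^sub>1\<^sup>* t1 + \<epsilon> \<pi>\<^sub>2\<^sup>* t2\<close>\<close>

definition prod_tensor ::
  "real \<Rightarrow> ('a, 'e::euclidean_space) chart set \<Rightarrow> 'a tensor2 \<Rightarrow>
   ('b, 'f::euclidean_space) chart set \<Rightarrow> 'b tensor2 \<Rightarrow> ('a \<times> 'b) tensor2" where
  "prod_tensor \<epsilon> A t1 B t2 z v w = pullback A fst t1 z v w + \<epsilon> * pullback B snd t2 z v w"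

definition kahler_product_metric ::
  "real \<Rightarrow> ('a, real^2) chart set \<Rightarrow> 'a tensor2 \<Rightarrow> ('b, real^2) chart set \<Rightarrow> 'b tensor2 \<Rightarrow>
   ('a \<times> 'b) tensor2" where
  "kahler_product_metric \<epsilon> A g1 B g2 = prod_tensor \<epsilon> A g1 B g2"

definition kahler_product_form ::
  "real \<Rightarrow> ('a, real^2) chart set \<Rightarrow> 'a tensor2 \<Rightarrow> ('b, real^2) chart set \<Rightarrow> 'b tensor2 \<Rightarrow>
   ('a \<times> 'b) tensor2" where
  "kahler_product_form \<epsilon> A g1 B g2 = prod_tensor \<epsilon> A (kahler_form A g1) B (kahler_form B g2)"

definition lagrangian ::
  "'c topology \<Rightarrow> ('c, 'e::euclidean_space) chart set \<Rightarrow> ('b, 'f::euclidean_space) chart set \<Rightarrow>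
   'b tensor2 \<Rightarrow> ('c \<Rightarrow> 'b) \<Rightarrow> bool" where
  "lagrangian S C B \<Omega> F \<longleftrightarrow>
     (\<forall>p\<in>topspace S. \<forall>v\<in>tangent_space C p. \<forall>w\<in>tangent_space C p. pullback B F \<Omega> p v w = 0)"

definition nondegenerate ::
  "'c topology \<Rightarrow> ('c, 'e::euclidean_space) chart set \<Rightarrow> 'c tensor2 \<Rightarrow> bool" where
  "nondegenerate S C t \<longleftrightarrow> (\<forall>p\<in>topspace S. \<forall>v\<in>tangent_space C p.
     (\<forall>w\<in>tangent_space C p. t p v w = 0) \<longrightarrow> v = (\<lambda>f. 0))"

definition minimal ::
  "'c topology \<Rightarrow> ('c, real^2) chart set \<Rightarrow> ('b, 'f::euclidean_space) chart set \<Rightarrow>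
   'b tensor2 \<Rightarrow> ('c \<Rightarrow> 'b) \<Rightarrow> bool" where
  "minimal S C B G F \<longleftrightarrow> nondegenerate S C (pullback B F G) \<and>
     (\<forall>p\<in>topspace S. \<forall>c\<in>C. \<forall>d\<in>B. p \<in> chart_dom c \<longrightarrow> F p \<in> chart_dom d \<longrightarrow>
        mean_curvature_vector (tensor_in_chart d G) (coord_expr c d F) (chart_map c p) = 0)"

definition projected_rank_one_at ::
  "('c, real^2) chart set \<Rightarrow> ('a, real^2) chart set \<Rightarrow> ('b, real^2) chart set \<Rightarrow>
   ('c \<Rightarrow> 'a \<times> 'b) \<Rightarrow> 'c \<Rightarrow> bool" where
  "projected_rank_one_at C A B F p \<longleftrightarrow> rank_at C A (fst \<circ> F) p = 1 \<or> rank_at C B (snd \<circ> F) p = 1"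

definition projected_rank_one ::
  "'c topology \<Rightarrow> ('c, real^2) chart set \<Rightarrow> ('a, real^2) chart set \<Rightarrow> ('b, real^2) chart set \<Rightarrow>
   ('c \<Rightarrow> 'a \<times> 'b) \<Rightarrow> bool" where
  "projected_rank_one S C A B F \<longleftrightarrow> (\<forall>p\<in>topspace S. projected_rank_one_at C A B F p)"

end

theory Submission
  imports Defs
begin

text \<open>Where the projected rank is not one, the Lagrangian condition and nondegeneracy make both
  \<open>\<phi>\<close> and \<open>\<psi>\<close> local diffeomorphisms. Put \<open>h = \<phi>\<^sup>*g\<^sub>1\<close> and \<open>k = \<epsilon> \<psi>\<^sup>*g\<^sub>2\<close>, so that the induced metric is
  \<open>G = h + k\<close>, and let \<open>T\<close> be the difference of the Levi-Civita connections of \<open>h\<close> and \<open>k\<close>. The Lagrangian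
  condition says \<open>det h = det k\<close>, whence \<open>T\<close> has vanishing contraction; minimality says that the
  \<open>G\<close>-trace of \<open>T\<close> vanishes. Tracing the difference of the Ricci tensors with respect to \<open>G\<close> then
  yields \<open>\<kappa>(g\<^sub>1) \<circ> \<phi> = \<epsilon> \<kappa>(g\<^sub>2) \<circ> \<psi>\<close> near such a point, which contradicts either hypothesis on the
  curvatures, because the images of an open set under \<open>\<phi>\<close> and \<open>\<psi>\<close> are not null sets.\<close>


text \<open>The curvatures are subtracted around the mean connection \<open>m\<close>: for
  \<open>m + T/2\<close> and \<open>m - T/2\<close> the terms \<open>mm\<close> and
  \<open>TT\<close> cancel, and since the contraction of \<open>T\<close> vanishes, the Ricci
  difference is the \<open>m\<close>-divergence of \<open>T\<close>. Its \<open>G\<close>-trace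
  would be the divergence of the vanishing \<open>G\<close>-trace of \<open>T\<close> if
  \<open>m\<close> preserved \<open>G\<close>. The obstacle is that it does not: each connection
  preserves only its own metric, so the \<open>m\<close>-derivative of \<open>G\<close> is
  \<open>T/2\<close> acting on \<open>h - k\<close>. The resulting error is a multiple of a 3 by 3
  determinant, and it vanishes because \<open>det h = det k\<close> puts \<open>h - k\<close> into
  the same plane as the two components of \<open>T\<close>. The same equality makes the
  \<open>G\<close>-traces of \<open>h\<close> and \<open>k\<close> equal to 1, and as the Ricci
  tensor of a surface is its curvature times its metric, what remains is the difference of the
  curvatures. The contraction of \<open>T\<close> vanishes because the contraction of a Levi-Civita
  connection is half the logarithmic derivative of the determinant of its metric. Of
  \<open>G\<close> only nondegeneracy enters, so the indefinite case \<open>\<epsilon> = - 1\<close>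
  runs along with the definite one.\<close>

section \<open>Two connections in the plane with traceless difference\<close>

text \<open>In the next two lemmas \<open>(a, b, c)\<close> are the components 11, 12, 22 of \<open>G = h + k\<close>, while \<open>(x, y, r)\<close> and
  \<open>(s, -x, -y)\<close> are those of \<open>T\<^sup>1\<close> and \<open>T\<^sup>2\<close>, so that the contraction of \<open>T\<close> vanishes; the first two
  hypotheses say that both are orthogonal to the adjugate of \<open>G\<close>. The connections are \<open>m + T/2\<close> and
  \<open>m - T/2\<close>, and \<open>h - k\<close> has components \<open>(e, f, g)\<close>.\<close>

lemma curvature_identity_mean_part:
  fixes a b c :: real
  assumes "c*x - 2*b*y + a*r = 0" "c * s + 2*b*x - a*y = 0"
  assumes da: "da1 = 2*(m111*a+m211*b)" "da2 = 2*(m112*a+m212*b)"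
  assumes dc: "dc1 = 2*(m112*b+m212*c)" "dc2 = 2*(m122*b+m222*c)"
  assumes db: "db1 = m111*b+m211*c+m112*a+m212*b" "db2 = m112*b+m212*c+m122*a+m222*b"
  shows "-(dc1*x - 2*db1*y+da1*r + dc2 * s + 2*db2*x - da2*y)
   + a*((m111*r+m112*(-y)-(m112*y+m122*(-x))) + (x*m122+y*m222 - (y*m112+r*m212)))
   - b*((m111*y+m112*(-x)-(m112*x+m122 * s)) + (x*m112+y*m212 - (y*m111+r*m211)))
   - c*((m211*y+m212*(-x)-(m212*x+m222 * s)) + (s*m112+(-x)*m212 - ((-x)*m111+(-y)*m211)))
   + b*((m211*r+m212*(-y)-(m212*y+m222*(-x))) + (s*m122+(-x)*m222 - ((-x)*m112+(-y)*m212))) = 0"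
  using assms by algebra

text \<open>\<open>T\<^sup>1\<close>, \<open>T\<^sup>2\<close> and \<open>h - k\<close> lie in the plane orthogonal to the adjugate of \<open>G\<close>, so they are linearly
  dependent; the left-hand side below is four times their determinant.\<close>

lemma curvature_identity_difference_part:
  fixes a b c :: real
  assumes "c*x - 2*b*y + a*r = 0" "c * s + 2*b*x - a*y = 0" "c*e-2*b*f+a*g=0" "a*c-b*b\<noteq>0"
  assumes da: "da1 = 2*(x*e+s*f)" "da2 = 2*(y*e-x*f)"
  assumes dc: "dc1 = 2*(y*f-x*g)" "dc2 = 2*(r*f-y*g)"
  assumes db: "db1 = x*f+s*g+y*e-x*f" "db2 = y*f-x*g+r*e-y*f"
  shows "(dc1*x - 2*db1*y+da1*r + dc2 * s + 2*db2*x - da2*y) = 0"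
proof -
  let ?Q = "(dc1*x - 2*db1*y+da1*r + dc2 * s + 2*db2*x - da2*y)"
  \<comment> \<open>The row \<open>(c, -2b, a)\<close> annihilates all three vectors, so each of its
    entries times their determinant is zero; \<open>a*c-b*b \<noteq> 0\<close> prevents
    \<open>a\<close>, \<open>b\<close>, \<open>c\<close> from vanishing together.\<close>
  have "a*?Q=0" "b * ?Q = 0" "c*?Q=0" using assms(1-3) unfolding da dc db by algebra+
  then show ?thesis using assms(4) by auto
qed

text \<open>For symmetric \<open>A\<close>, \<open>mixed_det A A = 2 det A\<close>.\<close>

definition mixed_det :: "(2 \<Rightarrow> 2 \<Rightarrow> real) \<Rightarrow> (2 \<Rightarrow> 2 \<Rightarrow> real) \<Rightarrow> real" where
  "mixed_det A B = A 2 2 * B 1 1 - 2 * A 1 2 * B 1 2 + A 1 1 * B 2 2"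

text \<open>\<open>c l i j\<close> stands for \<open>\<Gamma>\<^sup>l\<^sub>i\<^sub>j\<close>, \<open>d u l i j\<close> for its derivative in direction \<open>u\<close>, and \<open>dG\<close> for the derivative
  of \<open>G\<close> as given by metric compatibility.\<close>

lemma curvature_eq_of_traceless_difference:
  fixes h k :: "2 \<Rightarrow> 2 \<Rightarrow> real" and c1 c2 :: "2 \<Rightarrow> 2 \<Rightarrow> 2 \<Rightarrow> real"
    and d1 d2 :: "2 \<Rightarrow> 2 \<Rightarrow> 2 \<Rightarrow> 2 \<Rightarrow> real"
  defines "G \<equiv> \<lambda>i j. h i j + k i j"
    and "dG \<equiv> \<lambda>u i j. (\<Sum>l\<in>UNIV. c1 l u i * h l j + c1 l u j * h i l)
                        + (\<Sum>l\<in>UNIV. c2 l u i * k l j + c2 l u j * k i l)"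
  assumes sym: "h 2 1 = h 1 2" "k 2 1 = k 1 2" "\<And>l. c1 l 2 1 = c1 l 1 2" "\<And>l. c2 l 2 1 = c2 l 1 2"
      "\<And>u l. d1 u l 2 1 = d1 u l 1 2" "\<And>u l. d2 u l 2 1 = d2 u l 1 2"
    and det: "mixed_det h h = mixed_det k k"
    and nondeg: "mixed_det G G \<noteq> 0"
    and trace: "\<And>j. (\<Sum>l\<in>UNIV. c1 l l j) = (\<Sum>l\<in>UNIV. c2 l l j)"
    and dtrace: "\<And>u j. (\<Sum>l\<in>UNIV. d1 u l l j) = (\<Sum>l\<in>UNIV. d2 u l l j)"
    and min: "\<And>l. mixed_det G (\<lambda>i j. c1 l i j - c2 l i j) = 0"
    and dmin: "\<And>u l. mixed_det (dG u) (\<lambda>i j. c1 l i j - c2 l i j)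
                     + mixed_det G (\<lambda>i j. d1 u l i j - d2 u l i j) = 0"
    and curv1: "\<And>l w. d1 1 l 2 w - d1 2 l 1 w + (\<Sum>m\<in>UNIV. c1 l 1 m * c1 m 2 w - c1 l 2 m * c1 m 1 w)
                  = K1 * (if l = 1 then h 2 w else - h 1 w)"
    and curv2: "\<And>l w. d2 1 l 2 w - d2 2 l 1 w + (\<Sum>m\<in>UNIV. c2 l 1 m * c2 m 2 w - c2 l 2 m * c2 m 1 w)
                  = K2 * (if l = 1 then k 2 w else - k 1 w)"
  shows "K1 = K2"
proof -
  define a b c where abc: "a = G 1 1" "b = G 1 2" "c = G 2 2"
  define e f g where efg: "e = h 1 1 - k 1 1" "f = h 1 2 - k 1 2" "g = h 2 2 - k 2 2"
  define t where t: "t l i j = c1 l i j - c2 l i j" for l i j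
  define m where m: "m l i j = (c1 l i j + c2 l i j) / 2" for l i j
  define dt where dt: "dt u l i j = d1 u l i j - d2 u l i j" for u l i j
  have hk: "h 1 1 = (a + e) / 2" "h 1 2 = (b + f) / 2" "h 2 2 = (c + g) / 2"
      "k 1 1 = (a - e) / 2" "k 1 2 = (b - f) / 2" "k 2 2 = (c - g) / 2"
    unfolding abc efg G_def by simp_all
  have c12: "c1 l i j = m l i j + t l i j / 2" "c2 l i j = m l i j - t l i j / 2" for l i j
    unfolding m t by (simp_all add: field_simps)
  have d12: "d1 u l i j = dt u l i j + d2 u l i j" for u l i j unfolding dt by simp
  define x y r s where xyrs: "x = t 1 1 1" "y = t 1 1 2" "r = t 1 2 2" "s = t 2 1 1"
  have tsym: "t l 2 1 = t l 1 2" "m l 2 1 = m l 1 2" "dt u l 2 1 = dt u l 1 2" for u l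
    unfolding t m dt using sym by auto
  have t': "t 2 1 2 = - x" "t 2 2 2 = - y"
    using trace[of 1] trace[of 2] sym unfolding xyrs t by (simp_all add: sum_2)
  have dt': "dt u 2 1 2 = - dt u 1 1 1" "dt u 2 2 2 = - dt u 1 1 2" for u
    using dtrace[of u 1] dtrace[of u 2] sym unfolding dt by (simp_all add: sum_2)
  have T: "c * x - 2 * b * y + a * r = 0" "c * s + 2 * b * x - a * y = 0"
    using min[of 1] min[of 2] unfolding mixed_det_def
    by (simp_all add: abc[symmetric] t[symmetric] xyrs[symmetric] t' tsym)
  \<comment> \<open>Polarization: \<open>mixed_det\<close> is a symmetric bilinear form, so equal
    values on \<open>h\<close> and \<open>k\<close> make \<open>h + k\<close> and
    \<open>h - k\<close> orthogonal for it.\<close>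
  have H: "c * e - 2 * b * f + a * g = 0"
    using det unfolding mixed_det_def hk by (simp add: field_simps)
  have nd: "a * c - b * b \<noteq> 0"
    using nondeg unfolding mixed_det_def abc[symmetric] by (simp add: algebra_simps)
  define da where "da u = dG u 1 1" for u
  define db where "db u = dG u 1 2" for u
  define dc where "dc u = dG u 2 2" for u
  \<comment> \<open>From \<open>(m + t/2) h + (m - t/2) k = m (h + k) + (t/2) (h - k)\<close>: the
    second summand measures how far \<open>m\<close> is from preserving \<open>G\<close>.\<close>
  have dG': "dG u i j = (\<Sum>l\<in>UNIV. m l u i * G l j + m l u j * G i l)
        + (\<Sum>l\<in>UNIV. t l u i * (h l j - k l j) + t l u j * (h i l - k i l)) / 2" for u i j
    unfolding dG_def G_def c12 by (simp add: sum_2 field_simps)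
  define da1 da2 dc1 dc2 db1 db2 where dM:
    "da1 = 2*(m 1 1 1*a+m 2 1 1*b)" "da2 = 2*(m 1 1 2*a+m 2 1 2*b)"
    "dc1 = 2*(m 1 1 2*b+m 2 1 2*c)" "dc2 = 2*(m 1 2 2*b+m 2 2 2*c)"
    "db1 = m 1 1 1*b+m 2 1 1*c+m 1 1 2*a+m 2 1 2*b" "db2 = m 1 1 2*b+m 2 1 2*c+m 1 2 2*a+m 2 2 2*b"
  define ea1 ea2 ec1 ec2 eb1 eb2 where dT:
    "ea1 = 2*(x*e + s * f)" "ea2 = 2*(y*e-x*f)"
    "ec1 = 2*(y*f-x*g)" "ec2 = 2*(r*f-y*g)"
    "eb1 = x*f + s * g+y*e-x*f" "eb2 = y*f-x*g+r*e-y*f"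
  have G21: "G 2 1 = b" "h 2 1 - k 2 1 = f" "h 1 1 - k 1 1 = e" "h 1 2 - k 1 2 = f" "h 2 2 - k 2 2 = g"
    unfolding abc efg G_def using sym by auto
  have ddd: "da 1 = da1 + ea1 / 2" "da 2 = da2 + ea2 / 2" "db 1 = db1 + eb1 / 2" "db 2 = db2 + eb2 / 2"
    "dc 1 = dc1 + ec1 / 2" "dc 2 = dc2 + ec2 / 2"
    unfolding da_def db_def dc_def dG' dM dT
    by (simp_all only: sum_2 abc[symmetric] G21 tsym t' xyrs[symmetric]) (simp_all add: field_simps)
  \<comment> \<open>The divergence of the trace condition: the direction of differentiation equals
    the upper index, hence \<open>dmin\<close> at \<open>1 1\<close> and at
    \<open>2 2\<close>.\<close>
  have dm: "dc 1 * x - 2 * db 1 * y + da 1 * r + (c * dt 1 1 1 1 - 2 * b * dt 1 1 1 2 + a * dt 1 1 2 2) = 0"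
    "dc 2 * s + 2 * db 2 * x - da 2 * y + (c * dt 2 2 1 1 + 2 * b * dt 2 1 1 1 - a * dt 2 1 1 2) = 0"
    using dmin[of 1 1] dmin[of 2 2] unfolding mixed_det_def
    by (simp_all add: abc[symmetric] t[symmetric] xyrs[symmetric] t' tsym dt[symmetric] dt'
        da_def[symmetric] db_def[symmetric] dc_def[symmetric])
  note cM = curvature_identity_mean_part[OF T dM(1-4) dM(5,6)]
  note cT = curvature_identity_difference_part[OF T H nd dT(1-4) dT(5,6)]
  define F1 where "F1 l w = d1 1 l 2 w - d1 2 l 1 w + (\<Sum>m\<in>UNIV. c1 l 1 m * c1 m 2 w - c1 l 2 m * c1 m 1 w)" for l w
  define F2 where "F2 l w = d2 1 l 2 w - d2 2 l 1 w + (\<Sum>m\<in>UNIV. c2 l 1 m * c2 m 2 w - c2 l 2 m * c2 m 1 w)" for l w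
  \<comment> \<open>Since \<open>h\<close> and \<open>k\<close> are half of \<open>G\<close> plus or
    minus \<open>h - k\<close>, and \<open>H\<close> makes \<open>h - k\<close> traceless, both have
    \<open>G\<close>-trace 1.\<close>
  have area: "c * h 1 1 - 2 * b * h 1 2 + a * h 2 2 = a * c - b * b"
      "c * k 1 1 - 2 * b * k 1 2 + a * k 2 2 = a * c - b * b"
    unfolding hk using H by (simp_all add: field_simps)
  \<comment> \<open>The left-hand side is \<open>a * c - b * b\<close> times the
    \<open>G\<close>-trace of the Ricci tensor, because \<open>F1 1 w\<close> is Ric(2, w) and
    \<open>- F1 2 w\<close> is Ric(1, w).\<close>
  have e1: "a * F1 1 2 - b * F1 1 1 - c * F1 2 1 + b * F1 2 2 = K1 * (a * c - b * b)"
    unfolding F1_def curv1 area(1)[symmetric] by (simp add: sym algebra_simps)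
  have e2: "a * F2 1 2 - b * F2 1 1 - c * F2 2 1 + b * F2 2 2 = K2 * (a * c - b * b)"
    unfolding F2_def curv2 area(2)[symmetric] by (simp add: sym algebra_simps)
  \<comment> \<open>The reason for working with \<open>m\<close>: in the difference of the quadratic
    terms only the mixed products of \<open>m\<close> and \<open>t\<close> survive.\<close>
  have F: "F1 l w - F2 l w = dt 1 l 2 w - dt 2 l 1 w
      + ((m l 1 1 * t 1 2 w + m l 1 2 * t 2 2 w - (m l 2 1 * t 1 1 w + m l 2 2 * t 2 1 w))
      + (t l 1 1 * m 1 2 w + t l 1 2 * m 2 2 w - (t l 2 1 * m 1 1 w + t l 2 2 * m 2 1 w)))" for l w
    unfolding F1_def F2_def c12 d12 by (simp add: sum_2 field_simps)
  \<comment> \<open>\<open>dm\<close> trades the derivatives \<open>dt\<close> for derivatives of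
    \<open>G\<close>; their part along \<open>m\<close> cancels against the mixed products by
    \<open>cM\<close>, their part along \<open>t\<close> vanishes by \<open>cT\<close>.\<close>
  have "a * (F1 1 2 - F2 1 2) - b * (F1 1 1 - F2 1 1) - c * (F1 2 1 - F2 2 1) + b * (F1 2 2 - F2 2 2) = 0"
    unfolding F tsym t' dt' xyrs[symmetric] using cM cT dm[unfolded ddd]
    by (simp add: algebra_simps)
  with e1 e2 have "(K1 - K2) * (a * c - b * b) = 0" by algebra
  then show ?thesis using nd by simp
qed


section \<open>Second derivatives\<close>

lemma Ck_on_cong:
  assumes "open U" "\<And>y. y \<in> U \<Longrightarrow> f y = g y" "Ck_on k U f"
  shows "Ck_on k U g"
  using assms(2,3)
proof (induction k arbitrary: f g)
  case 0
  then show ?case using continuous_on_cong by (metis Ck_on.simps(1))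
next
  case (Suc k)
  have "\<forall>y\<in>U. f differentiable (at y)" and Ck: "Ck_on k U (\<lambda>y. frechet_derivative f (at y) u)" for u
    using Suc.prems(2) unfolding Ck_on.simps by blast+
  then have diff: "f differentiable (at y)" if "y \<in> U" for y using that by blast
  have eq: "frechet_derivative f (at y) = frechet_derivative g (at y)" if "y \<in> U" for y
    using frechet_derivative_transform_within_open[OF diff[OF that] assms(1) that] Suc.prems(1) by blast
  have "g differentiable (at y)" if "y \<in> U" for y
    using diff[OF that] Suc.prems(1) assms(1) that
    by (meson differentiable_def has_derivative_transform_within_open)
  moreover have "Ck_on k U (\<lambda>y. frechet_derivative g (at y) u)" for u
    by (rule Suc.IH[OF _ Ck]) (simp add: eq)
  ultimately show ?case unfolding Ck_on.simps by blast
qed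

lemma Ck_on_bounded_linear:
  assumes "open U" "bounded_linear L" "Ck_on k U f"
  shows "Ck_on k U (\<lambda>y. L (f y))"
  using assms(3)
proof (induction k arbitrary: f)
  case 0
  then show ?case using assms(2) by (simp add: linear_continuous_on_compose bounded_linear.continuous_on)
next
  case (Suc k)
  have Ck: "\<forall>y\<in>U. f differentiable (at y)" "Ck_on k U (\<lambda>y. frechet_derivative f (at y) u)" for u
    using Suc.prems unfolding Ck_on.simps by blast+
  have d: "((\<lambda>y. L (f y)) has_derivative (\<lambda>u. L (frechet_derivative f (at y) u))) (at y)" if "y \<in> U" for y
    using Ck(1) that assms(2) frechet_derivative_works by (blast intro: bounded_linear.has_derivative)
  have "Ck_on k U (\<lambda>y. frechet_derivative (\<lambda>y. L (f y)) (at y) u)" for u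
    by (rule Ck_on_cong[OF assms(1) _ Suc.IH[OF Ck(2)]]) (simp add: frechet_derivative_at[OF d, symmetric])
  then show ?case unfolding Ck_on.simps using d differentiable_def by blast
qed

lemma Ck_on_subset:
  assumes "V \<subseteq> U" "Ck_on k U f"
  shows "Ck_on k V f"
  using assms(2)
proof (induction k arbitrary: f)
  case 0
  then show ?case using assms(1) continuous_on_subset by auto
qed (use assms(1) in auto)

lemma smooth_on_subset: "smooth_on U f \<Longrightarrow> V \<subseteq> U \<Longrightarrow> smooth_on V f"
  using Ck_on_subset unfolding smooth_on_def by blast

lemma smooth_on_bounded_linear:
  "smooth_on U f \<Longrightarrow> open U \<Longrightarrow> bounded_linear L \<Longrightarrow> smooth_on U (\<lambda>y. L (f y))"
  using Ck_on_bounded_linear unfolding smooth_on_def by blast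

lemma smooth_on_differentiable: "smooth_on U f \<Longrightarrow> y \<in> U \<Longrightarrow> f differentiable (at y)"
  unfolding smooth_on_def by (metis Ck_on.simps(2))

lemma smooth_on_frechet_derivative: "smooth_on U f \<Longrightarrow> smooth_on U (\<lambda>y. frechet_derivative f (at y) u)"
  unfolding smooth_on_def by (metis Ck_on.simps(2))

lemma smooth_on_has_derivative:
  "smooth_on U f \<Longrightarrow> y \<in> U \<Longrightarrow> (f has_derivative frechet_derivative f (at y)) (at y)"
  using smooth_on_differentiable frechet_derivative_works by blast

text \<open>The mean value theorem in direction \<open>u\<close> reduces the second difference to a first difference of
  \<open>D\<^sub>u f\<close>, so differentiability of \<open>D\<^sub>u f\<close> at the single point \<open>x\<close> suffices.\<close>

lemma second_difference:
  fixes f :: "'e::real_normed_vector \<Rightarrow> real"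
  assumes "open U" "x \<in> U" and f: "\<And>y. y \<in> U \<Longrightarrow> f differentiable (at y)"
    and A: "((\<lambda>y. frechet_derivative f (at y) u) has_derivative A) (at x)" and "0 < e"
  shows "\<exists>d>0. \<forall>t. 0 < t \<and> t < d \<longrightarrow>
    \<bar>f (x + t *\<^sub>R u + t *\<^sub>R v) - f (x + t *\<^sub>R u) - f (x + t *\<^sub>R v) + f x - t\<^sup>2 * A v\<bar> \<le> e * t\<^sup>2"
proof -
  \<comment> \<open>All displacements \<open>\<xi> *\<^sub>R u + s *\<^sub>R v\<close> with
    \<open>\<xi>\<close> and \<open>s\<close> between 0 and \<open>t\<close> have norm at most
    \<open>K * t\<close>; the summand 1 keeps \<open>K\<close> positive if both vectors vanish.
    Below, \<open>e'\<close> is chosen so that two errors \<open>e' * (K * t)\<close> add up to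
    \<open>e * t\<close>.\<close>
  define K where "K = norm u + norm v + 1"
  have K: "K > 0" unfolding K_def by (simp add: add_nonneg_pos)
  interpret A: bounded_linear A using A by (rule has_derivative_bounded_linear)
  define e' where "e' = e / (2 * K)"
  have "e' > 0" unfolding e'_def using K \<open>0 < e\<close> by simp
  then obtain r1 where r1: "r1 > 0" "\<And>y. norm (y - x) < r1 \<Longrightarrow>
      norm (frechet_derivative f (at y) u - frechet_derivative f (at x) u - A (y - x)) \<le> e' * norm (y - x)"
    using A unfolding has_derivative_at_alt by metis
  obtain r2 where r2: "r2 > 0" "ball x r2 \<subseteq> U" using assms(1,2) openE by blast
  then have r2': "norm w < r2 \<Longrightarrow> x + w \<in> U" for w using subsetD[of _ _ "x + w"] by (simp add: dist_norm)
  define d where "d = min r1 r2 / K"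
  have small: "norm (\<xi> *\<^sub>R u + s *\<^sub>R v) \<le> K * t" "norm (\<xi> *\<^sub>R u + s *\<^sub>R v) < r1" "x + (\<xi> *\<^sub>R u + s *\<^sub>R v) \<in> U"
    if "0 \<le> \<xi>" "\<xi> \<le> t" "0 \<le> s" "s \<le> t" "t < d" for \<xi> s t
  proof -
    have "norm (\<xi> *\<^sub>R u + s *\<^sub>R v) \<le> \<xi> * norm u + s * norm v"
      using norm_triangle_ineq[of "\<xi> *\<^sub>R u" "s *\<^sub>R v"] that by simp
    also have "\<dots> \<le> t * norm u + t * norm v"
      using that by (intro add_mono mult_right_mono) auto
    also have "\<dots> \<le> K * t" unfolding K_def using that by (simp add: algebra_simps)
    finally show le: "norm (\<xi> *\<^sub>R u + s *\<^sub>R v) \<le> K * t" .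
    also have "\<dots> < min r1 r2" using that K unfolding d_def by (simp add: field_simps)
    finally show "norm (\<xi> *\<^sub>R u + s *\<^sub>R v) < r1" "x + (\<xi> *\<^sub>R u + s *\<^sub>R v) \<in> U"
      using r2' by simp_all
  qed
  have "\<bar>f (x + t *\<^sub>R u + t *\<^sub>R v) - f (x + t *\<^sub>R u) - f (x + t *\<^sub>R v) + f x - t\<^sup>2 * A v\<bar> \<le> e * t\<^sup>2"
    if t: "0 < t" "t < d" for t
  proof -
    \<comment> \<open>\<open>g t - g 0\<close> is the second difference. The summand
      \<open>0 *\<^sub>R v\<close> gives both terms the same shape, so that \<open>D\<close> and
      \<open>est\<close> apply to them with \<open>s = t\<close> and \<open>s = 0\<close>.\<close>
    define g where "g \<xi> = f (x + (\<xi> *\<^sub>R u + t *\<^sub>R v)) - f (x + (\<xi> *\<^sub>R u + 0 *\<^sub>R v))" for \<xi>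
    define g' where "g' \<xi> = frechet_derivative f (at (x + (\<xi> *\<^sub>R u + t *\<^sub>R v))) u
        - frechet_derivative f (at (x + (\<xi> *\<^sub>R u + 0 *\<^sub>R v))) u" for \<xi>
    have D: "((\<lambda>\<xi>. f (x + (\<xi> *\<^sub>R u + s *\<^sub>R v))) has_real_derivative
        frechet_derivative f (at (x + (\<xi> *\<^sub>R u + s *\<^sub>R v))) u) (at \<xi>)"
      if "0 \<le> \<xi>" "\<xi> \<le> t" "0 \<le> s" "s \<le> t" for \<xi> s
    proof -
      let ?y = "x + (\<xi> *\<^sub>R u + s *\<^sub>R v)"
      have d1: "(f has_derivative frechet_derivative f (at ?y)) (at ?y)"
        using f[OF small(3)[OF that t(2)]] frechet_derivative_works by blast
      have d2: "((\<lambda>\<xi>. x + (\<xi> *\<^sub>R u + s *\<^sub>R v)) has_derivative (\<lambda>h. h *\<^sub>R u)) (at \<xi>)"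
        by (auto intro!: derivative_eq_intros)
      have "((\<lambda>\<xi>. f (x + (\<xi> *\<^sub>R u + s *\<^sub>R v))) has_derivative (\<lambda>h. frechet_derivative f (at ?y) (h *\<^sub>R u))) (at \<xi>)"
        using has_derivative_compose[OF d2 d1] .
      then show ?thesis
        using linear_scale[OF has_derivative_linear[OF d1]]
        by (simp add: has_field_derivative_def mult.commute[of _ "frechet_derivative f (at ?y) u"])
    qed
    have "\<exists>\<xi>. 0 < \<xi> \<and> \<xi> < t \<and> g t - g 0 = (t - 0) * g' \<xi>"
      unfolding g_def g'_def using t by (intro MVT2 DERIV_diff D) auto
    then obtain \<xi> where \<xi>: "0 < \<xi>" "\<xi> < t" "g t - g 0 = t * g' \<xi>" by auto
    have est: "\<bar>frechet_derivative f (at (x + (\<xi> *\<^sub>R u + s *\<^sub>R v))) u - frechet_derivative f (at x) u - A (\<xi> *\<^sub>R u + s *\<^sub>R v)\<bar>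
        \<le> e' * (K * t)" if "0 \<le> s" "s \<le> t" for s
    proof -
      have le: "norm (\<xi> *\<^sub>R u + s *\<^sub>R v) < r1" "norm (\<xi> *\<^sub>R u + s *\<^sub>R v) \<le> K * t"
        using small[of \<xi> t s] \<xi> t that by auto
      have "\<bar>frechet_derivative f (at (x + (\<xi> *\<^sub>R u + s *\<^sub>R v))) u - frechet_derivative f (at x) u - A (\<xi> *\<^sub>R u + s *\<^sub>R v)\<bar>
          \<le> e' * norm (\<xi> *\<^sub>R u + s *\<^sub>R v)"
        using r1(2)[of "x + (\<xi> *\<^sub>R u + s *\<^sub>R v)"] le(1) by simp
      also have "\<dots> \<le> e' * (K * t)" using le(2) \<open>e' > 0\<close> by (intro mult_left_mono) auto
      finally show ?thesis .
    qed
    have "\<bar>g' \<xi> - t * A v\<bar> \<le> 2 * (e' * (K * t))"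
      using est[of t] est[of 0] t unfolding g'_def by (simp add: A.add A.scaleR)
    also have "\<dots> = e * t" unfolding e'_def using K by simp
    finally have "t * \<bar>g' \<xi> - t * A v\<bar> \<le> t * (e * t)" using t by (intro mult_left_mono) auto
    moreover have "t * \<bar>g' \<xi> - t * A v\<bar> = \<bar>g t - g 0 - t\<^sup>2 * A v\<bar>"
      using t by (simp add: \<xi>(3) power2_eq_square abs_mult[symmetric] algebra_simps)
        (metis abs_mult abs_of_pos mult.assoc right_diff_distrib)
    ultimately show ?thesis
      unfolding g_def by (simp add: power2_eq_square algebra_simps)
  qed
  moreover have "d > 0" unfolding d_def using K r1 r2 by simp
  ultimately show ?thesis by blast
qed

text \<open>Both iterated derivatives are limits of one and the same second difference over
  \<open>t\<^sup>2\<close>, which is symmetric in \<open>u\<close> and \<open>v\<close>.\<close>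

lemma frechet_derivative_commute_real:
  fixes f :: "'e::euclidean_space \<Rightarrow> real"
  assumes "smooth_on U f" "open U" "x \<in> U"
  shows "frechet_derivative (\<lambda>y. frechet_derivative f (at y) u) (at x) v =
    frechet_derivative (\<lambda>y. frechet_derivative f (at y) v) (at x) u" (is "?A = ?B")
proof (rule ccontr)
  assume "?A \<noteq> ?B"
  \<comment> \<open>A third of the gap: two errors of size \<open>e * t\<^sup>2\<close> cannot
    bridge \<open>3 * e * t\<^sup>2\<close>.\<close>
  define e where "e = \<bar>?A - ?B\<bar> / 3"
  have e: "e > 0" unfolding e_def using \<open>?A \<noteq> ?B\<close> by simp
  note D = smooth_on_has_derivative[OF smooth_on_frechet_derivative[OF assms(1)] assms(3)]
  obtain d1 where d1: "d1 > 0" "\<And>t. 0 < t \<Longrightarrow> t < d1 \<Longrightarrow>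
    \<bar>f (x + t *\<^sub>R u + t *\<^sub>R v) - f (x + t *\<^sub>R u) - f (x + t *\<^sub>R v) + f x - t\<^sup>2 * ?A\<bar> \<le> e * t\<^sup>2"
    using second_difference[OF assms(2,3) smooth_on_differentiable[OF assms(1)] D e, of u v] by blast
  obtain d2 where d2: "d2 > 0" "\<And>t. 0 < t \<Longrightarrow> t < d2 \<Longrightarrow>
    \<bar>f (x + t *\<^sub>R v + t *\<^sub>R u) - f (x + t *\<^sub>R v) - f (x + t *\<^sub>R u) + f x - t\<^sup>2 * ?B\<bar> \<le> e * t\<^sup>2"
    using second_difference[OF assms(2,3) smooth_on_differentiable[OF assms(1)] D e, of v u] by blast
  define t where "t = min d1 d2 / 2"
  have t: "0 < t" "t < d1" "t < d2" unfolding t_def using d1 d2 by auto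
  have "x + t *\<^sub>R v + t *\<^sub>R u = x + t *\<^sub>R u + t *\<^sub>R v" by simp
  then have "\<bar>t\<^sup>2 * ?A - t\<^sup>2 * ?B\<bar> \<le> 2 * (e * t\<^sup>2)"
    using d1(2)[OF t(1,2)] d2(2)[OF t(1,3)] by (simp only:)
  moreover have "\<bar>t\<^sup>2 * ?A - t\<^sup>2 * ?B\<bar> = t\<^sup>2 * (3 * e)"
    unfolding e_def right_diff_distrib[symmetric] abs_mult by simp
  ultimately show False using t e by (simp add: mult.commute)
qed

lemma frechet_derivative_commute:
  fixes f :: "'e::euclidean_space \<Rightarrow> 'f::euclidean_space"
  assumes "smooth_on U f" "open U" "x \<in> U"
  shows "frechet_derivative (\<lambda>y. frechet_derivative f (at y) u) (at x) v =
    frechet_derivative (\<lambda>y. frechet_derivative f (at y) v) (at x) u"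
proof (rule euclidean_eqI)
  fix b :: 'f
  assume "b \<in> Basis"
  have d: "frechet_derivative (\<lambda>y. f y \<bullet> b) (at y) = (\<lambda>u. frechet_derivative f (at y) u \<bullet> b)"
    if "y \<in> U" "smooth_on U f" for f :: "'e \<Rightarrow> 'f" and y
    using smooth_on_has_derivative[OF that(2,1)]
    by (intro frechet_derivative_at[symmetric] has_derivative_inner_left)
  have s: "smooth_on U (\<lambda>y. f y \<bullet> b)"
    using smooth_on_bounded_linear[OF assms(1,2) bounded_linear_inner_left] .
  have dd: "frechet_derivative (\<lambda>y. frechet_derivative f (at y) u) (at x) v \<bullet> b =
      frechet_derivative (\<lambda>y. frechet_derivative (\<lambda>y. f y \<bullet> b) (at y) u) (at x) v" for u v
  proof -
    have "frechet_derivative (\<lambda>y. frechet_derivative (\<lambda>y. f y \<bullet> b) (at y) u) (at x)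
       = frechet_derivative (\<lambda>y. frechet_derivative f (at y) u \<bullet> b) (at x)"
      using smooth_on_differentiable[OF smooth_on_frechet_derivative[OF s] assms(3)]
      by (rule frechet_derivative_transform_within_open[OF _ assms(2,3)]) (use d assms in auto)
    then show ?thesis using d[OF assms(3) smooth_on_frechet_derivative[OF assms(1)]] by simp
  qed
  show "frechet_derivative (\<lambda>y. frechet_derivative f (at y) u) (at x) v \<bullet> b =
    frechet_derivative (\<lambda>y. frechet_derivative f (at y) v) (at x) u \<bullet> b"
    unfolding dd by (rule frechet_derivative_commute_real[OF s assms(2,3)])
qed

lemma bilinear_euclidean_sum:
  fixes B :: "'a::euclidean_space \<Rightarrow> 'b::euclidean_space \<Rightarrow> 'c::real_normed_vector"
  assumes "bilinear B"
  shows "B a b = (\<Sum>i\<in>Basis. \<Sum>j\<in>Basis. ((a \<bullet> i) * (b \<bullet> j)) *\<^sub>R B i j)"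
proof -
  have "B a b = B (\<Sum>i\<in>Basis. (a \<bullet> i) *\<^sub>R i) (\<Sum>j\<in>Basis. (b \<bullet> j) *\<^sub>R j)"
    by (simp add: euclidean_representation)
  also have "\<dots> = (\<Sum>i\<in>Basis. \<Sum>j\<in>Basis. ((a \<bullet> i) * (b \<bullet> j)) *\<^sub>R B i j)"
    by (subst bilinear_sum[OF assms]) (simp_all add: sum.cartesian_product bilinear_lmul[OF assms] bilinear_rmul[OF assms] mult.commute)
  finally show ?thesis .
qed

text \<open>A product rule with three terms, for a bilinear map that varies with the point as well.
  Expanding in the standard basis reduces it to scalar coefficients, so differentiability of
  \<open>B\<close> is asked only entrywise and no operator norm on bilinear maps appears.\<close>

lemma has_derivative_bilinear_family:
  fixes B :: "'e::real_normed_vector \<Rightarrow> 'a::euclidean_space \<Rightarrow> 'b::euclidean_space \<Rightarrow> 'c::real_normed_vector"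
  assumes V: "open V" "\<And>z. z \<in> V \<Longrightarrow> bilinear (B z)"
    and B: "\<And>u v. (\<lambda>z. B z u v) differentiable (at (\<phi> x))"
    and \<phi>: "(\<phi> has_derivative \<phi>') (at x)" "\<phi> x \<in> V"
    and a: "(a has_derivative a') (at x)" and b: "(b has_derivative b') (at x)"
  shows "((\<lambda>y. B (\<phi> y) (a y) (b y)) has_derivative
     (\<lambda>u. frechet_derivative (\<lambda>z. B z (a x) (b x)) (at (\<phi> x)) (\<phi>' u)
          + B (\<phi> x) (a' u) (b x) + B (\<phi> x) (a x) (b' u))) (at x)"
proof -
  define dB where "dB i j = frechet_derivative (\<lambda>z. B z i j) (at (\<phi> x))" for i j
  have dB: "((\<lambda>z. B z i j) has_derivative dB i j) (at (\<phi> x))" for i j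
    unfolding dB_def using B frechet_derivative_works by blast
  have sumB: "((\<lambda>z. B z p q) has_derivative (\<lambda>h. \<Sum>i\<in>Basis. \<Sum>j\<in>Basis. ((p \<bullet> i) * (q \<bullet> j)) *\<^sub>R dB i j h)) (at (\<phi> x))" for p q
    by (rule has_derivative_transform_within_open[of
          "\<lambda>z. \<Sum>i\<in>Basis. \<Sum>j\<in>Basis. ((p \<bullet> i) * (q \<bullet> j)) *\<^sub>R B z i j" _ _ _ V])
      (auto intro!: has_derivative_sum has_derivative_scaleR_right dB V \<phi> simp: bilinear_euclidean_sum[OF V(2), of _ p q])
  have dB_sum: "dB p q = (\<lambda>h. \<Sum>i\<in>Basis. \<Sum>j\<in>Basis. ((p \<bullet> i) * (q \<bullet> j)) *\<^sub>R dB i j h)" for p q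
    unfolding dB_def using frechet_derivative_at[OF sumB[of p q]] unfolding dB_def by simp
  have cont: "isCont \<phi> x" using \<phi>(1) has_derivative_continuous by blast
  obtain W where W: "open W" "x \<in> W" "\<And>y. y \<in> W \<Longrightarrow> \<phi> y \<in> V"
    using cont V(1) \<phi>(2) by (metis continuous_at_open)
  have "((\<lambda>y. \<Sum>i\<in>Basis. \<Sum>j\<in>Basis. ((a y \<bullet> i) * (b y \<bullet> j)) *\<^sub>R B (\<phi> y) i j) has_derivative
     (\<lambda>u. \<Sum>i\<in>Basis. \<Sum>j\<in>Basis. ((a x \<bullet> i) * (b x \<bullet> j)) *\<^sub>R dB i j (\<phi>' u)
         + ((a x \<bullet> i) * (b' u \<bullet> j) + (a' u \<bullet> i) * (b x \<bullet> j)) *\<^sub>R B (\<phi> x) i j)) (at x)"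
    by (intro has_derivative_sum has_derivative_scaleR has_derivative_mult has_derivative_inner_left a b
        has_derivative_compose[OF \<phi>(1) dB])
  moreover have "(\<lambda>u. \<Sum>i\<in>Basis. \<Sum>j\<in>Basis. ((a x \<bullet> i) * (b x \<bullet> j)) *\<^sub>R dB i j (\<phi>' u)
         + ((a x \<bullet> i) * (b' u \<bullet> j) + (a' u \<bullet> i) * (b x \<bullet> j)) *\<^sub>R B (\<phi> x) i j)
    = (\<lambda>u. dB (a x) (b x) (\<phi>' u) + B (\<phi> x) (a' u) (b x) + B (\<phi> x) (a x) (b' u))"
    unfolding dB_sum[of "a x" "b x"] bilinear_euclidean_sum[OF V(2)[OF \<phi>(2)], of "a' _" "b x"]
      bilinear_euclidean_sum[OF V(2)[OF \<phi>(2)], of "a x" "b' _"]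
    by (simp add: sum.distrib scaleR_add_left fun_eq_iff)
  ultimately have "((\<lambda>y. \<Sum>i\<in>Basis. \<Sum>j\<in>Basis. ((a y \<bullet> i) * (b y \<bullet> j)) *\<^sub>R B (\<phi> y) i j) has_derivative
     (\<lambda>u. dB (a x) (b x) (\<phi>' u) + B (\<phi> x) (a' u) (b x) + B (\<phi> x) (a x) (b' u))) (at x)" by simp
  then show ?thesis unfolding dB_def
    by (rule has_derivative_transform_within_open[OF _ W(1,2)])
      (simp add: bilinear_euclidean_sum[OF V(2)[OF W(3)], of _ "a _" "b _"])
qed


section \<open>Levi-Civita connection and curvature in coordinates\<close>

lemma linear_frechet_family:
  fixes L :: "'e::real_normed_vector \<Rightarrow> 'a::real_vector \<Rightarrow> 'c::real_normed_vector"
  assumes "open V" "y \<in> V" "\<And>z. z \<in> V \<Longrightarrow> linear (L z)" "\<And>u. (\<lambda>z. L z u) differentiable (at y)"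
  shows "linear (\<lambda>u. frechet_derivative (\<lambda>z. L z u) (at y) a)"
proof -
  have D: "((\<lambda>z. L z u) has_derivative frechet_derivative (\<lambda>z. L z u) (at y)) (at y)" for u
    using assms(4) frechet_derivative_works by blast
  have add: "((\<lambda>z. L z (u + v)) has_derivative
      (\<lambda>a. frechet_derivative (\<lambda>z. L z u) (at y) a + frechet_derivative (\<lambda>z. L z v) (at y) a)) (at y)" for u v
    using has_derivative_add[OF D[of u] D[of v]] assms(1,2)
    by (rule has_derivative_transform_within_open) (simp add: linear_add[OF assms(3)])
  have scale: "((\<lambda>z. L z (r *\<^sub>R u)) has_derivative (\<lambda>a. r *\<^sub>R frechet_derivative (\<lambda>z. L z u) (at y) a)) (at y)" for r u
    using has_derivative_scaleR_right[OF D[of u]] assms(1,2)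
    by (rule has_derivative_transform_within_open) (simp add: linear_scale[OF assms(3)])
  show ?thesis
    by (intro linearI)
      (simp_all only: frechet_derivative_at[OF add, symmetric] frechet_derivative_at[OF scale, symmetric])
qed

lemma bilinear_frechet_family:
  fixes B :: "'e::real_normed_vector \<Rightarrow> 'a::real_vector \<Rightarrow> 'b::real_vector \<Rightarrow> 'c::real_normed_vector"
  assumes "open V" "y \<in> V" "\<And>z. z \<in> V \<Longrightarrow> bilinear (B z)" "\<And>u v. (\<lambda>z. B z u v) differentiable (at y)"
  shows "bilinear (\<lambda>u v. frechet_derivative (\<lambda>z. B z u v) (at y) a)"
  unfolding bilinear_def
  by (intro conjI allI linear_frechet_family[OF assms(1,2)] assms(4))
    (use assms(3) in \<open>auto simp: bilinear_def\<close>)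

text \<open>The values on the standard basis define the endomorphism \<open>T\<close>; nondegeneracy
  makes it injective, and finite dimension makes it surjective. The argument covers the indefinite
  forms that occur for \<open>\<epsilon> = - 1\<close>.\<close>

lemma riesz_nondegenerate:
  fixes b :: "'e::euclidean_space \<Rightarrow> 'e \<Rightarrow> real"
  assumes b: "bilinear b" and nondeg: "\<And>w. (\<And>z. b w z = 0) \<Longrightarrow> w = 0" and l: "linear l"
  shows "\<exists>!w. \<forall>z. b w z = l z"
proof -
  have lb: "linear (b w)" for w using b by (simp add: bilinear_def)
  define T where "T w = (\<Sum>i\<in>Basis. b w i *\<^sub>R i)" for w
  have T_inner: "T w \<bullet> i = b w i" if "i \<in> Basis" for w i
    unfolding T_def using that by (simp add: inner_sum_left inner_Basis if_distrib cong: if_cong)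
  have eq: "f = g" if "linear f" "linear g" "\<And>i. i \<in> Basis \<Longrightarrow> f i = g i" for f g :: "'e \<Rightarrow> real"
    using linear_eq_stdbasis that by blast
  have linT: "linear T"
    unfolding T_def
    by (intro linearI) (simp_all add: bilinear_ladd[OF b] bilinear_lmul[OF b] scaleR_add_left sum.distrib scaleR_sum_right)
  moreover have "inj T"
  proof (subst linear_injective_0[OF linT], intro allI impI)
    fix w assume "T w = 0"
    then have "b w i = 0" if "i \<in> Basis" for i using T_inner[OF that, of w] by simp
    then have "b w = (\<lambda>_. 0)" by (intro eq lb) (auto simp: linear_iff)
    then show "w = 0" by (intro nondeg) auto
  qed
  ultimately have "surj T" using linear_injective_imp_surjective by blast
  then obtain w where "T w = (\<Sum>i\<in>Basis. l i *\<^sub>R i)" by (metis surjD)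
  then have "b w i = l i" if "i \<in> Basis" for i
    using T_inner[OF that, of w] that by (simp add: inner_sum_left inner_Basis if_distrib cong: if_cong)
  then have "b w = l" by (intro eq lb l)
  moreover have "w' = w" if "\<forall>z. b w' z = l z" for w'
    using nondeg[of "w' - w"] that \<open>b w = l\<close> by (simp add: bilinear_lsub[OF b])
  ultimately show ?thesis by metis
qed

text \<open>Nondegenerate instead of positive, so that the product metric is an instance for both
  signs of \<open>\<epsilon>\<close>.\<close>

locale metric_patch =
  fixes V :: "'e::euclidean_space set" and h :: "'e coord_metric"
  assumes open_dom: "open V"
    and differentiable: "\<And>y u v. y \<in> V \<Longrightarrow> (\<lambda>y. h y u v) differentiable (at y)"
    and bilinear: "\<And>y. y \<in> V \<Longrightarrow> bilinear (h y)"
    and sym: "\<And>y u v. y \<in> V \<Longrightarrow> h y u v = h y v u"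
    and nondegenerate: "\<And>y u. y \<in> V \<Longrightarrow> (\<And>v. h y u v = 0) \<Longrightarrow> u = 0"
begin

definition D where "D y u v w = frechet_derivative (\<lambda>y. h y v w) (at y) u"

lemma bilinear_D: "y \<in> V \<Longrightarrow> bilinear (D y u)"
  unfolding D_def by (rule bilinear_frechet_family[OF open_dom]) (auto intro: bilinear differentiable)

lemma linear_D: "y \<in> V \<Longrightarrow> linear (\<lambda>u. D y u v w)"
  unfolding D_def using differentiable linear_frechet_derivative by blast

lemma D_sym: "y \<in> V \<Longrightarrow> D y u v w = D y u w v"
  unfolding D_def
  by (rule fun_cong[where x = u], rule frechet_derivative_transform_within_open[OF _ open_dom])
    (auto intro: differentiable sym)

lemma koszul_ex1:
  assumes "y \<in> V"
  shows "\<exists>!w. \<forall>z. h y w z = (D y u v z + D y v u z - D y z u v) / 2"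
proof (rule riesz_nondegenerate[OF bilinear[OF assms] nondegenerate[OF assms]])
  have "linear (\<lambda>z. D y u v z)" "linear (\<lambda>z. D y v u z)" "linear (\<lambda>z. D y z u v)"
    using bilinear_D[OF assms] linear_D[OF assms] by (auto simp: bilinear_def)
  then show "linear (\<lambda>z. (D y u v z + D y v u z - D y z u v) / 2)"
    by (simp add: linear_iff field_simps)
qed auto

text \<open>The definite description in \<open>christoffel\<close> is evaluated through this rule:
  symmetry, linearity and the product formula all follow by checking that a candidate satisfies the
  Koszul identity.\<close>

lemma christoffel_eqI:
  assumes "y \<in> V" "\<And>z. 2 * h y w z = D y u v z + D y v u z - D y z u v"
  shows "christoffel h y u v = w"
  unfolding christoffel_def D_def[symmetric]
proof (rule the_equality)
  fix w' assume "\<forall>z. 2 * h y w' z = D y u v z + D y v u z - D y z u v"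
  then show "w' = w" using koszul_ex1[OF assms(1), of u v] assms(2)
    by (metis field_sum_of_halves mult_2 nonzero_mult_div_cancel_left zero_neq_numeral)
qed (use assms(2) in simp)

lemma koszul:
  assumes "y \<in> V"
  shows "2 * h y (christoffel h y u v) z = D y u v z + D y v u z - D y z u v"
proof -
  obtain w where w: "\<And>z. h y w z = (D y u v z + D y v u z - D y z u v) / 2"
    using koszul_ex1[OF assms] by blast
  have "christoffel h y u v = w" by (rule christoffel_eqI[OF assms]) (simp add: w)
  then show ?thesis by (simp add: w)
qed

lemma christoffel_sym: "y \<in> V \<Longrightarrow> christoffel h y u v = christoffel h y v u"
  by (rule christoffel_eqI) (simp_all add: koszul D_sym[of y _ u v])

lemma bilinear_christoffel:
  assumes y: "y \<in> V"
  shows "bilinear (christoffel h y)"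
proof -
  note simps = bilinear_ladd[OF bilinear[OF y]] bilinear_lmul[OF bilinear[OF y]]
    bilinear_ladd[OF bilinear_D[OF y]] bilinear_lmul[OF bilinear_D[OF y]]
    bilinear_radd[OF bilinear_D[OF y]] bilinear_rmul[OF bilinear_D[OF y]]
    linear_add[OF linear_D[OF y]] linear_scale[OF linear_D[OF y]]
  have add: "christoffel h y (u + u') v = christoffel h y u v + christoffel h y u' v" for u u' v
    by (rule christoffel_eqI[OF y]) (simp add: simps distrib_left koszul[OF y])
  have scale: "christoffel h y (r *\<^sub>R u) v = r *\<^sub>R christoffel h y u v" for r u v
  proof (rule christoffel_eqI[OF y])
    fix z
    have "2 * h y (r *\<^sub>R christoffel h y u v) z = r * (2 * h y (christoffel h y u v) z)" by (simp add: simps)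
    then show "2 * h y (r *\<^sub>R christoffel h y u v) z = D y (r *\<^sub>R u) v z + D y v (r *\<^sub>R u) z - D y z (r *\<^sub>R u) v"
      unfolding koszul[OF y] by (simp add: simps algebra_simps)
  qed
  have "linear (\<lambda>u. christoffel h y u v)" for v using add scale by (simp add: linear_iff)
  then show ?thesis unfolding bilinear_def using christoffel_sym[OF y] by simp
qed

text \<open>In the sum of the Koszul identities for \<open>u\<close>, \<open>v\<close> tested on
  \<open>w\<close> and for \<open>u\<close>, \<open>w\<close> tested on \<open>v\<close>, the
  derivatives in directions \<open>v\<close> and \<open>w\<close> cancel.\<close>

lemma metric_compatible:
  assumes "y \<in> V"
  shows "D y u v w = h y (christoffel h y u v) w + h y v (christoffel h y u w)"
proof -
  have "2 * h y v (christoffel h y u w) = D y u w v + D y w u v - D y v u w"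
    using koszul[OF assms, of u w v] sym[OF assms] by simp
  then show ?thesis using koszul[OF assms, of u v w] D_sym[OF assms] by (smt (verit))
qed

end

section \<open>Determinants and Cramer's rule in the plane\<close>

definition det2 :: "real^2 \<Rightarrow> real^2 \<Rightarrow> real" where
  "det2 a b = a $ 1 * b $ 2 - a $ 2 * b $ 1"

abbreviation e1 :: "real^2" where "e1 \<equiv> axis 1 1"
abbreviation e2 :: "real^2" where "e2 \<equiv> axis 2 1"

lemma axis_2_simps [simp]: "e1 $ 1 = 1" "e1 $ 2 = 0" "e2 $ 1 = 0" "e2 $ 2 = 1"
  by (simp_all add: axis_def)

lemma vec2_decomp: "(v :: real^2) = (v $ 1) *\<^sub>R e1 + (v $ 2) *\<^sub>R e2"
  by (simp add: vec_eq_iff forall_2)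

text \<open>The inverse of the linear map taking \<open>e1\<close> to \<open>a\<close> and
  \<open>e2\<close> to \<open>b\<close>, applied to \<open>n\<close>. Written as explicit quotients,
  it visibly depends differentiably on all three arguments.\<close>

definition cramer :: "real^2 \<Rightarrow> real^2 \<Rightarrow> real^2 \<Rightarrow> real^2" where
  "cramer a b n = (det2 n b / det2 a b) *\<^sub>R e1 + (det2 a n / det2 a b) *\<^sub>R e2"

lemma cramer:
  assumes "det2 a b \<noteq> 0"
  shows "cramer a b n $ 1 *\<^sub>R a + cramer a b n $ 2 *\<^sub>R b = n"
proof -
  have "det2 n b * a $ i + det2 a n * b $ i = n $ i * det2 a b" for i
    using exhaust_2[of i] by (auto simp: det2_def algebra_simps)
  then have "(det2 n b * a $ i + det2 a n * b $ i) / det2 a b = n $ i" for i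
    using assms by simp
  then show ?thesis
    by (simp add: vec_eq_iff cramer_def add_divide_distrib)
qed

lemma cramer_comb:
  assumes "det2 a b \<noteq> 0"
  shows "cramer a b (x *\<^sub>R a + y *\<^sub>R b) = x *\<^sub>R e1 + y *\<^sub>R e2"
proof -
  have "det2 (x *\<^sub>R a + y *\<^sub>R b) b = x * det2 a b" "det2 a (x *\<^sub>R a + y *\<^sub>R b) = y * det2 a b"
    by (simp_all add: det2_def algebra_simps)
  then show ?thesis unfolding cramer_def using assms by simp
qed

lemma linear_cramer: "linear (cramer a b)"
  by (intro linearI) (simp_all add: cramer_def det2_def vec_eq_iff forall_2 add_divide_distrib[symmetric] algebra_simps)

lemma differentiable_vec_nth: "f differentiable F \<Longrightarrow> (\<lambda>y. f y $ i) differentiable F"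
  unfolding differentiable_def using bounded_linear.has_derivative[OF bounded_linear_vec_nth] by blast

lemma differentiable_det2:
  "a differentiable (at y) \<Longrightarrow> b differentiable (at y) \<Longrightarrow> (\<lambda>y. det2 (a y) (b y)) differentiable (at y)"
  unfolding det2_def by (intro differentiable_diff differentiable_mult differentiable_vec_nth)

lemma differentiable_cramer:
  assumes "a differentiable (at y)" "b differentiable (at y)" "n differentiable (at y)" "det2 (a y) (b y) \<noteq> 0"
  shows "(\<lambda>y. cramer (a y) (b y) (n y)) differentiable (at y)"
  unfolding cramer_def
  by (intro differentiable_add differentiable_scaleR differentiable_const differentiable_divide differentiable_det2 assms)

lemma bilinear_vec2:
  fixes B :: "real^2 \<Rightarrow> real^2 \<Rightarrow> 'c::real_vector"
  assumes "bilinear B"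
  shows "B u v = (u$1 * v$1) *\<^sub>R B e1 e1 + (u$1 * v$2) *\<^sub>R B e1 e2 + (u$2 * v$1) *\<^sub>R B e2 e1 + (u$2 * v$2) *\<^sub>R B e2 e2"
proof -
  have "B u v = B (u$1 *\<^sub>R e1 + u$2 *\<^sub>R e2) (v$1 *\<^sub>R e1 + v$2 *\<^sub>R e2)"
    using vec2_decomp by metis
  then show ?thesis
    by (simp add: bilinear_ladd[OF assms] bilinear_radd[OF assms] bilinear_lmul[OF assms] bilinear_rmul[OF assms] algebra_simps)
qed

lemma linear_vec2:
  fixes L :: "real^2 \<Rightarrow> 'c::real_vector"
  assumes "linear L"
  shows "L u = (u$1) *\<^sub>R L e1 + (u$2) *\<^sub>R L e2"
  by (subst vec2_decomp) (simp only: linear_add[OF assms] linear_scale[OF assms])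

section \<open>Curvature of a Riemannian metric on a plane domain\<close>

locale riemannian_patch = metric_patch V h for V :: "(real^2) set" and h +
  assumes smooth: "\<And>u v. smooth_on V (\<lambda>y. h y u v)"
    and pos: "\<And>y u. y \<in> V \<Longrightarrow> u \<noteq> 0 \<Longrightarrow> h y u u > 0"
begin

lemma gram_pos:
  assumes "y \<in> V"
  shows "h y e1 e1 * h y e2 e2 - (h y e1 e2)\<^sup>2 > 0"
proof -
  have p: "h y e1 e1 > 0" using pos[OF assms] by (simp add: axis_eq_0_iff)
  \<comment> \<open>A multiple of the component of \<open>e2\<close> orthogonal to
    \<open>e1\<close>; its square is therefore the Gram determinant up to the factor
    \<open>h y e1 e1\<close>.\<close>
  define w where "w = h y e1 e1 *\<^sub>R e2 - h y e1 e2 *\<^sub>R e1"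
  have "w $ 2 \<noteq> 0" unfolding w_def using p by simp
  then have "h y w w > 0" using pos[OF assms] by (metis zero_index)
  moreover have "h y w w = h y e1 e1 * (h y e1 e1 * h y e2 e2 - (h y e1 e2)\<^sup>2)"
    unfolding w_def by (simp add: bilinear_lsub[OF bilinear[OF assms]] bilinear_rsub[OF bilinear[OF assms]]
        bilinear_lmul[OF bilinear[OF assms]] bilinear_rmul[OF bilinear[OF assms]] sym[OF assms, of e2 e1]
        power2_eq_square algebra_simps)
  ultimately show ?thesis using p by (simp add: zero_less_mult_iff)
qed

text \<open>The components of the symbol solve a linear system with the Gram matrix as coefficients
  and the first derivatives of the metric on the right (\<open>n\<close>). Cramer's rule exhibits
  the pointwise description as a quotient of differentiable functions.\<close>

lemma differentiable_christoffel:
  assumes "y \<in> V"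
  shows "(\<lambda>y. christoffel h y u v) differentiable (at y)"
proof -
  define a where "a i y = h y i e1 *\<^sub>R e1 + h y i e2 *\<^sub>R e2" for i y
  define n where "n y = ((D y u v e1 + D y v u e1 - D y e1 u v) / 2) *\<^sub>R e1
    + ((D y u v e2 + D y v u e2 - D y e2 u v) / 2) *\<^sub>R e2" for y
  have det: "det2 (a e1 y) (a e2 y) \<noteq> 0" if "y \<in> V" for y
    using gram_pos[OF that] sym[OF that, of e2 e1] unfolding a_def by (simp add: det2_def power2_eq_square)
  have eq: "cramer (a e1 y) (a e2 y) (n y) = christoffel h y u v" if y: "y \<in> V" for y
  proof -
    define w where "w = christoffel h y u v"
    have hw: "h y w z = w $ 1 * h y e1 z + w $ 2 * h y e2 z" for z
      using linear_vec2[of "\<lambda>w. h y w z" w] bilinear[OF y] by (simp add: bilinear_def)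
    have "n y = h y w e1 *\<^sub>R e1 + h y w e2 *\<^sub>R e2"
      unfolding n_def w_def koszul[OF y, symmetric] by simp
    also have "\<dots> = w $ 1 *\<^sub>R a e1 y + w $ 2 *\<^sub>R a e2 y"
      unfolding a_def hw by (simp add: vec_eq_iff forall_2)
    finally show ?thesis
      using cramer_comb[OF det[OF y]] vec2_decomp unfolding w_def by metis
  qed
  have "a i differentiable (at y)" for i
    unfolding a_def using differentiable[OF assms]
    by (intro differentiable_add differentiable_scaleR differentiable_const)
  moreover have "(\<lambda>y. D y u v w) differentiable (at y)" for u v w
    unfolding D_def using smooth_on_differentiable[OF smooth_on_frechet_derivative[OF smooth] assms] .
  then have "n differentiable (at y)"
    unfolding n_def
    by (intro differentiable_add differentiable_diff differentiable_scaleR differentiable_const differentiable_divide) auto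
  ultimately have "(\<lambda>y. cramer (a e1 y) (a e2 y) (n y)) differentiable (at y)"
    using det[OF assms] by (intro differentiable_cramer) auto
  then obtain A where A: "((\<lambda>y. cramer (a e1 y) (a e2 y) (n y)) has_derivative A) (at y)"
    unfolding differentiable_def by blast
  have "((\<lambda>y. christoffel h y u v) has_derivative A) (at y)"
    by (rule has_derivative_transform_within_open[OF A open_dom assms]) (rule eq)
  then show ?thesis unfolding differentiable_def by blast
qed

text \<open>The second derivatives of \<open>h y w w\<close> commute. Computed by metric
  compatibility, their antisymmetric part is twice the left-hand side, because the product of the
  two first covariant derivatives of \<open>w\<close> is symmetric in \<open>u\<close> and
  \<open>v\<close>.\<close>

lemma curvature_skew:
  assumes y: "y \<in> V"
  shows "h y (riemann_curvature h y u v w) w = 0"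
proof -
  let ?\<Gamma> = "christoffel h"
  have D2: "frechet_derivative (\<lambda>y. frechet_derivative (\<lambda>y. h y w w) (at y) v) (at y) u
      = 2 * (h y (?\<Gamma> y u (?\<Gamma> y v w)) w + h y (?\<Gamma> y v w) (?\<Gamma> y u w)
             + h y (frechet_derivative (\<lambda>y. ?\<Gamma> y v w) (at y) u) w)" for u v
  proof -
    have \<Gamma>: "((\<lambda>y. ?\<Gamma> y v w) has_derivative frechet_derivative (\<lambda>y. ?\<Gamma> y v w) (at y)) (at y)"
      using differentiable_christoffel[OF y] frechet_derivative_works by blast
    have "((\<lambda>y. h y (?\<Gamma> y v w) w) has_derivative (\<lambda>u. D y u (?\<Gamma> y v w) w
           + h y (frechet_derivative (\<lambda>y. ?\<Gamma> y v w) (at y) u) w + h y (?\<Gamma> y v w) 0)) (at y)"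
      using has_derivative_bilinear_family[OF open_dom bilinear differentiable[OF y] has_derivative_ident y \<Gamma> has_derivative_const, of w]
      unfolding D_def .
    then have D1: "((\<lambda>y. 2 * h y (?\<Gamma> y v w) w) has_derivative (\<lambda>u. 2 * (D y u (?\<Gamma> y v w) w
           + h y (frechet_derivative (\<lambda>y. ?\<Gamma> y v w) (at y) u) w + h y (?\<Gamma> y v w) 0))) (at y)"
      by (rule has_derivative_mult_right)
    have eq: "2 * h z (?\<Gamma> z v w) w = frechet_derivative (\<lambda>y. h y w w) (at z) v" if "z \<in> V" for z
      using metric_compatible[OF that, of v w w] sym[OF that, of w] unfolding D_def by simp
    have "((\<lambda>y. frechet_derivative (\<lambda>y. h y w w) (at y) v) has_derivative (\<lambda>u. 2 * (D y u (?\<Gamma> y v w) w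
           + h y (frechet_derivative (\<lambda>y. ?\<Gamma> y v w) (at y) u) w + h y (?\<Gamma> y v w) 0))) (at y)"
      by (rule has_derivative_transform_within_open[OF D1 open_dom y]) (rule eq)
    from frechet_derivative_at[OF this, symmetric] show ?thesis
      using metric_compatible[OF y] bilinear_rzero[OF bilinear[OF y]] by simp
  qed
  have "frechet_derivative (\<lambda>y. frechet_derivative (\<lambda>y. h y w w) (at y) v) (at y) u
      = frechet_derivative (\<lambda>y. frechet_derivative (\<lambda>y. h y w w) (at y) u) (at y) v"
    by (rule frechet_derivative_commute[OF smooth open_dom y])
  then show ?thesis
    unfolding D2 riemann_curvature_def
    using sym[OF y, of "?\<Gamma> y v w" "?\<Gamma> y u w"]
    by (simp add: bilinear_lsub[OF bilinear[OF y]] bilinear_ladd[OF bilinear[OF y]])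
qed

lemma linear_riemann_curvature:
  assumes y: "y \<in> V"
  shows "linear (\<lambda>w. riemann_curvature h y u v w)" "linear (\<lambda>u. riemann_curvature h y u v w)"
proof -
  let ?\<Gamma> = "christoffel h"
  have b: "bilinear (\<lambda>u v. frechet_derivative (\<lambda>y. ?\<Gamma> y u v) (at y) a)" for a
    by (rule bilinear_frechet_family[OF open_dom y]) (auto intro: bilinear_christoffel differentiable_christoffel y)
  have l: "linear (frechet_derivative (\<lambda>y. ?\<Gamma> y u v) (at y))" for u v
    by (rule linear_frechet_derivative[OF differentiable_christoffel[OF y]])
  note B = bilinear_christoffel[OF y]
  note simps = bilinear_ladd[OF B] bilinear_radd[OF B] bilinear_lmul[OF B] bilinear_rmul[OF B]
    bilinear_ladd[OF b] bilinear_radd[OF b] bilinear_lmul[OF b] bilinear_rmul[OF b] linear_add[OF l] linear_scale[OF l]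
  show "linear (\<lambda>w. riemann_curvature h y u v w)" "linear (\<lambda>u. riemann_curvature h y u v w)"
    unfolding linear_iff riemann_curvature_def by (simp_all add: simps algebra_simps)
qed

text \<open>In dimension two, antisymmetry in \<open>u\<close>, \<open>v\<close> and skewness of the
  resulting endomorphism leave one independent component, and the Gauss curvature is defined from
  that one. It remains to compare with \<open>S\<close>, which has the same symmetries, on basis
  vectors.\<close>

lemma riemann_curvature_eq:
  assumes y: "y \<in> V"
  shows "riemann_curvature h y u v w = coord_gauss_curvature h y *\<^sub>R (h y v w *\<^sub>R u - h y u w *\<^sub>R v)"
proof -
  define K where "K = coord_gauss_curvature h y"
  define S where "S u v w = K *\<^sub>R (h y v w *\<^sub>R u - h y u w *\<^sub>R v)" for u v w
  let ?R = "riemann_curvature h y"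
  note b = bilinear[OF y]
  note bs = bilinear_ladd[OF b] bilinear_radd[OF b] bilinear_lmul[OF b] bilinear_rmul[OF b] bilinear_lsub[OF b]
  have anti: "?R u v w = - ?R v u w" "S u v w = - S v u w" for u v w
    unfolding riemann_curvature_def S_def by (simp_all add: algebra_simps)
  have linS: "linear (\<lambda>w. S u v w)" "linear (\<lambda>u. S u v w)" for u v w
    unfolding linear_iff S_def by (simp_all add: bs algebra_simps)
  have skew: "h y (?R e1 e2 w) z = - h y (?R e1 e2 z) w" for w z
    using curvature_skew[OF y, of e1 e2 "w + z"] curvature_skew[OF y, of e1 e2 w] curvature_skew[OF y, of e1 e2 z]
    by (simp add: linear_add[OF linear_riemann_curvature(1)[OF y]] bs)
  have nz: "h y e1 e1 * h y e2 e2 - (h y e1 e2)\<^sup>2 \<noteq> 0" using gram_pos[OF y] by simp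
  have K: "h y (?R e1 e2 e2) e1 = K * (h y e1 e1 * h y e2 e2 - (h y e1 e2)\<^sup>2)"
    unfolding K_def coord_gauss_curvature_def Let_def using nz by simp
  have nd: "a = b" if "h y a e1 = h y b e1" "h y a e2 = h y b e2" for a b
  proof -
    have "h y (a - b) z = 0" for z
      using linear_vec2[of "h y (a - b)" z] that bilinear[OF y] by (simp add: bilinear_def bilinear_lsub[OF b])
    then show ?thesis using nondegenerate[OF y, of "a - b"] by simp
  qed
  have base2: "?R e1 e2 e2 = S e1 e2 e2"
    using K curvature_skew[OF y, of e1 e2 e2] unfolding S_def
    by (intro nd) (simp_all add: bs sym[OF y, of e2 e1] power2_eq_square algebra_simps)
  have base1: "?R e1 e2 e1 = S e1 e2 e1"
    using K curvature_skew[OF y, of e1 e2 e1] skew[of e1 e2] unfolding S_def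
    by (intro nd) (simp_all add: bs sym[OF y, of e2 e1] power2_eq_square algebra_simps)
  have 12: "?R e1 e2 w = S e1 e2 w" for w
    using linear_vec2[OF linear_riemann_curvature(1)[OF y], of e1 e2 w] linear_vec2[OF linS(1), of e1 e2 w] base1 base2 by simp
  have 21: "?R e2 e1 w = S e2 e1 w" for w using 12[of w] anti by metis
  have same: "?R u u w = 0" "S u u w = 0" for u w
    unfolding riemann_curvature_def S_def by simp_all
  have e1v: "?R e1 v w = S e1 v w" for v w
  proof -
    have "?R v e1 w = S v e1 w"
      using linear_vec2[OF linear_riemann_curvature(2)[OF y], of v e1 w] linear_vec2[OF linS(2), of v e1 w] 21 same
      by simp
    then show ?thesis using anti(1)[of e1 v w] anti(2)[of e1 v w] by simp
  qed
  have e2v: "?R e2 v w = S e2 v w" for v w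
  proof -
    have "?R v e2 w = S v e2 w"
      using linear_vec2[OF linear_riemann_curvature(2)[OF y], of v e2 w] linear_vec2[OF linS(2), of v e2 w] 12 same
      by simp
    then show ?thesis using anti(1)[of e2 v w] anti(2)[of e2 v w] by simp
  qed
  have "?R u v w = S u v w"
    using linear_vec2[OF linear_riemann_curvature(2)[OF y], of u v w] linear_vec2[OF linS(2), of u v w] e1v e2v by simp
  then show ?thesis unfolding S_def K_def .
qed

end


section \<open>Pulling back a metric along a local diffeomorphism\<close>

lemma has_derivative_eq_0:
  assumes "(f has_derivative f') (at y)" "open W" "y \<in> W" "\<And>z. z \<in> W \<Longrightarrow> f z = 0"
  shows "f' u = 0"
proof -
  have "((\<lambda>_. 0) has_derivative f') (at y)"
    by (rule has_derivative_transform_within_open[OF assms(1-3)]) (rule assms(4))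
  then show ?thesis using has_derivative_unique has_derivative_const by metis
qed

locale pullback_patch = riemannian_patch V g for V and g :: "(real^2) coord_metric" +
  fixes W :: "(real^2) set" and \<phi> :: "real^2 \<Rightarrow> real^2"
  assumes open_W: "open W"
    and smooth_map: "smooth_on W \<phi>"
    and maps: "\<And>y. y \<in> W \<Longrightarrow> \<phi> y \<in> V"
    and regular: "\<And>y. y \<in> W \<Longrightarrow>
      det2 (frechet_derivative \<phi> (at y) e1) (frechet_derivative \<phi> (at y) e2) \<noteq> 0"
begin

definition P where "P y = frechet_derivative \<phi> (at y)"
definition D2 where "D2 y u v = frechet_derivative (\<lambda>y. P y v) (at y) u"
text \<open>The covariant derivative, along \<open>\<phi>\<close>, of the image of the constant
  field \<open>v\<close>. It is also the vector whose normal part enters the second fundamental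
  form.\<close>

definition N where "N y u v = D2 y u v + christoffel g (\<phi> y) (P y u) (P y v)"
definition H where "H y u v = g (\<phi> y) (P y u) (P y v)"

text \<open>The Levi-Civita connection of the pulled back metric \<open>H\<close>.\<close>

definition C where "C y u v = cramer (P y e1) (P y e2) (N y u v)"

context
  fixes y :: "real^2"
  assumes y: "y \<in> W"
begin

lemma P_has_derivative: "(\<phi> has_derivative P y) (at y)"
  unfolding P_def using smooth_map y by (rule smooth_on_has_derivative)

lemma linear_P: "linear (P y)"
  using P_has_derivative has_derivative_linear by blast

lemma det2_P: "det2 (P y e1) (P y e2) \<noteq> 0"
  unfolding P_def by (rule regular[OF y])

lemma P_inj: "P y u = P y v \<longleftrightarrow> u = v"
proof
  assume "P y u = P y v"
  then have "P y (u - v) = 0" by (simp add: linear_diff[OF linear_P])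
  then have "(u - v) $ 1 *\<^sub>R P y e1 + (u - v) $ 2 *\<^sub>R P y e2 = 0"
    using linear_vec2[OF linear_P] by metis
  then have "cramer (P y e1) (P y e2) 0 = u - v"
    using cramer_comb[OF det2_P, of "(u - v) $ 1" "(u - v) $ 2"] vec2_decomp[of "u - v"] by simp
  then show "u = v" using linear_0[OF linear_cramer] by simp
qed simp

lemma smooth_P: "smooth_on W (\<lambda>y. P y v)"
  unfolding P_def by (rule smooth_on_frechet_derivative[OF smooth_map])

lemma D2_has_derivative: "((\<lambda>y. P y v) has_derivative (\<lambda>u. D2 y u v)) (at y)"
  unfolding D2_def using smooth_P y by (rule smooth_on_has_derivative)

lemma D2_sym: "D2 y u v = D2 y v u"
  unfolding D2_def P_def by (rule frechet_derivative_commute[OF smooth_map open_W y])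

lemma linear_D2: "linear (\<lambda>u. D2 y u v)"
  using D2_has_derivative has_derivative_linear by blast

lemma bilinear_D2: "bilinear (D2 y)"
  unfolding bilinear_def using linear_D2 D2_sym by simp

lemma bilinear_N: "bilinear (N y)"
proof -
  note b = bilinear_christoffel[OF maps[OF y]]
  show ?thesis
    unfolding bilinear_def linear_iff N_def
    by (simp add: bilinear_ladd[OF bilinear_D2] bilinear_radd[OF bilinear_D2] bilinear_lmul[OF bilinear_D2]
        bilinear_rmul[OF bilinear_D2] bilinear_ladd[OF b] bilinear_radd[OF b] bilinear_lmul[OF b]
        bilinear_rmul[OF b] linear_add[OF linear_P] linear_scale[OF linear_P] algebra_simps)
qed

lemma N_sym: "N y u v = N y v u"
  unfolding N_def using D2_sym christoffel_sym[OF maps[OF y]] by metis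

lemma P_C: "P y (C y u v) = N y u v"
  using cramer[OF det2_P] linear_vec2[OF linear_P] unfolding C_def by metis

lemma C_sym: "C y u v = C y v u"
  unfolding C_def using N_sym by metis

lemma bilinear_C: "bilinear (C y)"
  unfolding bilinear_def C_def
  using linear_compose[OF _ linear_cramer] bilinear_N unfolding o_def bilinear_def by blast

lemma bilinear_H: "bilinear (H y)"
  using bilinear[OF maps[OF y]] linear_compose[OF linear_P] unfolding bilinear_def H_def o_def by blast

lemma H_sym: "H y u v = H y v u"
  unfolding H_def using sym[OF maps[OF y]] .

lemma N_has_derivative:
  "((\<lambda>y. N y v w) has_derivative (\<lambda>u. frechet_derivative (\<lambda>y. D2 y v w) (at y) u
     + (frechet_derivative (\<lambda>z. christoffel g z (P y v) (P y w)) (at (\<phi> y)) (P y u)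
        + christoffel g (\<phi> y) (D2 y u v) (P y w) + christoffel g (\<phi> y) (P y v) (D2 y u w)))) (at y)"
  unfolding N_def
proof (rule has_derivative_add)
  show "((\<lambda>y. D2 y v w) has_derivative frechet_derivative (\<lambda>y. D2 y v w) (at y)) (at y)"
    unfolding D2_def by (rule smooth_on_has_derivative[OF smooth_on_frechet_derivative[OF smooth_P] y])
qed (rule has_derivative_bilinear_family[OF open_dom bilinear_christoffel
      differentiable_christoffel[OF maps[OF y]] P_has_derivative maps[OF y] D2_has_derivative D2_has_derivative])

lemma differentiable_C: "(\<lambda>y. C y u v) differentiable (at y)"
proof -
  have "(\<lambda>y. P y v) differentiable (at y)" for v
    using D2_has_derivative differentiable_def by blast
  moreover have "(\<lambda>y. N y u v) differentiable (at y)"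
    using N_has_derivative differentiable_def by blast
  ultimately show ?thesis
    unfolding C_def using det2_P by (intro differentiable_cramer) auto
qed

text \<open>Compatibility with the metric, inherited from \<open>g\<close>. Together with
  \<open>C_sym\<close> it identifies \<open>C\<close> as the Levi-Civita connection of
  \<open>H\<close>.\<close>

lemma H_has_derivative:
  "((\<lambda>y. H y v w) has_derivative (\<lambda>u. H y (C y u v) w + H y v (C y u w))) (at y)"
proof -
  note b = bilinear[OF maps[OF y]]
  have "((\<lambda>y. H y v w) has_derivative (\<lambda>u. D (\<phi> y) (P y u) (P y v) (P y w)
      + g (\<phi> y) (D2 y u v) (P y w) + g (\<phi> y) (P y v) (D2 y u w))) (at y)"
    unfolding H_def D_def
    by (rule has_derivative_bilinear_family[OF open_dom bilinear differentiable[OF maps[OF y]]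
        P_has_derivative maps[OF y] D2_has_derivative D2_has_derivative])
  then show ?thesis
    unfolding H_def P_C N_def metric_compatible[OF maps[OF y]]
    by (simp add: bilinear_ladd[OF b] bilinear_radd[OF b] algebra_simps)
qed

text \<open>Obtained by differentiating \<open>P y (C y v w) = N y v w\<close>; the term
  \<open>D2 y u (C y v w)\<close> that arises on the left is absorbed by the second summand
  \<open>C y u (C y v w)\<close>.\<close>

lemma D_C:
  "P y (frechet_derivative (\<lambda>y. C y v w) (at y) u + C y u (C y v w))
   = frechet_derivative (\<lambda>y. D2 y v w) (at y) u
     + frechet_derivative (\<lambda>z. christoffel g z (P y v) (P y w)) (at (\<phi> y)) (P y u)
     + christoffel g (\<phi> y) (D2 y u v) (P y w) + christoffel g (\<phi> y) (P y v) (D2 y u w)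
     + christoffel g (\<phi> y) (P y u) (N y v w)"
proof -
  have c: "((\<lambda>y. C y v w) has_derivative frechet_derivative (\<lambda>y. C y v w) (at y)) (at y)"
    using differentiable_C frechet_derivative_works by blast
  have lin_P: "linear (P z)" if "z \<in> W" for z
    unfolding P_def by (rule linear_frechet_derivative[OF smooth_on_differentiable[OF smooth_map that]])
  \<comment> \<open>Evaluation of \<open>P z\<close> at a varying vector becomes a bilinear family
    by adding a scalar argument, which is then held at 1.\<close>
  have lin: "bilinear (\<lambda>a t. t *\<^sub>R P z a)" if "z \<in> W" for z
    using lin_P[OF that] unfolding bilinear_def by (auto simp: linear_iff algebra_simps)
  have diff: "(\<lambda>z. t *\<^sub>R P z a) differentiable (at y)" for a t
    using has_derivative_scaleR_right[OF D2_has_derivative] unfolding differentiable_def by blast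
  have "((\<lambda>z. (1::real) *\<^sub>R P z (C z v w)) has_derivative (\<lambda>u. frechet_derivative (\<lambda>z. 1 *\<^sub>R P z (C y v w)) (at y) u
      + 1 *\<^sub>R P y (frechet_derivative (\<lambda>y. C y v w) (at y) u) + 0 *\<^sub>R P y (C y v w))) (at y)"
    by (rule has_derivative_bilinear_family[OF open_W lin diff has_derivative_ident y c has_derivative_const])
  then have 1: "((\<lambda>z. P z (C z v w)) has_derivative (\<lambda>u. D2 y u (C y v w)
      + P y (frechet_derivative (\<lambda>y. C y v w) (at y) u))) (at y)"
    by (simp add: D2_def)
  have eq: "P z (C z v w) = N z v w" if "z \<in> W" for z
    using cramer[OF regular[OF that], of "N z v w"] linear_vec2[OF lin_P[OF that], of "C z v w"]
    unfolding C_def P_def by metis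
  have "((\<lambda>z. N z v w) has_derivative (\<lambda>u. D2 y u (C y v w)
      + P y (frechet_derivative (\<lambda>y. C y v w) (at y) u))) (at y)"
    by (rule has_derivative_transform_within_open[OF 1 open_W y]) (rule eq)
  from fun_cong[OF has_derivative_unique[OF this N_has_derivative], of u]
  have "P y (frechet_derivative (\<lambda>y. C y v w) (at y) u) = frechet_derivative (\<lambda>y. D2 y v w) (at y) u
     + (frechet_derivative (\<lambda>z. christoffel g z (P y v) (P y w)) (at (\<phi> y)) (P y u)
        + christoffel g (\<phi> y) (D2 y u v) (P y w) + christoffel g (\<phi> y) (P y v) (D2 y u w)) - D2 y u (C y v w)"
    by (simp add: algebra_simps)
  moreover have "P y (C y u (C y v w)) = D2 y u (C y v w) + christoffel g (\<phi> y) (P y u) (N y v w)"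
    unfolding P_C[of u] N_def[of y u] P_C ..
  ultimately show ?thesis
    by (simp add: linear_add[OF linear_P] algebra_simps)
qed

text \<open>Naturality of curvature: under \<open>P y\<close> the left-hand side becomes the
  curvature of \<open>g\<close>, since the third derivatives of \<open>\<phi>\<close> and the terms
  with \<open>D2 y u v\<close> cancel by symmetry. Injectivity of \<open>P y\<close> then transfers
  the two-dimensional formula.\<close>

lemma C_curvature:
  "frechet_derivative (\<lambda>y. C y v w) (at y) u + C y u (C y v w)
   - (frechet_derivative (\<lambda>y. C y u w) (at y) v + C y v (C y u w))
   = coord_gauss_curvature g (\<phi> y) *\<^sub>R (H y v w *\<^sub>R u - H y u w *\<^sub>R v)" (is "?L = ?R")
proof -
  note b = bilinear_christoffel[OF maps[OF y]]
  have comm: "frechet_derivative (\<lambda>y. D2 y v w) (at y) u = frechet_derivative (\<lambda>y. D2 y u w) (at y) v"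
    unfolding D2_def by (rule frechet_derivative_commute[OF smooth_P open_W y])
  have "P y ?L = riemann_curvature g (\<phi> y) (P y u) (P y v) (P y w)"
    unfolding linear_diff[OF linear_P] D_C riemann_curvature_def comm D2_sym[of v u] N_def
    by (simp add: bilinear_radd[OF b])
  also have "\<dots> = P y ?R"
    unfolding riemann_curvature_eq[OF maps[OF y]] H_def
    by (simp add: linear_diff[OF linear_P] linear_scale[OF linear_P])
  finally show ?thesis unfolding P_inj .
qed

end

abbreviation h where "h y \<equiv> \<lambda>i j. H y (axis i 1) (axis j 1)"
abbreviation c where "c y \<equiv> \<lambda>l i j. C y (axis i 1) (axis j 1) $ l"
definition dc where "dc y = (\<lambda>u l i j. frechet_derivative (\<lambda>y. C y (axis i 1) (axis j 1)) (at y) (axis u 1) $ l)"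

lemma H_C_expand: "y \<in> W \<Longrightarrow>
  H y (C y (axis u 1) (axis i 1)) (axis j 1) + H y (axis i 1) (C y (axis u 1) (axis j 1))
  = (\<Sum>l\<in>UNIV. c y l u i * h y l j + c y l u j * h y i l)"
  using linear_vec2[of "\<lambda>x. H y x (axis j 1)" "C y (axis u 1) (axis i 1)"]
    linear_vec2[of "H y (axis i 1)" "C y (axis u 1) (axis j 1)"] bilinear_H[of y]
  by (simp add: bilinear_def sum_2)

lemma c_has_derivative:
  assumes "y \<in> W"
  shows "((\<lambda>y. c y l i j) has_derivative (\<lambda>u. frechet_derivative (\<lambda>y. C y (axis i 1) (axis j 1)) (at y) u $ l)) (at y)"
  using differentiable_C[OF assms] frechet_derivative_works bounded_linear.has_derivative[OF bounded_linear_vec_nth] by blast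

text \<open>Jacobi's formula combined with metric compatibility. It turns equality of the two
  determinants on an open set into equality of the contractions of the two connections.\<close>

lemma det_has_derivative:
  assumes "y \<in> W"
  shows "\<exists>A. ((\<lambda>y. mixed_det (h y) (h y)) has_derivative A) (at y)
     \<and> (\<forall>j. A (axis j 1) = 2 * mixed_det (h y) (h y) * (\<Sum>l\<in>UNIV. c y l l j))"
proof (intro exI conjI allI)
  let ?A = "\<lambda>u i j. H y (C y u (axis i 1)) (axis j 1) + H y (axis i 1) (C y u (axis j 1))"
  let ?B = "\<lambda>u. 2 * (?A u 1 1 * h y 2 2 + h y 1 1 * ?A u 2 2 - 2 * h y 1 2 * ?A u 1 2)"
  show "((\<lambda>y. mixed_det (h y) (h y)) has_derivative ?B) (at y)"
    unfolding mixed_det_def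
    by (auto intro!: derivative_eq_intros H_has_derivative assms simp: algebra_simps)
  show "?B (axis j 1) = 2 * mixed_det (h y) (h y) * (\<Sum>l\<in>UNIV. c y l l j)" for j
    unfolding H_C_expand[OF assms] mixed_det_def sum_2
      H_sym[OF assms, of e2 e1] C_sym[OF assms, of e2 e1]
    using exhaust_2[of j] C_sym[OF assms, of e2 e1] by (auto simp: algebra_simps)
qed

lemma curvature_components:
  assumes "y \<in> W"
  shows "dc y 1 l 2 w - dc y 2 l 1 w + (\<Sum>m\<in>UNIV. c y l 1 m * c y m 2 w - c y l 2 m * c y m 1 w)
     = coord_gauss_curvature g (\<phi> y) * (if l = 1 then h y 2 w else - h y 1 w)"
proof -
  have "C y a (C y b v) $ l = C y b v $ 1 * C y a e1 $ l + C y b v $ 2 * C y a e2 $ l" for a b v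
    using linear_vec2[of "C y a" "C y b v"] bilinear_C[OF assms] unfolding bilinear_def
    by (metis vector_add_component vector_scaleR_component real_scaleR_def)
  then show ?thesis
    using arg_cong[OF C_curvature[OF assms, of e2 "axis w 1" e1], of "\<lambda>x. x $ l"] exhaust_2[of l]
    unfolding dc_def by (auto simp: sum_2 algebra_simps)
qed

end

text \<open>The determinant and trace conditions hold on the whole open set, so they may be
  differentiated, which supplies the first-order data of the algebraic lemma. That lemma is applied
  with \<open>k\<close> equal to \<open>\<epsilon>\<close> times the second metric: a constant
  factor leaves connection and curvature operator unchanged and, as \<open>\<epsilon>\<close> is its
  own inverse, multiplies the Gauss curvature by \<open>\<epsilon>\<close>.\<close>

lemma minimal_lagrangian_curvature_relation:
  assumes P1: "pullback_patch V1 g1 W \<phi>" and P2: "pullback_patch V2 g2 W \<psi>"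
    and eps: "\<epsilon> \<in> {1, - 1}" and y: "y \<in> W"
  defines "h1 \<equiv> pullback_patch.h g1 \<phi>" and "h2 \<equiv> pullback_patch.h g2 \<psi>"
  defines "c1 \<equiv> pullback_patch.c g1 \<phi>" and "c2 \<equiv> pullback_patch.c g2 \<psi>"
  defines "G \<equiv> \<lambda>z i j. h1 z i j + \<epsilon> * h2 z i j"
  assumes det: "\<And>z. z \<in> W \<Longrightarrow> mixed_det (h1 z) (h1 z) = mixed_det (h2 z) (h2 z)"
    and nondeg: "mixed_det (G y) (G y) \<noteq> 0"
    and min: "\<And>z l. z \<in> W \<Longrightarrow> mixed_det (G z) (\<lambda>i j. c1 z l i j - c2 z l i j) = 0"
  shows "coord_gauss_curvature g1 (\<phi> y) = \<epsilon> * coord_gauss_curvature g2 (\<psi> y)"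
proof -
  interpret P1: pullback_patch V1 g1 W \<phi> by (rule P1)
  interpret P2: pullback_patch V2 g2 W \<psi> by (rule P2)
  have eps2: "\<epsilon> * \<epsilon> = 1" "\<epsilon> * (\<epsilon> * x) = x" for x using eps by auto
  have W: "open W" by (rule P1.open_W)
  have trace: "(\<Sum>l\<in>UNIV. c1 z l l j) = (\<Sum>l\<in>UNIV. c2 z l l j)" if z: "z \<in> W" for z j
  proof -
    obtain A1 where A1: "((\<lambda>y. mixed_det (h1 y) (h1 y)) has_derivative A1) (at z)"
        "A1 (axis j 1) = 2 * mixed_det (h1 z) (h1 z) * (\<Sum>l\<in>UNIV. c1 z l l j)"
      using P1.det_has_derivative[OF z] unfolding h1_def c1_def by blast
    obtain A2 where A2: "((\<lambda>y. mixed_det (h2 y) (h2 y)) has_derivative A2) (at z)"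
        "A2 (axis j 1) = 2 * mixed_det (h2 z) (h2 z) * (\<Sum>l\<in>UNIV. c2 z l l j)"
      using P2.det_has_derivative[OF z] unfolding h2_def c2_def by blast
    have "A1 (axis j 1) - A2 (axis j 1) = 0"
      by (rule has_derivative_eq_0[OF has_derivative_diff[OF A1(1) A2(1)] W z]) (simp add: det)
    moreover have "mixed_det (h1 z) (h1 z) \<noteq> 0"
    proof
      assume 0: "mixed_det (h1 z) (h1 z) = 0"
      \<comment> \<open>Orthogonal to \<open>e2\<close>, so its square is
        \<open>P1.H z e2 e2\<close> times the Gram determinant, which would be zero.\<close>
      define K where "K = P1.H z e2 e2 *\<^sub>R e1 - P1.H z e1 e2 *\<^sub>R e2"
      note b = P1.bilinear_H[OF z]
      have pos: "P1.H z u u > 0" if "u \<noteq> 0" for u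
        unfolding P1.H_def using P1.pos[OF P1.maps[OF z]] P1.P_inj[OF z, of u 0] that linear_0[OF P1.linear_P[OF z]] by simp
      have "K $ 1 \<noteq> 0" using pos[of e2] unfolding K_def by (simp add: axis_eq_0_iff)
      then have "P1.H z K K > 0" using pos by (metis zero_index)
      moreover have "P1.H z K K = P1.H z e2 e2 * (P1.H z e1 e1 * P1.H z e2 e2 - P1.H z e1 e2 * P1.H z e1 e2)"
        unfolding K_def by (simp add: bilinear_lsub[OF b] bilinear_rsub[OF b]
          bilinear_lmul[OF b] bilinear_rmul[OF b] P1.H_sym[OF z, of e2 e1] algebra_simps)
      moreover have "P1.H z e1 e1 * P1.H z e2 e2 - P1.H z e1 e2 * P1.H z e1 e2 = 0"
        using 0 unfolding mixed_det_def h1_def by (simp add: algebra_simps)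
      ultimately show False by simp
    qed
    ultimately show ?thesis using A1(2) A2(2) det[OF z] by simp
  qed
  have dcd: "((\<lambda>z. c1 z l i j - c2 z l i j) has_derivative
      (\<lambda>u. frechet_derivative (\<lambda>y. P1.C y (axis i 1) (axis j 1)) (at y) u $ l
         - frechet_derivative (\<lambda>y. P2.C y (axis i 1) (axis j 1)) (at y) u $ l)) (at y)" for l i j
    unfolding c1_def c2_def by (rule has_derivative_diff[OF P1.c_has_derivative[OF y] P2.c_has_derivative[OF y]])
  have dtrace: "(\<Sum>l\<in>UNIV. P1.dc y u l l j) = (\<Sum>l\<in>UNIV. P2.dc y u l l j)" for u j
  proof -
    have "(\<Sum>l\<in>UNIV. P1.dc y u l l j - P2.dc y u l l j) = 0"
      unfolding P1.dc_def P2.dc_def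
      by (rule has_derivative_eq_0[OF has_derivative_sum[OF dcd] W y]) (simp add: sum_subtractf trace)
    then show ?thesis by (simp add: sum_subtractf)
  qed
  define dG where "dG u i j = (\<Sum>l\<in>UNIV. c1 y l u i * h1 y l j + c1 y l u j * h1 y i l)
                        + (\<Sum>l\<in>UNIV. c2 y l u i * (\<epsilon> * h2 y l j) + c2 y l u j * (\<epsilon> * h2 y i l))" for u i j
  have dmin: "mixed_det (dG u) (\<lambda>i j. c1 y l i j - c2 y l i j)
       + mixed_det (G y) (\<lambda>i j. P1.dc y u l i j - P2.dc y u l i j) = 0" for u l
  proof -
    define dG' where "dG' i j u = P1.H y (P1.C y u (axis i 1)) (axis j 1) + P1.H y (axis i 1) (P1.C y u (axis j 1))
      + \<epsilon> * (P2.H y (P2.C y u (axis i 1)) (axis j 1) + P2.H y (axis i 1) (P2.C y u (axis j 1)))" for i j u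
    have G': "((\<lambda>z. G z i j) has_derivative dG' i j) (at y)" for i j
      unfolding G_def h1_def h2_def dG'_def
      by (intro has_derivative_add has_derivative_mult_right P1.H_has_derivative P2.H_has_derivative y)
    have dG'_eq: "dG' i j (axis u 1) = dG u i j" for i j
      unfolding dG'_def dG_def P1.H_C_expand[OF y] P2.H_C_expand[OF y] c1_def c2_def h1_def h2_def
      by (simp add: sum_2 algebra_simps)
    let ?A = "\<lambda>i j u. frechet_derivative (\<lambda>y. P1.C y (axis i 1) (axis j 1)) (at y) u $ l
         - frechet_derivative (\<lambda>y. P2.C y (axis i 1) (axis j 1)) (at y) u $ l"
    let ?t = "\<lambda>i j. c1 y l i j - c2 y l i j"
    have "((\<lambda>z. mixed_det (G z) (\<lambda>i j. c1 z l i j - c2 z l i j)) has_derivative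
       (\<lambda>u. G y 2 2 * ?A 1 1 u + dG' 2 2 u * ?t 1 1 - (2 * G y 1 2 * ?A 1 2 u + 2 * dG' 1 2 u * ?t 1 2)
          + (G y 1 1 * ?A 2 2 u + dG' 1 1 u * ?t 2 2))) (at y)"
      unfolding mixed_det_def
      by (intro has_derivative_add has_derivative_diff has_derivative_mult has_derivative_mult_right G' dcd)
    from has_derivative_eq_0[OF this W y min, of "axis u 1"]
    show ?thesis
      unfolding dG'_eq mixed_det_def P1.dc_def P2.dc_def by (simp add: algebra_simps)
  qed
  show ?thesis
  proof (rule curvature_eq_of_traceless_difference[where h = "h1 y" and k = "\<lambda>i j. \<epsilon> * h2 y i j" and ?c1.0 = "c1 y" and ?c2.0 = "c2 y"
        and ?d1.0 = "P1.dc y" and ?d2.0 = "P2.dc y"])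
    show "mixed_det (h1 y) (h1 y) = mixed_det (\<lambda>i j. \<epsilon> * h2 y i j) (\<lambda>i j. \<epsilon> * h2 y i j)"
      using det[OF y] unfolding mixed_det_def by (simp add: mult.left_commute eps2)
    show "P2.dc y 1 l 2 w - P2.dc y 2 l 1 w + (\<Sum>m\<in>UNIV. c2 y l 1 m * c2 y m 2 w - c2 y l 2 m * c2 y m 1 w)
        = \<epsilon> * coord_gauss_curvature g2 (\<psi> y) * (if l = 1 then \<epsilon> * h2 y 2 w else - (\<epsilon> * h2 y 1 w))" for l w
      unfolding P2.curvature_components[OF y, folded c2_def h2_def] c2_def h2_def
      by (simp add: mult.left_commute mult.assoc eps2)
    show "P1.dc y u l 2 1 = P1.dc y u l 1 2" for u l
      unfolding P1.dc_def
      using frechet_derivative_transform_within_open[OF P1.differentiable_C[OF y] W y P1.C_sym, of e2 e1] by simp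
    show "P2.dc y u l 2 1 = P2.dc y u l 1 2" for u l
      unfolding P2.dc_def
      using frechet_derivative_transform_within_open[OF P2.differentiable_C[OF y] W y P2.C_sym, of e2 e1] by simp
    show "(\<Sum>l\<in>UNIV. c1 y l l j) = (\<Sum>l\<in>UNIV. c2 y l l j)" for j by (rule trace[OF y])
  qed (use y nondeg dtrace min dmin P1.curvature_components[OF y] P1.H_sym[OF y] P2.H_sym[OF y] P1.C_sym[OF y] P2.C_sym[OF y]
      in \<open>simp_all add: G_def dG_def[abs_def] h1_def h2_def c1_def c2_def\<close>)
qed


section \<open>Mean curvature in a product\<close>

text \<open>The tangential part \<open>D a\<close> is found by representing the functional
  \<open>b w (D c)\<close> of \<open>c\<close> through the form pulled back by \<open>D\<close>.
  Nondegeneracy of that form makes the definite description in \<open>normal_part\<close> meaningful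
  even if \<open>b\<close> is indefinite.\<close>

lemma normal_part_complement:
  fixes b :: "'f::euclidean_space \<Rightarrow> 'f \<Rightarrow> real" and D :: "'e::euclidean_space \<Rightarrow> 'f"
  assumes b: "bilinear b" and D: "linear D"
    and nondeg: "\<And>a. (\<And>c. b (D a) (D c) = 0) \<Longrightarrow> a = 0"
  shows "w - normal_part b (range D) w \<in> range D"
proof -
  have "bilinear (\<lambda>a c. b (D a) (D c))"
    using b linear_compose[OF D] unfolding bilinear_def o_def by blast
  moreover have "linear (\<lambda>c. b w (D c))"
    using b linear_compose[OF D] unfolding bilinear_def o_def by blast
  ultimately have "\<exists>!a. \<forall>c. b (D a) (D c) = b w (D c)"
    using nondeg by (intro riesz_nondegenerate) auto
  then obtain a where a: "\<And>c. b (D a) (D c) = b w (D c)"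
      and unique: "\<And>a'. (\<And>c. b (D a') (D c) = b w (D c)) \<Longrightarrow> a' = a" by metis
  have "normal_part b (range D) w = w - D a"
    unfolding normal_part_def
  proof (rule the_equality)
    fix n assume n: "w - n \<in> range D \<and> (\<forall>t\<in>range D. b n t = 0)"
    then obtain a' where a': "w - n = D a'" by blast
    have "b (D a') (D c) = b w (D c)" for c
      using n unfolding a'[symmetric] by (simp add: bilinear_lsub[OF b])
    then have "a' = a" by (rule unique)
    then show "n = w - D a" using a' by (simp add: algebra_simps)
  qed (use a in \<open>auto simp: bilinear_lsub[OF b]\<close>)
  then show ?thesis by simp
qed

text \<open>\<open>mixed_det\<close> pairs \<open>t\<close> with the adjugate of \<open>A\<close>,
  and the inverse is the adjugate over the determinant. The factor 2 appears because
  \<open>mixed_det\<close> of a symmetric matrix with itself is twice its determinant.\<close>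

lemma mixed_det_matrix_inv:
  fixes A :: "real^2^2"
  assumes "mixed_det (\<lambda>i j. A $ i $ j) (\<lambda>i j. A $ i $ j) \<noteq> 0" "A $ 2 $ 1 = A $ 1 $ 2" "t 2 1 = t 1 2"
  shows "2 * mixed_det (\<lambda>i j. A $ i $ j) t =
    mixed_det (\<lambda>i j. A $ i $ j) (\<lambda>i j. A $ i $ j) * (\<Sum>i\<in>UNIV. \<Sum>j\<in>UNIV. matrix_inv A $ i $ j * t i j)"
proof -
  define X where "X = matrix_inv A"
  have "det A \<noteq> 0" using assms(1,2) unfolding mixed_det_def det_2 by (simp add: algebra_simps)
  then have "A ** X = mat 1"
    using someI_ex[of "\<lambda>A'. A ** A' = mat 1 \<and> A' ** A = mat 1"] unfolding X_def matrix_inv_def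
    by (metis invertible_def invertible_det_nz)
  then have "(A ** X) $ i $ j = (if i = j then 1 else 0)" for i j by (simp add: mat_def)
  then have "A $ i $ 1 * X $ 1 $ j + A $ i $ 2 * X $ 2 $ j = (if i = j then 1 else 0)" for i j
    by (simp add: matrix_matrix_mult_def sum_2)
  from this[of 1 1] this[of 1 2] this[of 2 1] this[of 2 2]
  have "A $ 1 $ 1 * X $ 1 $ 1 + A $ 1 $ 2 * X $ 2 $ 1 = 1" "A $ 1 $ 1 * X $ 1 $ 2 + A $ 1 $ 2 * X $ 2 $ 2 = 0"
    "A $ 1 $ 2 * X $ 1 $ 1 + A $ 2 $ 2 * X $ 2 $ 1 = 0" "A $ 1 $ 2 * X $ 1 $ 2 + A $ 2 $ 2 * X $ 2 $ 2 = 1"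
    using assms(2) by simp_all
  then show ?thesis
    unfolding X_def[symmetric] mixed_det_def sum_2 assms(3) by algebra
qed

locale product_patch = M1: riemannian_patch V1 g1 + M2: riemannian_patch V2 g2
  for V1 V2 g1 g2 +
  fixes \<epsilon> :: real and h :: "((real^2) \<times> (real^2)) coord_metric"
  assumes eps: "\<epsilon> \<noteq> 0"
    and h: "\<And>z u v. z \<in> V1 \<times> V2 \<Longrightarrow>
      h z u v = g1 (fst z) (fst u) (fst v) + \<epsilon> * g2 (snd z) (snd u) (snd v)"
begin

lemma h_has_derivative:
  assumes "z \<in> V1 \<times> V2"
  shows "((\<lambda>z. h z u v) has_derivative
    (\<lambda>w. M1.D (fst z) (fst w) (fst u) (fst v) + \<epsilon> * M2.D (snd z) (snd w) (snd u) (snd v))) (at z)"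
proof -
  have "((\<lambda>x. g1 (fst x) (fst u) (fst v)) has_derivative (\<lambda>w. M1.D (fst z) (fst w) (fst u) (fst v))) (at z)"
    unfolding M1.D_def using assms
    by (intro has_derivative_compose[of fst fst, OF bounded_linear_imp_has_derivative[OF bounded_linear_fst]])
      (auto simp: frechet_derivative_works[symmetric] intro: M1.differentiable)
  moreover have "((\<lambda>x. g2 (snd x) (snd u) (snd v)) has_derivative (\<lambda>w. M2.D (snd z) (snd w) (snd u) (snd v))) (at z)"
    unfolding M2.D_def using assms
    by (intro has_derivative_compose[of snd snd, OF bounded_linear_imp_has_derivative[OF bounded_linear_snd]])
      (auto simp: frechet_derivative_works[symmetric] intro: M2.differentiable)
  ultimately have "((\<lambda>x. g1 (fst x) (fst u) (fst v) + \<epsilon> * g2 (snd x) (snd u) (snd v)) has_derivative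
    (\<lambda>w. M1.D (fst z) (fst w) (fst u) (fst v) + \<epsilon> * M2.D (snd z) (snd w) (snd u) (snd v))) (at z)"
    by (intro has_derivative_add has_derivative_mult_right)
  then show ?thesis
    using open_Times[OF M1.open_dom M2.open_dom] assms
    by (rule has_derivative_transform_within_open) (simp add: h)
qed

sublocale prod: metric_patch "V1 \<times> V2" h
proof
  show "open (V1 \<times> V2)" by (rule open_Times[OF M1.open_dom M2.open_dom])
  fix z u v assume z: "z \<in> V1 \<times> V2"
  then have z': "fst z \<in> V1" "snd z \<in> V2" by auto
  show "(\<lambda>y. h y u v) differentiable (at z)" using h_has_derivative[OF z] differentiable_def by blast
  note b1 = M1.bilinear[OF z'(1)] and b2 = M2.bilinear[OF z'(2)]
  show "bilinear (h z)"
    unfolding bilinear_def linear_iff h[OF z]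
    by (simp add: bilinear_ladd[OF b1] bilinear_radd[OF b1] bilinear_lmul[OF b1] bilinear_rmul[OF b1]
      bilinear_ladd[OF b2] bilinear_radd[OF b2] bilinear_lmul[OF b2] bilinear_rmul[OF b2] algebra_simps)
  show "h z u v = h z v u" unfolding h[OF z] using M1.sym[OF z'(1)] M2.sym[OF z'(2)] by simp
next
  fix z u assume z: "z \<in> V1 \<times> V2" and 0: "\<And>v. h z u v = 0"
  then have z': "fst z \<in> V1" "snd z \<in> V2" by auto
  have "fst u = 0"
    using 0[of "(_, 0)"] M1.nondegenerate[OF z'(1)]
    by (simp add: h[OF z] bilinear_rzero[OF M2.bilinear[OF z'(2)]])
  moreover have "snd u = 0"
    using 0[of "(0, _)"] M2.nondegenerate[OF z'(2)] eps
    by (simp add: h[OF z] bilinear_rzero[OF M1.bilinear[OF z'(1)]])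
  ultimately show "u = 0" by (simp add: prod_eq_iff)
qed

text \<open>Metric and derivatives split, so the pair satisfies the Koszul identity;
  \<open>\<epsilon>\<close> multiplies both sides of the identity of the second factor and drops
  out.\<close>

lemma christoffel_prod:
  assumes z: "z \<in> V1 \<times> V2"
  shows "christoffel h z u v =
    (christoffel g1 (fst z) (fst u) (fst v), christoffel g2 (snd z) (snd u) (snd v))"
proof (rule prod.christoffel_eqI[OF z])
  fix w
  have D: "prod.D z a b c = M1.D (fst z) (fst a) (fst b) (fst c) + \<epsilon> * M2.D (snd z) (snd a) (snd b) (snd c)" for a b c
    unfolding prod.D_def using frechet_derivative_at[OF h_has_derivative[OF z], symmetric] by simp
  have "2 * h z (christoffel g1 (fst z) (fst u) (fst v), christoffel g2 (snd z) (snd u) (snd v)) w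
     = 2 * g1 (fst z) (christoffel g1 (fst z) (fst u) (fst v)) (fst w)
       + \<epsilon> * (2 * g2 (snd z) (christoffel g2 (snd z) (snd u) (snd v)) (snd w))"
    unfolding h[OF z] by simp
  also have "\<dots> = prod.D z u v w + prod.D z v u w - prod.D z w u v"
    using z by (auto simp: M1.koszul M2.koszul D algebra_simps)
  finally show "2 * h z (christoffel g1 (fst z) (fst u) (fst v), christoffel g2 (snd z) (snd u) (snd v)) w
     = prod.D z u v w + prod.D z v u w - prod.D z w u v" .
qed

end

text \<open>If the normal part of the trace of \<open>(P1.N, P2.N)\<close> vanishes, the trace is
  the image under \<open>D\<close> of a single tangent vector. Both components of \<open>D\<close>
  are injective, so the traces of \<open>P1.C\<close> and \<open>P2.C\<close> both equal that
  vector, and their difference is zero.\<close>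

lemma mean_curvature_zero_imp_trace_zero:
  assumes P1: "pullback_patch V1 g1 W \<phi>" and P2: "pullback_patch V2 g2 W \<psi>"
    and prod: "product_patch V1 V2 g1 g2 \<epsilon> h" and y: "y \<in> W"
  defines "h1 \<equiv> pullback_patch.h g1 \<phi>" and "h2 \<equiv> pullback_patch.h g2 \<psi>"
  defines "c1 \<equiv> pullback_patch.c g1 \<phi>" and "c2 \<equiv> pullback_patch.c g2 \<psi>"
  defines "G \<equiv> \<lambda>i j. h1 y i j + \<epsilon> * h2 y i j"
  assumes nondeg: "mixed_det G G \<noteq> 0"
    and min: "mean_curvature_vector h (\<lambda>y. (\<phi> y, \<psi> y)) y = 0"
  shows "mixed_det G (\<lambda>i j. c1 y l i j - c2 y l i j) = 0"
proof -
  interpret P1: pullback_patch V1 g1 W \<phi> by (rule P1)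
  interpret P2: pullback_patch V2 g2 W \<psi> by (rule P2)
  interpret product_patch V1 V2 g1 g2 \<epsilon> h by (rule prod)
  define F where "F y = (\<phi> y, \<psi> y)" for y
  have Fy: "F y \<in> V1 \<times> V2" unfolding F_def using P1.maps[OF y] P2.maps[OF y] by simp
  have dF: "frechet_derivative F (at z) = (\<lambda>u. (P1.P z u, P2.P z u))" if "z \<in> W" for z
    unfolding F_def
    by (rule frechet_derivative_at[symmetric]) (intro has_derivative_Pair P1.P_has_derivative P2.P_has_derivative that)
  define D where "D = frechet_derivative F (at y)"
  have D: "D u = (P1.P y u, P2.P y u)" for u unfolding D_def dF[OF y] by simp
  have lin: "linear D"
    using P1.linear_P[OF y] P2.linear_P[OF y] unfolding linear_iff D by simp
  have d2F: "frechet_derivative (\<lambda>y. frechet_derivative F (at y) v) (at y) u = (P1.D2 y u v, P2.D2 y u v)" for u v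
  proof -
    have 1: "((\<lambda>z. (P1.P z v, P2.P z v)) has_derivative (\<lambda>u. (P1.D2 y u v, P2.D2 y u v))) (at y)"
      by (intro has_derivative_Pair P1.D2_has_derivative P2.D2_has_derivative y)
    have "((\<lambda>z. frechet_derivative F (at z) v) has_derivative (\<lambda>u. (P1.D2 y u v, P2.D2 y u v))) (at y)"
      by (rule has_derivative_transform_within_open[OF 1 P1.open_W y]) (simp add: dF)
    from frechet_derivative_at[OF this, symmetric] show ?thesis by simp
  qed
  have hD: "h (F y) (D u) (D v) = P1.H y u v + \<epsilon> * P2.H y u v" for u v
    using h[OF Fy, of "D u" "D v"] unfolding D P1.H_def P2.H_def F_def by simp
  note bH1 = P1.bilinear_H[OF y] and bH2 = P2.bilinear_H[OF y]
  have nd: "a = 0" if "\<And>c. h (F y) (D a) (D c) = 0" for a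
  proof -
    have eq: "a $ 1 * G 1 j + a $ 2 * G 2 j = 0" for j
      using that[of "axis j 1"] linear_vec2[of "\<lambda>a. P1.H y a (axis j 1)" a] linear_vec2[of "\<lambda>a. P2.H y a (axis j 1)" a] bH1 bH2
      unfolding hD G_def h1_def h2_def by (simp add: bilinear_def algebra_simps)
    have G21: "G 2 1 = G 1 2" unfolding G_def h1_def h2_def using P1.H_sym[OF y] P2.H_sym[OF y] by simp
    have "a $ 1 * mixed_det G G = 0" "a $ 2 * mixed_det G G = 0"
      using eq[of 1] eq[of 2] unfolding mixed_det_def G21 by algebra+
    then show ?thesis using nondeg by (simp add: vec_eq_iff forall_2)
  qed
  define A where "A = (\<chi> i j. h (F y) (D (axis i 1)) (D (axis j 1)) :: real^2^2)"
  have A: "A $ i $ j = G i j" for i j unfolding A_def G_def h1_def h2_def by (simp add: hD)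
  define X where "X = matrix_inv A"
  let ?w = "\<lambda>i j. (P1.N y (axis i 1) (axis j 1), P2.N y (axis i 1) (axis j 1))"
  have sff: "second_fundamental_form h F y (axis i 1) (axis j 1) = normal_part (h (F y)) (range D) (?w i j)" for i j
    unfolding second_fundamental_form_def Let_def D_def[symmetric] d2F christoffel_prod[OF Fy] D P1.N_def P2.N_def
    by (simp add: F_def)
  have "\<exists>a. ?w i j - normal_part (h (F y)) (range D) (?w i j) = D a" for i j
    using normal_part_complement[OF prod.bilinear[OF Fy] lin nd] by blast
  then obtain a where a: "\<And>i j. ?w i j - normal_part (h (F y)) (range D) (?w i j) = D (a i j)" by metis
  have "(\<Sum>i\<in>UNIV. \<Sum>j\<in>UNIV. X $ i $ j *\<^sub>R second_fundamental_form h F y (axis i 1) (axis j 1)) = 0"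
    using min[folded F_def[abs_def]]
    unfolding mean_curvature_vector_def Let_def D_def[symmetric] A_def[symmetric] X_def[symmetric] .
  moreover have "second_fundamental_form h F y (axis i 1) (axis j 1) = ?w i j - D (a i j)" for i j
    unfolding sff a[of i j, symmetric] by simp
  ultimately have "(\<Sum>i\<in>UNIV. \<Sum>j\<in>UNIV. X $ i $ j *\<^sub>R (?w i j - D (a i j))) = 0" by simp
  then have "(\<Sum>i\<in>UNIV. \<Sum>j\<in>UNIV. X $ i $ j *\<^sub>R ?w i j) = D (\<Sum>i\<in>UNIV. \<Sum>j\<in>UNIV. X $ i $ j *\<^sub>R a i j)"
    by (simp only: scaleR_diff_right sum_subtractf linear_sum[OF lin] linear_scale[OF lin] right_minus_eq)
  then have "(\<Sum>i\<in>UNIV. \<Sum>j\<in>UNIV. X $ i $ j *\<^sub>R P1.N y (axis i 1) (axis j 1)) = P1.P y (\<Sum>i\<in>UNIV. \<Sum>j\<in>UNIV. X $ i $ j *\<^sub>R a i j)"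
    "(\<Sum>i\<in>UNIV. \<Sum>j\<in>UNIV. X $ i $ j *\<^sub>R P2.N y (axis i 1) (axis j 1)) = P2.P y (\<Sum>i\<in>UNIV. \<Sum>j\<in>UNIV. X $ i $ j *\<^sub>R a i j)"
    unfolding D by (simp_all add: prod_eq_iff fst_sum snd_sum)
  then have "(\<Sum>i\<in>UNIV. \<Sum>j\<in>UNIV. X $ i $ j *\<^sub>R P1.C y (axis i 1) (axis j 1)) = (\<Sum>i\<in>UNIV. \<Sum>j\<in>UNIV. X $ i $ j *\<^sub>R a i j)"
    "(\<Sum>i\<in>UNIV. \<Sum>j\<in>UNIV. X $ i $ j *\<^sub>R P2.C y (axis i 1) (axis j 1)) = (\<Sum>i\<in>UNIV. \<Sum>j\<in>UNIV. X $ i $ j *\<^sub>R a i j)"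
    unfolding P1.P_C[OF y, symmetric] P2.P_C[OF y, symmetric] linear_scale[OF P1.linear_P[OF y], symmetric]
      linear_scale[OF P2.linear_P[OF y], symmetric] linear_sum[OF P1.linear_P[OF y], symmetric]
      linear_sum[OF P2.linear_P[OF y], symmetric] P1.P_inj[OF y] P2.P_inj[OF y] by auto
  then have "(\<Sum>i\<in>UNIV. \<Sum>j\<in>UNIV. X $ i $ j *\<^sub>R (P1.C y (axis i 1) (axis j 1) - P2.C y (axis i 1) (axis j 1))) = 0"
    by (simp add: scaleR_diff_right sum_subtractf)
  from arg_cong[OF this, of "\<lambda>v. v $ l"]
  have "(\<Sum>i\<in>UNIV. \<Sum>j\<in>UNIV. X $ i $ j * (c1 y l i j - c2 y l i j)) = 0"
    unfolding c1_def c2_def by simp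
  moreover have "2 * mixed_det G (\<lambda>i j. c1 y l i j - c2 y l i j) = mixed_det G G *
      (\<Sum>i\<in>UNIV. \<Sum>j\<in>UNIV. X $ i $ j * (c1 y l i j - c2 y l i j))"
    using mixed_det_matrix_inv[of A "\<lambda>i j. c1 y l i j - c2 y l i j"] nondeg
      P1.H_sym[OF y, of e2 e1] P2.H_sym[OF y, of e2 e1] P1.C_sym[OF y, of e2 e1] P2.C_sym[OF y, of e2 e1]
    unfolding A X_def[symmetric] by (simp add: c1_def c2_def G_def h1_def h2_def)
  ultimately show ?thesis by simp
qed


section \<open>Tangent vectors in charts\<close>

text \<open>The chain rule in the form shared by chart transitions (with \<open>F = id\<close>), the
  two projections and the components of the immersion; \<open>\<tau>\<close> is the expression of
  \<open>F\<close> in charts, valid near the point.\<close>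

lemma coord_vector_chain:
  assumes "open O'" "chart_map c p \<in> O'"
    and eq: "\<And>y. y \<in> O' \<Longrightarrow> F (chart_inv c y) = chart_inv d (\<tau> y)"
    and \<tau>: "(\<tau> has_derivative \<tau>') (at (chart_map c p))" "\<tau> (chart_map c p) = chart_map d q"
    and f: "(f \<circ> chart_inv d) differentiable (at (chart_map d q))"
  shows "((f \<circ> F) \<circ> chart_inv c) differentiable (at (chart_map c p))"
    and "coord_vector c p u (f \<circ> F) = coord_vector d q (\<tau>' u) f"
proof -
  let ?f' = "frechet_derivative (f \<circ> chart_inv d) (at (chart_map d q))"
  have "((f \<circ> chart_inv d) has_derivative ?f') (at (\<tau> (chart_map c p)))"
    using f frechet_derivative_works unfolding \<tau>(2) by blast
  from has_derivative_compose[OF \<tau>(1) this]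
  have D: "((f \<circ> F \<circ> chart_inv c) has_derivative (\<lambda>u. ?f' (\<tau>' u))) (at (chart_map c p))"
    by (rule has_derivative_transform_within_open[OF _ assms(1,2)]) (simp add: eq)
  then show d: "((f \<circ> F) \<circ> chart_inv c) differentiable (at (chart_map c p))"
    using differentiable_def by blast
  show "coord_vector c p u (f \<circ> F) = coord_vector d q (\<tau>' u) f"
    unfolding coord_vector_def using d f frechet_derivative_at[OF D, symmetric] by (simp add: o_def)
qed

context smooth_manifold
begin

lemma chart_inj: "c \<in> A \<Longrightarrow> inj_on (chart_map c) (chart_dom c)"
  using homeomorphic_imp_injective_map[OF chart_homeomorphic] openin_chart_dom
  by (metis openin_subset topspace_subtopology_subset)

lemma chart_inv_map [simp]: "c \<in> A \<Longrightarrow> p \<in> chart_dom c \<Longrightarrow> chart_inv c (chart_map c p) = p"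
  unfolding chart_inv_def by (rule inv_into_f_f[OF chart_inj])

lemma chart_map_inv [simp]: "y \<in> chart_map c ` chart_dom c \<Longrightarrow> chart_map c (chart_inv c y) = y"
  unfolding chart_inv_def by (rule f_inv_into_f)

lemma chart_inv_in: "y \<in> chart_map c ` chart_dom c \<Longrightarrow> chart_inv c y \<in> chart_dom c"
  unfolding chart_inv_def by (rule inv_into_into)

lemma open_chart_map_image:
  assumes c: "c \<in> A" and U: "openin X U"
  shows "open (chart_map c ` (chart_dom c \<inter> U))"
proof -
  have "openin (subtopology X (chart_dom c)) (chart_dom c \<inter> U)"
    using U by (simp add: openin_subtopology_Int2)
  then have "openin (top_of_set (chart_map c ` chart_dom c)) (chart_map c ` (chart_dom c \<inter> U))"
    using homeomorphic_imp_open_map[OF chart_homeomorphic[OF c]] unfolding open_map_def by blast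
  then show ?thesis using open_chart_image[OF c] openin_open_trans by blast
qed

lemma chart_dom_subset: "c \<in> A \<Longrightarrow> chart_dom c \<subseteq> topspace X"
  using openin_chart_dom openin_subset by blast

lemma chart_at: "p \<in> topspace X \<Longrightarrow> chart_at A p \<in> A \<and> p \<in> chart_dom (chart_at A p)"
  unfolding chart_at_def by (rule someI_ex) (use charts_cover in blast)

context
  fixes c d p
  assumes cd: "c \<in> A" "d \<in> A" "p \<in> chart_dom c" "p \<in> chart_dom d"
begin

lemma transition_has_derivative:
  "(coord_expr c d id has_derivative frechet_derivative (coord_expr c d id) (at (chart_map c p))) (at (chart_map c p))"
  using smooth_on_has_derivative[OF smooth_transition[OF cd(1,2)]] cd by blast

lemma transition_chain:
  assumes "(f \<circ> chart_inv d) differentiable (at (chart_map d p))"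
  shows "(f \<circ> chart_inv c) differentiable (at (chart_map c p))"
    and "coord_vector c p u f = coord_vector d p (frechet_derivative (coord_expr c d id) (at (chart_map c p)) u) f"
proof -
  let ?O = "chart_map c ` (chart_dom c \<inter> chart_dom d)"
  have O: "open ?O" "chart_map c p \<in> ?O"
    using open_chart_map_image[OF cd(1) openin_chart_dom[OF cd(2)]] cd by auto
  have eq: "id (chart_inv c y) = chart_inv d (coord_expr c d id y)" if "y \<in> ?O" for y
    using that cd by (auto simp: coord_expr_def)
  have "coord_expr c d id (chart_map c p) = chart_map d p" using cd by (simp add: coord_expr_def)
  note chain = coord_vector_chain[where F = id, OF O eq transition_has_derivative this assms]
  show "(f \<circ> chart_inv c) differentiable (at (chart_map c p))" using chain(1) by simp
  show "coord_vector c p u f = coord_vector d p (frechet_derivative (coord_expr c d id) (at (chart_map c p)) u) f"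
    using chain(2) by simp
qed

end

lemma differentiable_at_point_iff:
  assumes "c \<in> A" "p \<in> chart_dom c"
  shows "differentiable_at_point A p f \<longleftrightarrow> (f \<circ> chart_inv c) differentiable (at (chart_map c p))"
  unfolding differentiable_at_point_def using transition_chain(1) assms by blast

lemma coord_vector_change:
  assumes "c \<in> A" "d \<in> A" "p \<in> chart_dom c" "p \<in> chart_dom d"
  shows "coord_vector c p u = coord_vector d p (frechet_derivative (coord_expr c d id) (at (chart_map c p)) u)"
proof
  fix f
  show "coord_vector c p u f = coord_vector d p (frechet_derivative (coord_expr c d id) (at (chart_map c p)) u) f"
  proof (cases "(f \<circ> chart_inv d) differentiable (at (chart_map d p))")
    case True
    then show ?thesis by (rule transition_chain(2)[OF assms])
  next
    \<comment> \<open>Differentiability at \<open>p\<close> does not depend on the chart, so here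
      both sides take the default value 0.\<close>
    case False
    then have "\<not> (f \<circ> chart_inv c) differentiable (at (chart_map c p))"
      using transition_chain(1) assms by blast
    then show ?thesis using False unfolding coord_vector_def by simp
  qed
qed

lemma tangent_space_eq:
  assumes "c \<in> A" "p \<in> chart_dom c"
  shows "tangent_space A p = range (coord_vector c p)"
  unfolding tangent_space_def using coord_vector_change assms by blast

text \<open>Applying a tangent vector to the coordinate functions recovers its components.\<close>

lemma coord_vector_inj:
  assumes "c \<in> A" "p \<in> chart_dom c"
  shows "coord_vector c p u = coord_vector c p v \<longleftrightarrow> u = v"
proof
  assume eq: "coord_vector c p u = coord_vector c p v"
  have "coord_vector c p w (\<lambda>q. chart_map c q \<bullet> b) = w \<bullet> b" for w b
  proof -
    have D: "(((\<lambda>q. chart_map c q \<bullet> b) \<circ> chart_inv c) has_derivative (\<lambda>w. w \<bullet> b)) (at (chart_map c p))"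
      using has_derivative_inner_left[OF has_derivative_ident] open_chart_image[OF assms(1)] imageI[OF assms(2)]
      by (rule has_derivative_transform_within_open) simp
    show ?thesis
      unfolding coord_vector_def using frechet_derivative_at[OF D, symmetric] D differentiable_def by (auto simp: o_def)
  qed
  then have "u \<bullet> b = v \<bullet> b" for b using eq by metis
  then show "u = v" using vector_eq_rdot by metis
qed simp

lemma coord_vector_0: "coord_vector c p 0 = (\<lambda>f. 0)"
  unfolding coord_vector_def by (auto simp: fun_eq_iff linear_0[OF linear_frechet_derivative])

lemma coord_vector_eq_0:
  "c \<in> A \<Longrightarrow> p \<in> chart_dom c \<Longrightarrow> coord_vector c p u = (\<lambda>f. 0) \<longleftrightarrow> u = 0"
  using coord_vector_inj[of c p u 0] by (simp add: coord_vector_0)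

lemma pushforward_coord_vector:
  assumes d: "d \<in> A" "F p \<in> chart_dom d" and "open O'" "chart_map c p \<in> O'"
    and "\<And>y. y \<in> O' \<Longrightarrow> F (chart_inv c y) = chart_inv d (\<tau> y)"
    and "(\<tau> has_derivative \<tau>') (at (chart_map c p))" "\<tau> (chart_map c p) = chart_map d (F p)"
  shows "pushforward A F p (coord_vector c p u) = coord_vector d (F p) (\<tau>' u)"
proof
  fix f
  show "pushforward A F p (coord_vector c p u) f = coord_vector d (F p) (\<tau>' u) f"
  proof (cases "differentiable_at_point A (F p) f")
    case True
    then show ?thesis
      using coord_vector_chain(2)[OF assms(3-7)] unfolding pushforward_def differentiable_at_point_iff[OF d] by simp
  next
    case False
    then show ?thesis unfolding pushforward_def differentiable_at_point_iff[OF d] coord_vector_def by simp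
  qed
qed

end

lemma det2_eq_det: "det2 a b = det (vector [a, b] :: real^2^2)"
  unfolding det2_def det_2 by simp

lemma det2_linear:
  assumes "linear L"
  shows "det2 (L u) (L v) = det (matrix L) * det2 u v"
proof -
  have "det2 (L u) (L v) = det2 (L e1) (L e2) * det2 u v"
    unfolding linear_vec2[OF assms, of u] linear_vec2[OF assms, of v] by (simp add: det2_def algebra_simps)
  also have "det2 (L e1) (L e2) = det (matrix L)" unfolding det_2 det2_def matrix_def by simp
  finally show ?thesis .
qed

section \<open>The Kaehler form of an oriented surface in a chart\<close>

context oriented_riemannian_surface
begin

lemma riemannian_patch_chart:
  assumes "c \<in> A"
  shows "riemannian_patch (chart_map c ` chart_dom c) (tensor_in_chart c g)"
proof
  fix y u assume y: "y \<in> chart_map c ` chart_dom c" and 0: "\<And>v. tensor_in_chart c g y u v = 0"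
  then show "u = 0" using metric_pos[OF assms y, of u] by fastforce
qed (use assms open_chart_image metric_smooth metric_bilinear metric_sym metric_pos
      smooth_on_differentiable[OF metric_smooth] in auto)

definition area_density where
  "area_density c y = sqrt (tensor_in_chart c g y e1 e1 * tensor_in_chart c g y e2 e2 - (tensor_in_chart c g y e1 e2)\<^sup>2)"

text \<open>In a chart the Kaehler form is the Riemannian area form. The work lies in showing that
  the definite description in \<open>rotation\<close> is met by exactly one vector, given explicitly
  by \<open>r\<close>.\<close>

lemma kahler_form_coord_vector:
  assumes c: "c \<in> A" and p: "p \<in> chart_dom c"
  shows "kahler_form A g p (coord_vector c p u) (coord_vector c p v)
    = area_density c (chart_map c p) * det2 u v"
proof -
  define y where "y = chart_map c p"
  have y: "y \<in> chart_map c ` chart_dom c" unfolding y_def using p by simp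
  interpret R: riemannian_patch "chart_map c ` chart_dom c" "tensor_in_chart c g"
    by (rule riemannian_patch_chart[OF c])
  define h where "h = tensor_in_chart c g y"
  have g: "g p (coord_vector c p a) (coord_vector c p b) = h a b" for a b
    unfolding h_def tensor_in_chart_def y_def using c p by simp
  define s where "s = area_density c y"
  have s2: "s\<^sup>2 = h e1 e1 * h e2 e2 - (h e1 e2)\<^sup>2" and s: "s > 0"
    unfolding s_def area_density_def h_def using R.gram_pos[OF y] by simp_all
  have b: "bilinear h" unfolding h_def by (rule R.bilinear[OF y])
  have sym: "h a b = h b a" for a b unfolding h_def by (rule R.sym[OF y])
  have pos: "h a a > 0" if "a \<noteq> 0" for a unfolding h_def by (rule R.pos[OF y that])
  have vec: "h a b = a$1 * b$1 * h e1 e1 + (a$1 * b$2 + a$2 * b$1) * h e1 e2 + a$2 * b$2 * h e2 e2" for a b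
    using bilinear_vec2[OF b, of a b] sym[of e2 e1] by (simp add: algebra_simps)
  \<comment> \<open>The solution of \<open>h (r u) v = s * det2 u v\<close>; orthogonality to
    \<open>u\<close> and the length of \<open>r u\<close> follow from this single identity.\<close>
  define r where "r u = (1 / s) *\<^sub>R (h u e1 *\<^sub>R e2 - h u e2 *\<^sub>R e1)" for u
  have r_h: "h (r u) v = s * det2 u v" for u v
  proof -
    have "s * h (r u) v = h u e1 * h e2 v - h u e2 * h e1 v"
      unfolding r_def using s by (simp add: bilinear_lsub[OF b] bilinear_lmul[OF b])
    also have "\<dots> = (h e1 e1 * h e2 e2 - (h e1 e2)\<^sup>2) * det2 u v"
      unfolding vec[of u] vec[of _ v] det2_def by (simp add: power2_eq_square algebra_simps)
    also have "\<dots> = s * (s * det2 u v)" unfolding s2[symmetric] by (simp add: power2_eq_square)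
    finally show ?thesis using s by simp
  qed
  have det_r: "s * det2 u (r u) = h u u" for u
    using s unfolding r_def vec[of u u] vec[of u e1] vec[of u e2] by (simp add: det2_def algebra_simps)
  have gram: "h a a * h b b - (h a b)\<^sup>2 = (s * det2 a b)\<^sup>2" for a b
    unfolding power_mult_distrib s2 vec[of a] vec[of b] det2_def by (simp add: power2_eq_square algebra_simps)
  \<comment> \<open>By \<open>gram\<close>, orthogonality and equal length fix
    \<open>s * det2 u w\<close> up to sign, and the orientation fixes the sign. Then the square of
    \<open>w - r u\<close> vanishes. For \<open>u = 0\<close> the length alone forces
    \<open>w = 0\<close>.\<close>
  have unique: "w = r u" if w: "h w w = h u u" "h u w = 0" "u \<noteq> 0 \<Longrightarrow> det2 u w > 0" for u w
  proof (cases "u = 0")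
    case True
    then have "h w w = 0" using w(1) bilinear_lzero[OF b] by simp
    then have "w = 0" using pos[of w] by fastforce
    then show ?thesis using True unfolding r_def by (simp add: bilinear_lzero[OF b])
  next
    case False
    have "(s * det2 u w)\<^sup>2 = (h u u)\<^sup>2" using gram[of u w] w by (simp add: power2_eq_square)
    then have "s * det2 u w = h u u"
      using s w(3)[OF False] pos[OF False] by (simp add: power2_eq_iff_nonneg)
    then have "h (w - r u) (w - r u) = 0"
      using r_h[of u w] r_h[of u "r u"] det_r[of u] w(1) sym[of w "r u"]
      by (simp add: bilinear_lsub[OF b] bilinear_rsub[OF b])
    then show ?thesis using pos[of "w - r u"] by fastforce
  qed
  \<comment> \<open>\<open>positively_oriented\<close> only provides some chart \<open>d\<close>;
    the positive transition determinant carries the sign back to \<open>c\<close>.\<close>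
  have positive: "det2 a b' > 0" if po: "positively_oriented A p (coord_vector c p a) (coord_vector c p b')" for a b'
  proof -
    obtain d k l where d: "d \<in> A" "p \<in> chart_dom d" and kl: "coord_vector c p a = coord_vector d p k"
      "coord_vector c p b' = coord_vector d p l" "det2 k l > 0"
      using po unfolding positively_oriented_def det2_eq_det by blast
    let ?L = "frechet_derivative (coord_expr c d id) (at (chart_map c p))"
    have "k = ?L a" "l = ?L b'"
      using kl coord_vector_inj[OF d] coord_vector_change[OF c d(1) p d(2)] by metis+
    then have "det (matrix ?L) * det2 a b' > 0"
      using kl(3) det2_linear[OF has_derivative_linear[OF transition_has_derivative[OF c d(1) p d(2)]]] by simp
    then show ?thesis using oriented[OF c d(1) p d(2)] zero_less_mult_pos by blast
  qed
  have "rotation A g p (coord_vector c p u) = coord_vector c p (r u)"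
    unfolding rotation_def
  proof (rule the_equality, intro conjI impI)
    show "coord_vector c p (r u) \<in> tangent_space A p" unfolding tangent_space_eq[OF c p] by simp
    show "g p (coord_vector c p (r u)) (coord_vector c p (r u)) = g p (coord_vector c p u) (coord_vector c p u)"
      unfolding g r_h det_r ..
    show "g p (coord_vector c p u) (coord_vector c p (r u)) = 0"
      unfolding g sym[of u] r_h by (simp add: det2_def)
    assume "coord_vector c p u \<noteq> (\<lambda>f. 0)"
    then have "u \<noteq> 0" by (simp add: coord_vector_eq_0[OF c p])
    then have "s * det2 u (r u) > 0" using det_r pos by simp
    then have "det2 u (r u) > 0" using s zero_less_mult_pos by blast
    then show "positively_oriented A p (coord_vector c p u) (coord_vector c p (r u))"
      unfolding positively_oriented_def det2_eq_det using c p by blast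
  next
    fix w assume w: "w \<in> tangent_space A p \<and> g p w w = g p (coord_vector c p u) (coord_vector c p u) \<and>
      g p (coord_vector c p u) w = 0 \<and>
      (coord_vector c p u \<noteq> (\<lambda>f. 0) \<longrightarrow> positively_oriented A p (coord_vector c p u) w)"
    then obtain x where x: "w = coord_vector c p x" using tangent_space_eq[OF c p] by blast
    have "x = r u"
      using w positive[of u x] coord_vector_eq_0[OF c p, of u] by (intro unique) (auto simp: x g)
    then show "w = coord_vector c p (r u)" using x by simp
  qed
  then have "kahler_form A g p (coord_vector c p u) (coord_vector c p v) = h (r u) v"
    unfolding kahler_form_def by (simp only: g)
  then show ?thesis unfolding r_h s_def y_def .
qed

end


section \<open>Minimal Lagrangian surfaces\<close>

definition prod_chart :: "('a, 'e) chart \<Rightarrow> ('b, 'f) chart \<Rightarrow> ('a \<times> 'b, 'e \<times> 'f) chart" where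
  "prod_chart c d = (chart_dom c \<times> chart_dom d, map_prod (chart_map c) (chart_map d))"

lemma prod_atlas_eq: "prod_atlas A B = {prod_chart c d | c d. c \<in> A \<and> d \<in> B}"
  unfolding prod_atlas_def prod_chart_def[symmetric] image_def split_paired_Bex_Sigma split_conv by blast

lemma prod_chart_simps [simp]:
  "chart_dom (prod_chart c d) = chart_dom c \<times> chart_dom d"
  "chart_map (prod_chart c d) = map_prod (chart_map c) (chart_map d)"
  by (simp_all add: prod_chart_def)

lemma smooth_on_fst_snd:
  assumes "smooth_on U f" "open U"
  shows "smooth_on U (\<lambda>y. fst (f y))" "smooth_on U (\<lambda>y. snd (f y))"
  using smooth_on_bounded_linear[OF assms bounded_linear_fst] smooth_on_bounded_linear[OF assms bounded_linear_snd] .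

lemma continuous_on_frechet_derivative: "smooth_on U f \<Longrightarrow> continuous_on U (\<lambda>y. frechet_derivative f (at y) u)"
  using smooth_on_frechet_derivative[of U f u] unfolding smooth_on_def by (metis Ck_on.simps(1))

text \<open>Surjectivity of the derivative at \<open>y\<close> puts \<open>f y\<close> into the
  interior of the image by an open mapping theorem, and nonempty open sets are not null.\<close>

lemma image_not_negligible:
  fixes f :: "real^2 \<Rightarrow> real^2"
  assumes "open W" "smooth_on W f" "y \<in> W"
    and det: "det2 (frechet_derivative f (at y) e1) (frechet_derivative f (at y) e2) \<noteq> 0"
  shows "\<not> negligible (f ` W)"
proof
  assume "negligible (f ` W)"
  let ?L = "frechet_derivative f (at y)"
  have D: "(f has_derivative ?L) (at y)" by (rule smooth_on_has_derivative[OF assms(2,3)])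
  have lin: "linear ?L" using D has_derivative_linear by blast
  have "det (matrix ?L) \<noteq> 0" using det unfolding det2_linear[OF lin] by (auto simp: det2_def)
  then have "inj ?L" using det_nz_iff_inj[OF lin] by blast
  then obtain g' where g': "linear g'" "?L \<circ> g' = id"
    using linear_injective_isomorphism[OF lin] by (metis comp_id ext o_apply id_apply)
  have "continuous_on W f"
    using assms(2) unfolding smooth_on_def by (metis Ck_on.simps(1))
  moreover have "bounded_linear g'" using g'(1) linear_conv_bounded_linear by blast
  ultimately have "f y \<in> interior (f ` W)"
    using sussmann_open_mapping[OF assms(1) _ assms(3) D _ g'(2), of W] assms(1,3) by (simp add: interior_open)
  moreover have "negligible (interior (f ` W))"
    using \<open>negligible (f ` W)\<close> interior_subset negligible_subset by blast
  ultimately show False using open_not_negligible[of "interior (f ` W)"] by auto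
qed

lemma dim_range_less_2:
  fixes L :: "real^2 \<Rightarrow> real^2"
  assumes lin: "linear L" and det: "det2 (L e1) (L e2) = 0"
  shows "dim (range L) < 2"
proof (rule ccontr)
  assume "\<not> dim (range L) < 2"
  moreover have "dim (range L) \<le> 2" using dim_subset_UNIV[of "range L"] by simp
  ultimately have "dim (range L) = DIM(real^2)" by simp
  then have "span (range L) = UNIV" using dim_eq_full by blast
  then have "surj L" using linear_subspace_image[OF lin subspace_UNIV] span_eq_iff by metis
  then have "inj L" using linear_surjective_imp_injective[OF lin] by blast
  then have "det (matrix L) \<noteq> 0" using det_nz_iff_inj[OF lin] by blast
  then show False using det unfolding det2_linear[OF lin] by (simp add: det2_def)
qed

locale minimal_lagrangian_surface =
  M1: oriented_riemannian_surface X1 A1 g1 + M2: oriented_riemannian_surface X2 A2 g2 + M: smooth_manifold S C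
  for X1 :: "'a topology" and A1 g1 and X2 :: "'b topology" and A2 g2
    and S :: "'c topology" and C :: "('c, real^2) chart set" +
  fixes \<epsilon> :: real and \<Phi> :: "'c \<Rightarrow> 'a \<times> 'b"
  assumes eps: "\<epsilon> \<in> {1, - 1}"
    and smooth_map: "smooth_map S C (prod_topology X1 X2) (prod_atlas A1 A2) \<Phi>"
    and lagrangian: "lagrangian S C (prod_atlas A1 A2) (kahler_product_form \<epsilon> A1 g1 A2 g2) \<Phi>"
    and minimal: "minimal S C (prod_atlas A1 A2) (kahler_product_metric \<epsilon> A1 g1 A2 g2) \<Phi>"
begin

abbreviation "\<phi> \<equiv> fst \<circ> \<Phi>"
abbreviation "\<psi> \<equiv> snd \<circ> \<Phi>"

lemma \<Phi>_in: "p \<in> topspace S \<Longrightarrow> \<Phi> p \<in> topspace X1 \<times> topspace X2"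
  using smooth_map unfolding smooth_map_def continuous_map_def by auto

section \<open>The product of the two surfaces in product charts\<close>

context
  fixes d1 d2
  assumes d: "d1 \<in> A1" "d2 \<in> A2"
begin

abbreviation "V1 \<equiv> chart_map d1 ` chart_dom d1"
abbreviation "V2 \<equiv> chart_map d2 ` chart_dom d2"

lemma open_V: "open (V1 \<times> V2)"
  using M1.open_chart_image M2.open_chart_image d open_Times by blast

lemma prod_chart_inv:
  assumes "y \<in> V1 \<times> V2"
  shows "chart_inv (prod_chart d1 d2) y = (chart_inv d1 (fst y), chart_inv d2 (snd y))"
  unfolding chart_inv_def[of "prod_chart d1 d2"]
proof (rule inv_into_f_eq)
  show "inj_on (chart_map (prod_chart d1 d2)) (chart_dom (prod_chart d1 d2))"
    using M1.chart_inj[OF d(1)] M2.chart_inj[OF d(2)] by (simp add: map_prod_inj_on)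
qed (use assms in \<open>auto simp: M1.chart_inv_in M2.chart_inv_in d\<close>)

context
  fixes z assumes z: "z \<in> chart_dom d1 \<times> chart_dom d2"
begin

lemma prod_chart_fst_snd:
  "chart_map (prod_chart d1 d2) z \<in> V1 \<times> V2"
  "fst (chart_map (prod_chart d1 d2) z) = chart_map d1 (fst z)"
  "snd (chart_map (prod_chart d1 d2) z) = chart_map d2 (snd z)"
  using z by auto

lemma fst_chart_inv: "y \<in> V1 \<times> V2 \<Longrightarrow> fst (chart_inv (prod_chart d1 d2) y) = chart_inv d1 (fst y)"
  and snd_chart_inv: "y \<in> V1 \<times> V2 \<Longrightarrow> snd (chart_inv (prod_chart d1 d2) y) = chart_inv d2 (snd y)"
  by (simp_all add: prod_chart_inv)

lemma pushforward_fst: "pushforward A1 fst z (coord_vector (prod_chart d1 d2) z u) = coord_vector d1 (fst z) (fst u)"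
  by (rule M1.pushforward_coord_vector[OF d(1) _ open_V prod_chart_fst_snd(1) fst_chart_inv
        bounded_linear_imp_has_derivative[OF bounded_linear_fst] prod_chart_fst_snd(2)]) (use z in auto)

lemma pushforward_snd: "pushforward A2 snd z (coord_vector (prod_chart d1 d2) z u) = coord_vector d2 (snd z) (snd u)"
  by (rule M2.pushforward_coord_vector[OF d(2) _ open_V prod_chart_fst_snd(1) snd_chart_inv
        bounded_linear_imp_has_derivative[OF bounded_linear_snd] prod_chart_fst_snd(3)]) (use z in auto)

lemma differentiable_fst:
  assumes "differentiable_at_point A1 (fst z) f"
  shows "(f \<circ> fst \<circ> chart_inv (prod_chart d1 d2)) differentiable (at (chart_map (prod_chart d1 d2) z))"
proof (rule coord_vector_chain(1)[OF open_V prod_chart_fst_snd(1) fst_chart_inv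
        bounded_linear_imp_has_derivative[OF bounded_linear_fst] prod_chart_fst_snd(2)])
  show "(f \<circ> chart_inv d1) differentiable (at (chart_map d1 (fst z)))"
    using assms d z unfolding differentiable_at_point_def by auto
qed

lemma differentiable_snd:
  assumes "differentiable_at_point A2 (snd z) f"
  shows "(f \<circ> snd \<circ> chart_inv (prod_chart d1 d2)) differentiable (at (chart_map (prod_chart d1 d2) z))"
proof (rule coord_vector_chain(1)[OF open_V prod_chart_fst_snd(1) snd_chart_inv
        bounded_linear_imp_has_derivative[OF bounded_linear_snd] prod_chart_fst_snd(3)])
  show "(f \<circ> chart_inv d2) differentiable (at (chart_map d2 (snd z)))"
    using assms d z unfolding differentiable_at_point_def by auto
qed

end

lemma product_metric_in_chart:
  assumes "y \<in> V1 \<times> V2"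
  shows "tensor_in_chart (prod_chart d1 d2) (kahler_product_metric \<epsilon> A1 g1 A2 g2) y u v
    = tensor_in_chart d1 g1 (fst y) (fst u) (fst v) + \<epsilon> * tensor_in_chart d2 g2 (snd y) (snd u) (snd v)"
proof -
  have z: "chart_inv (prod_chart d1 d2) y \<in> chart_dom d1 \<times> chart_dom d2"
    unfolding prod_chart_inv[OF assms] using assms d by (auto simp: M1.chart_inv_in M2.chart_inv_in)
  show ?thesis
    unfolding tensor_in_chart_def kahler_product_metric_def prod_tensor_def pullback_def
      pushforward_fst[OF z] pushforward_snd[OF z]
    by (simp add: prod_chart_inv[OF assms])
qed

lemma product_patch: "product_patch V1 V2 (tensor_in_chart d1 g1) (tensor_in_chart d2 g2) \<epsilon>
    (tensor_in_chart (prod_chart d1 d2) (kahler_product_metric \<epsilon> A1 g1 A2 g2))"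
  unfolding product_patch_def product_patch_axioms_def
  using M1.riemannian_patch_chart[OF d(1)] M2.riemannian_patch_chart[OF d(2)] product_metric_in_chart eps by auto

end

text \<open>Functoriality, despite the default value of \<open>pushforward\<close>: a function
  differentiable at the projected point stays differentiable in every product chart after
  composition with the projection, so the inner test never discards what the outer one
  admits.\<close>

lemma pushforward_pushforward:
  "pushforward A1 fst (\<Phi> p) (pushforward (prod_atlas A1 A2) \<Phi> p v) = pushforward A1 \<phi> p v"
  "pushforward A2 snd (\<Phi> p) (pushforward (prod_atlas A1 A2) \<Phi> p v) = pushforward A2 \<psi> p v"
proof -
  have "differentiable_at_point (prod_atlas A1 A2) (\<Phi> p) (f \<circ> fst)"
    if "differentiable_at_point A1 (fst (\<Phi> p)) f" for f
    unfolding differentiable_at_point_def[of "prod_atlas A1 A2"]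
  proof (intro ballI impI)
    fix e assume "e \<in> prod_atlas A1 A2" and e: "\<Phi> p \<in> chart_dom e"
    then obtain c d where "e = prod_chart c d" "c \<in> A1" "d \<in> A2" unfolding prod_atlas_eq by blast
    then show "(f \<circ> fst \<circ> chart_inv e) differentiable (at (chart_map e (\<Phi> p)))"
      using differentiable_fst[OF _ _ _ that, of c d] e by simp
  qed
  then show "pushforward A1 fst (\<Phi> p) (pushforward (prod_atlas A1 A2) \<Phi> p v) = pushforward A1 \<phi> p v"
    unfolding pushforward_def by (auto simp: fun_eq_iff o_assoc)
  have "differentiable_at_point (prod_atlas A1 A2) (\<Phi> p) (f \<circ> snd)"
    if "differentiable_at_point A2 (snd (\<Phi> p)) f" for f
    unfolding differentiable_at_point_def[of "prod_atlas A1 A2"]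
  proof (intro ballI impI)
    fix e assume "e \<in> prod_atlas A1 A2" and e: "\<Phi> p \<in> chart_dom e"
    then obtain c d where "e = prod_chart c d" "c \<in> A1" "d \<in> A2" unfolding prod_atlas_eq by blast
    then show "(f \<circ> snd \<circ> chart_inv e) differentiable (at (chart_map e (\<Phi> p)))"
      using differentiable_snd[OF _ _ _ that, of c d] e by simp
  qed
  then show "pushforward A2 snd (\<Phi> p) (pushforward (prod_atlas A1 A2) \<Phi> p v) = pushforward A2 \<psi> p v"
    unfolding pushforward_def by (auto simp: fun_eq_iff o_assoc)
qed

section \<open>The immersion in a chart of the surface and charts of the two factors\<close>

context
  fixes c d1 d2
  assumes cd: "c \<in> C" "d1 \<in> A1" "d2 \<in> A2"
begin

definition U where "U = chart_map c ` (chart_dom c \<inter> \<Phi> -` (chart_dom d1 \<times> chart_dom d2))"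

abbreviation "f1 \<equiv> coord_expr c d1 \<phi>"
abbreviation "f2 \<equiv> coord_expr c d2 \<psi>"
abbreviation "P1 y \<equiv> frechet_derivative f1 (at y)"
abbreviation "P2 y \<equiv> frechet_derivative f2 (at y)"

lemma coord_expr_\<Phi>: "coord_expr c (prod_chart d1 d2) \<Phi> = (\<lambda>y. (f1 y, f2 y))"
  by (simp add: coord_expr_def fun_eq_iff map_prod_def split_def)

lemma open_U: "open U"
proof -
  have "openin S {q \<in> topspace S. \<Phi> q \<in> chart_dom d1 \<times> chart_dom d2}"
    using smooth_map M1.openin_chart_dom[OF cd(2)] M2.openin_chart_dom[OF cd(3)] unfolding smooth_map_def
    by (intro openin_continuous_map_preimage[of S "prod_topology X1 X2"]) (simp_all add: openin_prod_Times_iff)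
  note 1 = M.open_chart_map_image[OF cd(1) this]
  have 2: "chart_dom c \<inter> {q \<in> topspace S. \<Phi> q \<in> chart_dom d1 \<times> chart_dom d2}
      = chart_dom c \<inter> \<Phi> -` (chart_dom d1 \<times> chart_dom d2)"
    using M.chart_dom_subset[OF cd(1)] by auto
  show ?thesis using 1 unfolding U_def 2 .
qed

lemma smooth_f: "smooth_on U f1" "smooth_on U f2"
proof -
  have "prod_chart d1 d2 \<in> prod_atlas A1 A2" unfolding prod_atlas_eq using cd by blast
  then have "smooth_on (chart_map c ` (chart_dom c \<inter> \<Phi> -` chart_dom (prod_chart d1 d2))) (coord_expr c (prod_chart d1 d2) \<Phi>)"
    using smooth_map cd(1) unfolding smooth_map_def by blast
  then have "smooth_on U (\<lambda>y. (f1 y, f2 y))" unfolding U_def coord_expr_\<Phi> by simp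
  from smooth_on_fst_snd[OF this open_U] show "smooth_on U f1" "smooth_on U f2" by simp_all
qed

context
  fixes y assumes y: "y \<in> U"
begin

lemma U_point:
  "chart_inv c y \<in> chart_dom c" "chart_map c (chart_inv c y) = y"
  "fst (\<Phi> (chart_inv c y)) \<in> chart_dom d1" "snd (\<Phi> (chart_inv c y)) \<in> chart_dom d2"
  "chart_map d1 (fst (\<Phi> (chart_inv c y))) = f1 y" "chart_map d2 (snd (\<Phi> (chart_inv c y))) = f2 y"
  "chart_inv c y \<in> topspace S"
  using y M.chart_dom_subset[OF cd(1)] cd(1) unfolding U_def by (auto simp: coord_expr_def)

lemma f_in: "f1 y \<in> chart_map d1 ` chart_dom d1" "f2 y \<in> chart_map d2 ` chart_dom d2"
  using imageI[OF U_point(3), of "chart_map d1"] imageI[OF U_point(4), of "chart_map d2"] unfolding U_point(5,6) .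

lemma chart_inv_f: "\<phi> (chart_inv c y) = chart_inv d1 (f1 y)" "\<psi> (chart_inv c y) = chart_inv d2 (f2 y)"
  using M1.chart_inv_map[OF cd(2) U_point(3)] M2.chart_inv_map[OF cd(3) U_point(4)] unfolding U_point(5,6) by simp_all

end

context
  fixes y assumes y: "y \<in> U"
begin

lemma f_has_derivative: "(f1 has_derivative P1 y) (at y)" "(f2 has_derivative P2 y) (at y)"
  using smooth_on_has_derivative smooth_f y by blast+

lemma pushforward_\<phi>: "pushforward A1 \<phi> (chart_inv c y) (coord_vector c (chart_inv c y) u)
    = coord_vector d1 (fst (\<Phi> (chart_inv c y))) (P1 y u)"
proof -
  have "pushforward A1 \<phi> (chart_inv c y) (coord_vector c (chart_inv c y) u)
    = coord_vector d1 (\<phi> (chart_inv c y)) (P1 y u)"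
  proof (rule M1.pushforward_coord_vector[where F = \<phi> and O' = U and \<tau> = f1])
    show "(f1 has_derivative P1 y) (at (chart_map c (chart_inv c y)))"
      unfolding U_point(2)[OF y] by (rule f_has_derivative)
    show "\<phi> (chart_inv c z) = chart_inv d1 (f1 z)" if "z \<in> U" for z
      by (rule chart_inv_f[OF that])
  qed (use cd open_U U_point[OF y] y in simp_all)
  then show ?thesis by simp
qed

lemma pushforward_\<psi>: "pushforward A2 \<psi> (chart_inv c y) (coord_vector c (chart_inv c y) u)
    = coord_vector d2 (snd (\<Phi> (chart_inv c y))) (P2 y u)"
proof -
  have "pushforward A2 \<psi> (chart_inv c y) (coord_vector c (chart_inv c y) u)
    = coord_vector d2 (\<psi> (chart_inv c y)) (P2 y u)"
  proof (rule M2.pushforward_coord_vector[where F = \<psi> and O' = U and \<tau> = f2])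
    show "(f2 has_derivative P2 y) (at (chart_map c (chart_inv c y)))"
      unfolding U_point(2)[OF y] by (rule f_has_derivative)
    show "\<psi> (chart_inv c z) = chart_inv d2 (f2 z)" if "z \<in> U" for z
      by (rule chart_inv_f[OF that])
  qed (use cd open_U U_point[OF y] y in simp_all)
  then show ?thesis by simp
qed

text \<open>The Jacobians of the two components, weighted by area densities, agree up to sign. This
  is the source both of their simultaneous vanishing and of the equality of the pulled back
  determinants.\<close>

lemma lagrangian_in_charts:
  "M1.area_density d1 (f1 y) * det2 (P1 y u) (P1 y v) + \<epsilon> * (M2.area_density d2 (f2 y) * det2 (P2 y u) (P2 y v)) = 0"
proof -
  let ?q = "chart_inv c y"
  note q = U_point[OF y]
  have "pullback (prod_atlas A1 A2) \<Phi> (kahler_product_form \<epsilon> A1 g1 A2 g2) ?q (coord_vector c ?q u) (coord_vector c ?q v) = 0"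
    using lagrangian q(7) M.tangent_space_eq[OF cd(1) q(1)] unfolding lagrangian_def by blast
  then show ?thesis
    unfolding pullback_def kahler_product_form_def prod_tensor_def pushforward_pushforward pushforward_\<phi> pushforward_\<psi>
      M1.kahler_form_coord_vector[OF cd(2) q(3)] M2.kahler_form_coord_vector[OF cd(3) q(4)] q(5,6) .
qed

lemma nondegenerate_in_charts:
  assumes "\<And>v. tensor_in_chart d1 g1 (f1 y) (P1 y u) (P1 y v) + \<epsilon> * tensor_in_chart d2 g2 (f2 y) (P2 y u) (P2 y v) = 0"
  shows "u = 0"
proof -
  let ?q = "chart_inv c y"
  note q = U_point[OF y]
  have g: "g1 (fst (\<Phi> ?q)) (coord_vector d1 (fst (\<Phi> ?q)) a) (coord_vector d1 (fst (\<Phi> ?q)) b) = tensor_in_chart d1 g1 (f1 y) a b"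
    "g2 (snd (\<Phi> ?q)) (coord_vector d2 (snd (\<Phi> ?q)) a) (coord_vector d2 (snd (\<Phi> ?q)) b) = tensor_in_chart d2 g2 (f2 y) a b" for a b
    unfolding tensor_in_chart_def chart_inv_f[OF y, symmetric] by simp_all
  have "pullback (prod_atlas A1 A2) \<Phi> (kahler_product_metric \<epsilon> A1 g1 A2 g2) ?q (coord_vector c ?q u) (coord_vector c ?q v) = 0" for v
    unfolding pullback_def kahler_product_metric_def prod_tensor_def pushforward_pushforward pushforward_\<phi> pushforward_\<psi> g
    by (rule assms)
  then have "\<forall>w\<in>tangent_space C ?q. pullback (prod_atlas A1 A2) \<Phi> (kahler_product_metric \<epsilon> A1 g1 A2 g2) ?q (coord_vector c ?q u) w = 0"
    unfolding M.tangent_space_eq[OF cd(1) q(1)] by blast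
  moreover have "coord_vector c ?q u \<in> tangent_space C ?q"
    unfolding M.tangent_space_eq[OF cd(1) q(1)] by blast
  ultimately have "coord_vector c ?q u = (\<lambda>f. 0)"
    using minimal q(7) unfolding minimal_def nondegenerate_def by blast
  then show ?thesis using M.coord_vector_eq_0[OF cd(1) q(1)] by blast
qed

lemma mean_curvature_in_charts:
  "mean_curvature_vector (tensor_in_chart (prod_chart d1 d2) (kahler_product_metric \<epsilon> A1 g1 A2 g2)) (\<lambda>y. (f1 y, f2 y)) y = 0"
proof -
  note q = U_point[OF y]
  have "prod_chart d1 d2 \<in> prod_atlas A1 A2" unfolding prod_atlas_eq using cd by blast
  moreover have "\<Phi> (chart_inv c y) \<in> chart_dom (prod_chart d1 d2)" using q by (simp add: mem_Times_iff)
  ultimately have "mean_curvature_vector (tensor_in_chart (prod_chart d1 d2) (kahler_product_metric \<epsilon> A1 g1 A2 g2))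
      (coord_expr c (prod_chart d1 d2) \<Phi>) (chart_map c (chart_inv c y)) = 0"
    using minimal q(1,7) cd(1) unfolding minimal_def by blast
  then show ?thesis unfolding coord_expr_\<Phi> q(2) .
qed

lemma det_eq_0_iff: "det2 (P1 y e1) (P1 y e2) = 0 \<longleftrightarrow> det2 (P2 y e1) (P2 y e2) = 0"
proof -
  have "M1.area_density d1 (f1 y) > 0" "M2.area_density d2 (f2 y) > 0"
    unfolding M1.area_density_def M2.area_density_def
    using riemannian_patch.gram_pos[OF M1.riemannian_patch_chart[OF cd(2)] f_in(1)[OF y]]
      riemannian_patch.gram_pos[OF M2.riemannian_patch_chart[OF cd(3)] f_in(2)[OF y]] by simp_all
  then show ?thesis using lagrangian_in_charts[of e1 e2] eps by auto
qed

end

section \<open>The open set on which both components are regular\<close>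

definition W where "W = {y \<in> U. det2 (P1 y e1) (P1 y e2) \<noteq> 0}"

lemma open_W: "open W"
proof -
  have "continuous_on U (\<lambda>y. det2 (P1 y e1) (P1 y e2))"
    unfolding det2_def
    by (intro continuous_intros continuous_on_frechet_derivative smooth_f)
  then have "open (U \<inter> (\<lambda>y. det2 (P1 y e1) (P1 y e2)) -` (- {0}))"
    using continuous_open_preimage[OF _ open_U] open_Compl[OF closed_singleton] by blast
  moreover have "U \<inter> (\<lambda>y. det2 (P1 y e1) (P1 y e2)) -` (- {0}) = W" unfolding W_def by auto
  ultimately show ?thesis by simp
qed

lemma pullback_patches:
  "pullback_patch (chart_map d1 ` chart_dom d1) (tensor_in_chart d1 g1) W f1"
  "pullback_patch (chart_map d2 ` chart_dom d2) (tensor_in_chart d2 g2) W f2"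
  unfolding pullback_patch_def pullback_patch_axioms_def
  using M1.riemannian_patch_chart[OF cd(2)] M2.riemannian_patch_chart[OF cd(3)] open_W
    smooth_on_subset[OF smooth_f(1), of W] smooth_on_subset[OF smooth_f(2), of W] f_in det_eq_0_iff
  by (auto simp: W_def)

lemma coord_gauss_curvature_relation:
  assumes y: "y \<in> W"
  shows "coord_gauss_curvature (tensor_in_chart d1 g1) (f1 y) = \<epsilon> * coord_gauss_curvature (tensor_in_chart d2 g2) (f2 y)"
proof -
  interpret Q1: pullback_patch "chart_map d1 ` chart_dom d1" "tensor_in_chart d1 g1" W f1 by (rule pullback_patches)
  interpret Q2: pullback_patch "chart_map d2 ` chart_dom d2" "tensor_in_chart d2 g2" W f2 by (rule pullback_patches)
  define G where "G = (\<lambda>z i j. Q1.h z i j + \<epsilon> * Q2.h z i j)"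
  have nondeg: "mixed_det (G z) (G z) \<noteq> 0" if z: "z \<in> W" for z
  proof
    assume 0: "mixed_det (G z) (G z) = 0"
    have zU: "z \<in> U" using z unfolding W_def by simp
    define B where "B u v = Q1.H z u v + \<epsilon> * Q2.H z u v" for u v
    have bB: "bilinear B"
      using Q1.bilinear_H[OF z] Q2.bilinear_H[OF z] unfolding bilinear_def linear_iff B_def by (simp add: algebra_simps)
    have B_sym: "B u v = B v u" for u v unfolding B_def using Q1.H_sym[OF z] Q2.H_sym[OF z] by simp
    have nd: "u = 0" if "B u e1 = 0" "B u e2 = 0" for u
    proof (rule nondegenerate_in_charts[OF zU])
      show "tensor_in_chart d1 g1 (f1 z) (P1 z u) (P1 z v) + \<epsilon> * tensor_in_chart d2 g2 (f2 z) (P2 z u) (P2 z v) = 0" for v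
        using linear_vec2[of "B u" v] bB that
        unfolding B_def[of u v] Q1.H_def Q2.H_def Q1.P_def Q2.P_def by (simp add: bilinear_def)
    qed
    have det: "B e1 e1 * B e2 e2 = B e1 e2 * B e1 e2"
      using 0 B_sym[of e2 e1] unfolding mixed_det_def G_def B_def by (simp add: algebra_simps)
    \<comment> \<open>If the Gram determinant vanishes, the columns of its adjugate are null vectors
      of \<open>B\<close>, hence zero. Then \<open>e1\<close> itself is a null vector.\<close>
    have "B e2 e2 *\<^sub>R e1 - B e1 e2 *\<^sub>R e2 = 0" "B e1 e2 *\<^sub>R e1 - B e1 e1 *\<^sub>R e2 = 0"
      by (rule nd; use det B_sym[of e2 e1] in \<open>simp add: bilinear_lsub[OF bB] bilinear_lmul[OF bB] algebra_simps\<close>)+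
    then have "B e1 e2 = 0" "B e1 e1 = 0" by (simp_all add: vec_eq_iff forall_2)
    then show False using nd[of e1] by (simp add: axis_eq_0_iff)
  qed
  have det: "mixed_det (Q1.h z) (Q1.h z) = mixed_det (Q2.h z) (Q2.h z)" if z: "z \<in> W" for z
  proof -
    have zU: "z \<in> U" using z unfolding W_def by simp
    have pull: "mixed_det (\<lambda>i j. h (L (axis i 1)) (L (axis j 1))) (\<lambda>i j. h (L (axis i 1)) (L (axis j 1)))
       = 2 * (h e1 e1 * h e2 e2 - (h e1 e2)\<^sup>2) * (det2 (L e1) (L e2))\<^sup>2"
      if b: "bilinear h" and s: "\<And>u v. h u v = h v u" for h L :: "real^2 \<Rightarrow> _"
      unfolding mixed_det_def bilinear_vec2[OF b, of "L _" "L _"] det2_def s[of e2 e1]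
      by (simp add: power2_eq_square algebra_simps)
    have "M1.area_density d1 (f1 z) * det2 (P1 z e1) (P1 z e2) = - \<epsilon> * (M2.area_density d2 (f2 z) * det2 (P2 z e1) (P2 z e2))"
      using lagrangian_in_charts[OF zU, of e1 e2] by simp
    \<comment> \<open>Squaring removes the sign \<open>- \<epsilon>\<close>. By \<open>pull\<close>,
      each side is then half the \<open>mixed_det\<close> of a pulled back metric.\<close>
    then have "(M1.area_density d1 (f1 z))\<^sup>2 * (det2 (P1 z e1) (P1 z e2))\<^sup>2 = (M2.area_density d2 (f2 z))\<^sup>2 * (det2 (P2 z e1) (P2 z e2))\<^sup>2"
      using eps by (auto simp flip: power_mult_distrib)
    then have "(tensor_in_chart d1 g1 (f1 z) e1 e1 * tensor_in_chart d1 g1 (f1 z) e2 e2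
          - (tensor_in_chart d1 g1 (f1 z) e1 e2)\<^sup>2) * (det2 (P1 z e1) (P1 z e2))\<^sup>2
      = (tensor_in_chart d2 g2 (f2 z) e1 e1 * tensor_in_chart d2 g2 (f2 z) e2 e2
          - (tensor_in_chart d2 g2 (f2 z) e1 e2)\<^sup>2) * (det2 (P2 z e1) (P2 z e2))\<^sup>2"
      unfolding M1.area_density_def M2.area_density_def
      using Q1.gram_pos[OF Q1.maps[OF z]] Q2.gram_pos[OF Q2.maps[OF z]] by simp
    then show ?thesis
      unfolding Q1.H_def Q2.H_def Q1.P_def Q2.P_def
        pull[OF Q1.bilinear[OF Q1.maps[OF z]] Q1.sym[OF Q1.maps[OF z]]]
        pull[OF Q2.bilinear[OF Q2.maps[OF z]] Q2.sym[OF Q2.maps[OF z]]] by (simp only: mult.assoc)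
  qed
  have min: "mixed_det (G z) (\<lambda>i j. Q1.c z l i j - Q2.c z l i j) = 0" if z: "z \<in> W" for z l
    using mean_curvature_zero_imp_trace_zero[OF pullback_patches product_patch[OF cd(2,3)] z
        nondeg[OF z, unfolded G_def] mean_curvature_in_charts] z
    unfolding G_def W_def by simp
  show ?thesis
    by (rule minimal_lagrangian_curvature_relation[OF pullback_patches eps y det nondeg[OF y, unfolded G_def] min[unfolded G_def]])
qed

end

text \<open>The charts selected in \<open>gauss_curvature\<close> vary with the point, so the relation is applied anew in
  those charts at every point.\<close>

lemma gauss_curvature_relation:
  assumes cd: "c \<in> C" "d1 \<in> A1" "d2 \<in> A2" and y: "y \<in> W c d1 d2"
  shows "gauss_curvature A1 g1 (\<phi> (chart_inv c y)) = \<epsilon> * gauss_curvature A2 g2 (\<psi> (chart_inv c y))"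
proof -
  let ?q = "chart_inv c y"
  have yU: "y \<in> U c d1 d2" and det: "det2 (frechet_derivative (coord_expr c d1 \<phi>) (at y) e1)
      (frechet_derivative (coord_expr c d1 \<phi>) (at y) e2) \<noteq> 0"
    using y unfolding W_def[OF cd] by auto
  note q = U_point[OF cd yU]
  have q12: "fst (\<Phi> ?q) \<in> topspace X1" "snd (\<Phi> ?q) \<in> topspace X2"
    using \<Phi>_in[OF q(7)] by (auto simp: mem_Times_iff)
  define d1' d2' where d': "d1' = chart_at A1 (fst (\<Phi> ?q))" "d2' = chart_at A2 (snd (\<Phi> ?q))"
  have d1': "d1' \<in> A1" "fst (\<Phi> ?q) \<in> chart_dom d1'" and d2': "d2' \<in> A2" "snd (\<Phi> ?q) \<in> chart_dom d2'"
    using M1.chart_at[OF q12(1)] M2.chart_at[OF q12(2)] unfolding d' by auto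
  note cd' = cd(1) d1'(1) d2'(1)
  have yU': "y \<in> U c d1' d2'"
    unfolding U_def[OF cd'] using q(1,2) d1' d2' by (intro image_eqI[of _ _ ?q]) (auto simp: mem_Times_iff)
  define L where "L = frechet_derivative (coord_expr d1 d1' id) (at (chart_map d1 (fst (\<Phi> ?q))))"
  have L: "linear L" "det (matrix L) > 0"
    unfolding L_def using has_derivative_linear[OF M1.transition_has_derivative[OF cd(2) d1'(1) q(3) d1'(2)]]
      M1.oriented[OF cd(2) d1'(1) q(3) d1'(2)] by auto
  \<comment> \<open>Both expressions are components of the same pushforward, read in
    \<open>d1'\<close> and in \<open>d1\<close>. Since \<open>L\<close> is invertible, regularity at
    \<open>y\<close> survives the change of chart.\<close>
  have "frechet_derivative (coord_expr c d1' \<phi>) (at y) u = L (frechet_derivative (coord_expr c d1 \<phi>) (at y) u)" for u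
    using pushforward_\<phi>[OF cd yU, of u] pushforward_\<phi>[OF cd' yU', of u]
      M1.coord_vector_change[OF cd(2) d1'(1) q(3) d1'(2)] M1.coord_vector_inj[OF d1'] unfolding L_def by metis
  then have "y \<in> W c d1' d2'"
    unfolding W_def[OF cd'] using yU' det L(2) det2_linear[OF L(1)] by simp
  from coord_gauss_curvature_relation[OF cd' this]
  show ?thesis
    unfolding gauss_curvature_def Let_def o_apply d'[symmetric] U_point(5,6)[OF cd' yU'] .
qed

text \<open>Both ranks are 0 or 2. The Jacobians vanish together, so a singular point would have
  both ranks 0; then the induced metric is zero there, against nondegeneracy. The charts are those
  in which \<open>rank_at\<close> is evaluated.\<close>

lemma curvature_relation_near_higher_rank:
  assumes p: "p \<in> topspace S" and not1: "\<not> projected_rank_one_at C A1 A2 \<Phi> p"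
  obtains c d1 d2 y where "c \<in> C" "d1 \<in> A1" "d2 \<in> A2" "y \<in> W c d1 d2"
proof -
  define c where "c = chart_at C p"
  define d1 where "d1 = chart_at A1 (fst (\<Phi> p))"
  define d2 where "d2 = chart_at A2 (snd (\<Phi> p))"
  have q12: "fst (\<Phi> p) \<in> topspace X1" "snd (\<Phi> p) \<in> topspace X2"
    using \<Phi>_in[OF p] by (auto simp: mem_Times_iff)
  have c: "c \<in> C" "p \<in> chart_dom c" and d1: "d1 \<in> A1" "fst (\<Phi> p) \<in> chart_dom d1"
    and d2: "d2 \<in> A2" "snd (\<Phi> p) \<in> chart_dom d2"
    using M.chart_at[OF p] M1.chart_at[OF q12(1)] M2.chart_at[OF q12(2)] unfolding c_def d1_def d2_def by auto
  note cd = c(1) d1(1) d2(1)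
  define y where "y = chart_map c p"
  have y: "y \<in> U c d1 d2" unfolding U_def[OF cd] y_def using c d1 d2 by (auto simp: mem_Times_iff)
  define L1 where "L1 = frechet_derivative (coord_expr c d1 \<phi>) (at y)"
  define L2 where "L2 = frechet_derivative (coord_expr c d2 \<psi>) (at y)"
  have lin: "linear L1" "linear L2"
    unfolding L1_def L2_def using f_has_derivative[OF cd y] has_derivative_linear by blast+
  have rank: "dim (range L1) \<noteq> 1" "dim (range L2) \<noteq> 1"
    using not1 unfolding projected_rank_one_at_def rank_at_def Let_def L1_def L2_def y_def c_def d1_def d2_def by auto
  have "det2 (L1 e1) (L1 e2) \<noteq> 0"
  proof
    assume 0: "det2 (L1 e1) (L1 e2) = 0"
    then have "det2 (L2 e1) (L2 e2) = 0" using det_eq_0_iff[OF cd y] unfolding L1_def L2_def by blast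
    then have "dim (range L1) = 0" "dim (range L2) = 0"
      using dim_range_less_2[OF lin(1) 0] dim_range_less_2[OF lin(2)] rank by linarith+
    then have "L1 u = 0" "L2 u = 0" for u by auto
    then have "e1 = 0"
      using nondegenerate_in_charts[OF cd y, of e1] f_in[OF cd y]
        bilinear_lzero[OF M1.metric_bilinear[OF d1(1)]] bilinear_lzero[OF M2.metric_bilinear[OF d2(1)]]
      unfolding L1_def L2_def by simp
    then show False by (simp add: axis_eq_0_iff)
  qed
  then show thesis using that[OF cd] y unfolding W_def[OF cd] L1_def by blast
qed

text \<open>The witness must be nonflat on the factor that is known to be generically non-flat, and
  under the second hypothesis on the curvatures this can be either one; hence two versions.\<close>

lemma curvature_nonzero:
  assumes cd: "c \<in> C" "d1 \<in> A1" "d2 \<in> A2" and y: "y \<in> W c d1 d2"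
  shows "generically_non_flat A1 g1 \<Longrightarrow> \<exists>q\<in>topspace S. gauss_curvature A1 g1 (\<phi> q) \<noteq> 0 \<and>
      gauss_curvature A1 g1 (\<phi> q) = \<epsilon> * gauss_curvature A2 g2 (\<psi> q)"
    and "generically_non_flat A2 g2 \<Longrightarrow> \<exists>q\<in>topspace S. gauss_curvature A2 g2 (\<psi> q) \<noteq> 0 \<and>
      gauss_curvature A1 g1 (\<phi> q) = \<epsilon> * gauss_curvature A2 g2 (\<psi> q)"
proof -
  have U: "z \<in> U c d1 d2" if "z \<in> W c d1 d2" for z using that unfolding W_def[OF cd] by simp
  interpret Q1: pullback_patch "chart_map d1 ` chart_dom d1" "tensor_in_chart d1 g1" "W c d1 d2" "coord_expr c d1 \<phi>"
    by (rule pullback_patches[OF cd])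
  interpret Q2: pullback_patch "chart_map d2 ` chart_dom d2" "tensor_in_chart d2 g2" "W c d1 d2" "coord_expr c d2 \<psi>"
    by (rule pullback_patches[OF cd])
  {
    assume "generically_non_flat A1 g1"
    then have N: "negligible (chart_map d1 ` {p \<in> chart_dom d1. \<not> gauss_curvature A1 g1 p \<noteq> 0})"
      using cd unfolding generically_non_flat_def holds_almost_everywhere_def by blast
    have "\<not> negligible (coord_expr c d1 \<phi> ` W c d1 d2)"
      by (rule image_not_negligible[OF Q1.open_W Q1.smooth_map y Q1.regular[OF y]])
    then have "\<not> coord_expr c d1 \<phi> ` W c d1 d2 \<subseteq> chart_map d1 ` {p \<in> chart_dom d1. \<not> gauss_curvature A1 g1 p \<noteq> 0}"
      by (rule contrapos_nn) (rule negligible_subset[OF N])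
    then obtain z where z: "z \<in> W c d1 d2"
        "coord_expr c d1 \<phi> z \<notin> chart_map d1 ` {p \<in> chart_dom d1. \<not> gauss_curvature A1 g1 p \<noteq> 0}"
      by (meson image_subsetI)
    note q = U_point[OF cd U[OF z(1)]]
    have "gauss_curvature A1 g1 (\<phi> (chart_inv c z)) \<noteq> 0"
      using z(2) q(3) unfolding q(5)[symmetric] by auto
    then show "\<exists>q\<in>topspace S. gauss_curvature A1 g1 (\<phi> q) \<noteq> 0 \<and>
      gauss_curvature A1 g1 (\<phi> q) = \<epsilon> * gauss_curvature A2 g2 (\<psi> q)"
      using gauss_curvature_relation[OF cd z(1)] q(7) by blast
  next
    assume "generically_non_flat A2 g2"
    then have N: "negligible (chart_map d2 ` {p \<in> chart_dom d2. \<not> gauss_curvature A2 g2 p \<noteq> 0})"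
      using cd unfolding generically_non_flat_def holds_almost_everywhere_def by blast
    have "\<not> negligible (coord_expr c d2 \<psi> ` W c d1 d2)"
      by (rule image_not_negligible[OF Q2.open_W Q2.smooth_map y Q2.regular[OF y]])
    then have "\<not> coord_expr c d2 \<psi> ` W c d1 d2 \<subseteq> chart_map d2 ` {p \<in> chart_dom d2. \<not> gauss_curvature A2 g2 p \<noteq> 0}"
      by (rule contrapos_nn) (rule negligible_subset[OF N])
    then obtain z where z: "z \<in> W c d1 d2"
        "coord_expr c d2 \<psi> z \<notin> chart_map d2 ` {p \<in> chart_dom d2. \<not> gauss_curvature A2 g2 p \<noteq> 0}"
      by (meson image_subsetI)
    note q = U_point[OF cd U[OF z(1)]]
    have "gauss_curvature A2 g2 (\<psi> (chart_inv c z)) \<noteq> 0"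
      using z(2) q(4) unfolding q(6)[symmetric] by auto
    then show "\<exists>q\<in>topspace S. gauss_curvature A2 g2 (\<psi> q) \<noteq> 0 \<and>
      gauss_curvature A1 g1 (\<phi> q) = \<epsilon> * gauss_curvature A2 g2 (\<psi> q)"
      using gauss_curvature_relation[OF cd z(1)] q(7) by blast
  }
qed

end

theorem theorem3:
  fixes X1 :: "'a topology" and A1 :: "('a, real^2) chart set" and g1 :: "'a tensor2"
    and X2 :: "'b topology" and A2 :: "('b, real^2) chart set" and g2 :: "'b tensor2"
    and \<epsilon> :: real
    and S :: "'c topology" and C :: "('c, real^2) chart set" and \<Phi> :: "'c \<Rightarrow> 'a \<times> 'b"
  assumes "oriented_riemannian_surface X1 A1 g1"
    and "connected_space X1"
    and "geodesically_complete X1 A1 g1"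
    and "oriented_riemannian_surface X2 A2 g2"
    and "connected_space X2"
    and "geodesically_complete X2 A2 g2"
    and "\<epsilon> \<in> {1, -1}"
    and "(generically_non_flat A1 g1 \<and> generically_non_flat A2 g2 \<and>
           (\<forall>x\<in>topspace X1. \<forall>y\<in>topspace X2.
              gauss_curvature A1 g1 x \<noteq> 0 \<longrightarrow> gauss_curvature A2 g2 y \<noteq> 0 \<longrightarrow>
              \<epsilon> * gauss_curvature A1 g1 x * gauss_curvature A2 g2 y < 0))
       \<or> (flat_metric X1 A1 g1 \<and> generically_non_flat A2 g2)
       \<or> (generically_non_flat A1 g1 \<and> flat_metric X2 A2 g2)"
    and "smooth_manifold S C"
    and "immersion S C (prod_topology X1 X2) (prod_atlas A1 A2) \<Phi>"
    and "lagrangian S C (prod_atlas A1 A2) (kahler_product_form \<epsilon> A1 g1 A2 g2) \<Phi>"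
    and "minimal S C (prod_atlas A1 A2) (kahler_product_metric \<epsilon> A1 g1 A2 g2) \<Phi>"
  shows "projected_rank_one S C A1 A2 \<Phi>"
  unfolding projected_rank_one_def
proof (intro ballI, rule ccontr)
  interpret minimal_lagrangian_surface X1 A1 g1 X2 A2 g2 S C \<epsilon> \<Phi>
    using assms unfolding minimal_lagrangian_surface_def minimal_lagrangian_surface_axioms_def immersion_def by blast
  fix p assume "p \<in> topspace S" "\<not> projected_rank_one_at C A1 A2 \<Phi> p"
  then obtain c d1 d2 y where "c \<in> C" "d1 \<in> A1" "d2 \<in> A2" "y \<in> W c d1 d2"
    by (rule curvature_relation_near_higher_rank)
  note K = curvature_nonzero[OF this]
  have top: "\<phi> q \<in> topspace X1" "\<psi> q \<in> topspace X2" if "q \<in> topspace S" for q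
    using \<Phi>_in[OF that] by (auto simp: mem_Times_iff)
  from assms(8) show False
  proof (elim disjE conjE)
    assume "generically_non_flat A1 g1" and neg: "\<forall>x\<in>topspace X1. \<forall>y\<in>topspace X2.
              gauss_curvature A1 g1 x \<noteq> 0 \<longrightarrow> gauss_curvature A2 g2 y \<noteq> 0 \<longrightarrow>
              \<epsilon> * gauss_curvature A1 g1 x * gauss_curvature A2 g2 y < 0"
    then obtain q where q: "q \<in> topspace S" "gauss_curvature A1 g1 (\<phi> q) \<noteq> 0"
      "gauss_curvature A1 g1 (\<phi> q) = \<epsilon> * gauss_curvature A2 g2 (\<psi> q)" using K(1) by blast
    \<comment> \<open>The relation passes nonvanishing to the second factor, so the sign hypothesis
      applies at \<open>q\<close>; but by the same relation the product it declares negative is the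
      square of the first curvature.\<close>
    then have "gauss_curvature A2 g2 (\<psi> q) \<noteq> 0" by auto
    then have "gauss_curvature A1 g1 (\<phi> q) * (\<epsilon> * gauss_curvature A2 g2 (\<psi> q)) < 0"
      using neg top[OF q(1)] q(2) by (metis mult.assoc mult.left_commute)
    then show False unfolding q(3)[symmetric] by (simp add: not_sum_squares_lt_zero mult_less_0_iff)
  next
    assume "flat_metric X1 A1 g1" "generically_non_flat A2 g2"
    \<comment> \<open>The relation forces the other curvature to vanish at the witness too, because
      \<open>\<epsilon>\<close> is not zero.\<close>
    then show False using K(2) top eps unfolding flat_metric_def by fastforce
  next
    assume "generically_non_flat A1 g1" "flat_metric X2 A2 g2"
    then show False using K(1) top unfolding flat_metric_def by fastforce
  qed
qed

end
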